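(* Let $L$ be a number field and $w\in L^*$. The following are equivalent: (i) the extension $L'=L(\sqrt{w})$ is unramified over all prime ideals of $O_L$; (ii) $L'$ and $L$ have the same root discriminant; (iii) there is $\beta\in L^*$ such that $\beta^2w\in 1+4O_L$ and $\beta^2wO_L$ is the square of an ideal $\mathcal{A}$ of $O_L$. Moreover, under these conditions (with $\beta,\mathcal{A}$ as in (iii)), the ring of integers $O_{L'}$ is generated as an $O_L$-module by $1$, $\frac{1+\beta\sqrt{w}}{2}$ and $\mathcal{A}^{-1}\beta\sqrt{w}$, where $\mathcal{A}^{-1}$ is the inverse (fractional) ideal of $\mathcal{A}$.
   Context: For a number field $K$ of degree $n(K)$ with discriminant of absolute value $\Delta(K)$, the root discriminant is $\delta(K)=\Delta(K)^{1/n(K)}$. *)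

theory Defs
  imports
    "HOL-Algebra.Algebraic_Closure_Type"
    "HOL-Algebra.Ideal_Product"
    "HOL-Algebra.Divisibility"
    "HOL-Algebra.Generated_Fields"
    "Jordan_Normal_Form.Determinant"
begin

text \<open>
  Number fields are taken as subfields \<open>K\<close> of an arbitrary ambient field \<open>'a\<close> of
  characteristic 0, regarded as a ring record through \<^const>\<open>ring_of_type_algebra\<close>.
\<close>

interpretation rat_vs: vector_space "\<lambda>(q::rat) (x::'a::field_char_0). of_rat q * x"
  by unfold_locales (simp_all add: algebra_simps of_rat_add of_rat_mult)

definition number_field :: "'a::field_char_0 set \<Rightarrow> bool" where
  "number_field K \<longleftrightarrow>
     subfield K ring_of_type_algebra \<and> (\<exists>B. finite B \<and> rat_vs.span B = K)"

definition degree_nf :: "'a::field_char_0 set \<Rightarrow> nat" where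
  "degree_nf K = rat_vs.dim K"

definition integers_of :: "'a::field_char_0 set \<Rightarrow> 'a set" where
  "integers_of K = {x \<in> K. algebraic_int x}"

definition integer_ring :: "'a::field_char_0 set \<Rightarrow> 'a ring" where
  "integer_ring K = ring_of_type_algebra\<lparr>carrier := integers_of K\<rparr>"

text \<open>
  The trace of the \<open>\<rat>\<close>-linear map \<open>y \<mapsto> x y\<close> on \<open>K\<close>, as the sum of the diagonal entries of its
  matrix in some (hence any) \<open>\<rat>\<close>-basis of \<open>K\<close>.
\<close>

definition field_trace :: "'a::field_char_0 set \<Rightarrow> 'a \<Rightarrow> rat" where
  "field_trace K x =
     (let B = (SOME B. rat_vs.independent B \<and> rat_vs.span B = K)
      in \<Sum>b\<in>B. rat_vs.representation B (x * b) b)"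

definition integral_basis :: "'a::field_char_0 set \<Rightarrow> 'a list \<Rightarrow> bool" where
  "integral_basis K bs \<longleftrightarrow> set bs \<subseteq> integers_of K \<and>
     (\<forall>x\<in>integers_of K. \<exists>!c :: int list. length c = length bs \<and>
        x = (\<Sum>i<length bs. of_int (c ! i) * bs ! i))"

definition discriminant :: "'a::field_char_0 set \<Rightarrow> rat" where
  "discriminant K =
     (let bs = (SOME bs. integral_basis K bs); n = length bs
      in det (mat n n (\<lambda>(i, j). field_trace K (bs ! i * bs ! j))))"

definition root_discriminant :: "'a::field_char_0 set \<Rightarrow> real" where
  "root_discriminant K = real_of_rat \<bar>discriminant K\<bar> powr (1 / real (degree_nf K))"

text \<open>
  The exponent of \<open>Q\<close> in the factorisation of the extended ideal \<open>P O\<^bsub>K'\<^esub>\<close>. The monoid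
  \<^term>\<open>ideals_set R\<close> consists of the ideals of \<open>R\<close> under the ideal product.
\<close>

definition ramification_index ::
    "'a::field_char_0 set \<Rightarrow> 'a set \<Rightarrow> 'a set \<Rightarrow> nat" where
  "ramification_index K' P Q =
     (let R = integer_ring K'
      in GREATEST e. (Q [^]\<^bsub>ideals_set R\<^esub> e) divides\<^bsub>ideals_set R\<^esub> (Idl\<^bsub>R\<^esub> P))"

text \<open>
  The zero ideal, which satisfies \<^const>\<open>primeideal\<close> in a domain, is not among the primes at which
  ramification is considered. Residue fields are finite, hence the residue extensions are
  automatically separable.
\<close>

definition unramified_extension :: "'a::field_char_0 set \<Rightarrow> 'a set \<Rightarrow> bool" where
  "unramified_extension K K' \<longleftrightarrow>
     (\<forall>P Q. primeideal P (integer_ring K) \<and> P \<noteq> {0} \<and>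
            primeideal Q (integer_ring K') \<and> Q \<inter> integers_of K = P \<longrightarrow>
            ramification_index K' P Q = 1)"

definition adjoin :: "'a::field_char_0 set \<Rightarrow> 'a \<Rightarrow> 'a set" where
  "adjoin K s = generate_field ring_of_type_algebra (insert s K)"

definition inverse_ideal :: "'a::field_char_0 set \<Rightarrow> 'a set \<Rightarrow> 'a set" where
  "inverse_ideal K A = {x \<in> K. \<forall>a\<in>A. x * a \<in> integers_of K}"

definition submodule_over :: "'a::field_char_0 set \<Rightarrow> 'a set \<Rightarrow> bool" where
  "submodule_over S M \<longleftrightarrow>
     0 \<in> M \<and> (\<forall>x\<in>M. \<forall>y\<in>M. x + y \<in> M) \<and> (\<forall>r\<in>S. \<forall>x\<in>M. r * x \<in> M)"

definition square_condition ::
    "'a::field_char_0 set \<Rightarrow> 'a \<Rightarrow> 'a \<Rightarrow> 'a set \<Rightarrow> bool" where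
  "square_condition L w \<beta> A \<longleftrightarrow>
     \<beta> \<in> L - {0} \<and>
     \<beta>\<^sup>2 * w \<in> {1 + 4 * x | x. x \<in> integers_of L} \<and>
     ideal A (integer_ring L) \<and>
     PIdl\<^bsub>integer_ring L\<^esub> (\<beta>\<^sup>2 * w) = A [^]\<^bsub>ideals_set (integer_ring L)\<^esub> (2::nat)"

end

theory Submission
  imports Defs "Jordan_Normal_Form.Char_Poly"
begin

text \<open>
  All three conditions are equivalent to the triviality of the relative discriminant of
  \<open>L' = L(s)\<close>. Assume \<open>s \<notin> L\<close> and let \<open>x \<mapsto> cj x\<close> be the conjugation of \<open>L'\<close> over \<open>L\<close>. The
  differences \<open>x - cj x\<close> of integers \<open>x\<close> form a module \<open>C s\<close> with a fractional ideal \<open>C\<close> of \<open>L\<close>, and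
  \<open>D = w C\<^sup>2\<close> is an ideal of \<open>O\<^sub>L\<close>, the relative discriminant.

  A product \<open>(x - cj x) (y - cj y)\<close> is a difference of two traces. So if \<open>D = O\<^sub>L\<close>, then \<open>1\<close> is the
  trace of some integer \<open>y\<close>, and \<open>\<beta> s = y - cj y\<close>, \<open>A = \<beta> w C\<close> satisfy condition (iii); conversely
  (iii) puts \<open>\<beta>\<close> and \<open>2 \<beta> A\<^sup>-\<^sup>1\<close> into \<open>C\<close>, which gives \<open>1 \<in> D\<close>. A prime of \<open>L\<close> ramifies exactly if it
  contains \<open>D\<close>, that is, if conjugation acts trivially modulo a prime above it. A basis of \<open>O\<^sub>L\<close>
  together with integers \<open>x\<^sub>j\<close> such that the \<open>x\<^sub>j - cj x\<^sub>j\<close> form a basis of \<open>C s\<close> is a basis of the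
  integers of \<open>L'\<close>; its trace form has determinant \<open>disc(L)\<^sup>2 N(D)\<close> up to sign, by the
  multiplicativity of the ideal norm \<open>N\<close>.
\<close>

section \<open>Submodules\<close>

text \<open>The primes above \<open>2\<close> shape the argument. There \<open>1\<close> and
  \<open>s\<close> in general do not generate the integers of \<open>L'\<close>, and these need not
  be free over those of \<open>L\<close>, so no local generators are chosen: everything relative is
  expressed by the differences \<open>x - cj x\<close> of all integers, and bases occur only over
  the rational integers and the rationals. The ideal theory rests on one tool, the index of a
  sublattice as the absolute value of a determinant. A strictly larger ideal has a strictly smaller
  index, which drives every induction on ideals; residue rings are finite, which makes nonzero
  primes maximal; and integral closedness enters through elements that stabilise a lattice. The
  \<open>4\<close> in (iii) comes from the identity
  \<open>(y - cj y)^2 = (y + cj y)^2 - 4 y (cj y)\<close> at an integer \<open>y\<close> of trace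
  \<open>1\<close>. In the absolute discriminant the powers of two cancel: the trace of
  \<open>L'\<close> doubles that of \<open>L\<close>, while the \<open>s\<close>-coordinate of an
  integer is half of the coefficient in its difference, so the two blocks of the trace form
  contribute inverse powers of two.\<close>

lemma submodule_overI:
  assumes "0 \<in> M" "\<And>x y. x \<in> M \<Longrightarrow> y \<in> M \<Longrightarrow> x + y \<in> M" "\<And>r x. r \<in> S \<Longrightarrow> x \<in> M \<Longrightarrow> r * x \<in> M"
  shows "submodule_over S M"
  using assms by (simp add: submodule_over_def)

lemma submodule_over_0: "submodule_over S M \<Longrightarrow> 0 \<in> M"
  by (simp add: submodule_over_def)

lemma submodule_over_add: "submodule_over S M \<Longrightarrow> x \<in> M \<Longrightarrow> y \<in> M \<Longrightarrow> x + y \<in> M"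
  by (simp add: submodule_over_def)

lemma submodule_over_mult: "submodule_over S M \<Longrightarrow> r \<in> S \<Longrightarrow> x \<in> M \<Longrightarrow> r * x \<in> M"
  by (simp add: submodule_over_def)

lemma submodule_over_uminus: "submodule_over S M \<Longrightarrow> - 1 \<in> S \<Longrightarrow> x \<in> M \<Longrightarrow> - x \<in> M"
  using submodule_over_mult[of S M "- 1" x] by simp

lemma submodule_over_diff:
  "submodule_over S M \<Longrightarrow> - 1 \<in> S \<Longrightarrow> x \<in> M \<Longrightarrow> y \<in> M \<Longrightarrow> x - y \<in> M"
  using submodule_over_add[of S M x "- y"] submodule_over_uminus[of S M y] by simp

lemma submodule_over_sum:
  "submodule_over S M \<Longrightarrow> (\<And>i. i \<in> I \<Longrightarrow> f i \<in> M) \<Longrightarrow> (\<Sum>i\<in>I. f i) \<in> M"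
  by (induction I rule: infinite_finite_induct) (auto simp: submodule_over_0 submodule_over_add)

lemma submodule_over_subset: "submodule_over S M \<Longrightarrow> T \<subseteq> S \<Longrightarrow> submodule_over T M"
  by (auto simp: submodule_over_def)

lemma submodule_over_hull: "submodule_over S (submodule_over S hull G)"
  by (rule hull_in) (auto simp: submodule_over_def)

lemma submodule_hull_minimal: "G \<subseteq> M \<Longrightarrow> submodule_over S M \<Longrightarrow> submodule_over S hull G \<subseteq> M"
  by (rule hull_minimal)

lemma submodule_over_image_mult: "submodule_over S M \<Longrightarrow> submodule_over S ((*) c ` M)"
  unfolding submodule_over_def image_iff
proof (intro conjI ballI, goal_cases)
  case 1
  then show ?case by (auto intro: bexI[of _ 0])
next
  case (2 x y)
  then obtain a b where "a \<in> M" "b \<in> M" "x = c * a" "y = c * b" by auto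
  with 2 show ?case by (intro bexI[of _ "a + b"]) (auto simp: distrib_left)
next
  case (3 r x)
  then obtain a where "a \<in> M" "x = c * a" by auto
  with 3 show ?case by (intro bexI[of _ "r * a"]) auto
qed

section \<open>Determinants of matrices given by functions\<close>

text \<open>The size is an argument and the entries come from a function, so that products and
  linear combinations are plain finite sums without carrier conditions. Entries outside the
  \<open>n\<close> by \<open>n\<close> square are irrelevant.\<close>

definition fdet :: "nat \<Rightarrow> (nat \<Rightarrow> nat \<Rightarrow> 'b::comm_ring_1) \<Rightarrow> 'b" where
  "fdet n A = det (mat n n (\<lambda>(i, j). A i j))"

lemma fdet_cong:
  assumes "\<And>i j. i < n \<Longrightarrow> j < n \<Longrightarrow> A i j = B i j"
  shows "fdet n A = fdet n B"
  unfolding fdet_def by (rule arg_cong[of _ _ det]) (auto simp: assms)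

lemma fdet_mult: "fdet n (\<lambda>i k. \<Sum>j<n. A i j * B j k) = fdet n A * fdet n B"
proof -
  have "mat n n (\<lambda>(i, k). \<Sum>j<n. A i j * B j k)
      = mat n n (\<lambda>(i, j). A i j) * mat n n (\<lambda>(i, j). B i j)"
    by (rule eq_matI) (auto simp: scalar_prod_def atLeast0LessThan)
  then show ?thesis
    unfolding fdet_def by (simp add: det_mult[of _ n])
qed

lemma fdet_transpose: "fdet n (\<lambda>i j. A j i) = fdet n A"
proof -
  have "mat n n (\<lambda>(i, j). A j i) = transpose_mat (mat n n (\<lambda>(i, j). A i j))"
    by (rule eq_matI) auto
  then show ?thesis
    unfolding fdet_def by (simp add: det_transpose[of _ n])
qed

lemma fdet_one: "fdet n (\<lambda>i j. if i = j then 1 else 0 :: 'b::comm_ring_1) = 1"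
proof -
  have "mat n n (\<lambda>(i, j). if i = j then 1 else 0 :: 'b::comm_ring_1) = 1\<^sub>m n"
    by (rule eq_matI) auto
  then show ?thesis
    unfolding fdet_def by simp
qed

lemma fdet_smult: "fdet n (\<lambda>i j. c * A i j) = c ^ n * fdet n A"
proof -
  have "mat n n (\<lambda>(i, j). c * A i j) = c \<cdot>\<^sub>m mat n n (\<lambda>(i, j). A i j)"
    by (rule eq_matI) auto
  then show ?thesis
    unfolding fdet_def by simp
qed

lemma fdet_of_int: "fdet n (\<lambda>i j. of_int (A i j)) = (of_int (fdet n A) :: 'b::comm_ring_1)"
proof -
  have "mat n n (\<lambda>(i, j). of_int (A i j) :: 'b) = map_mat of_int (mat n n (\<lambda>(i, j). A i j))"
    by (rule eq_matI) auto
  then show ?thesis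
    unfolding fdet_def by (simp add: of_int_hom.hom_det)
qed

lemma fdet_lower_triangular:
  assumes "\<And>i j. i < j \<Longrightarrow> j < n \<Longrightarrow> A i j = 0"
  shows "fdet n A = (\<Prod>i<n. A i i)"
proof -
  have "fdet n A = prod_list (diag_mat (mat n n (\<lambda>(i, j). A i j)))"
    unfolding fdet_def by (rule det_lower_triangular[of n]) (auto simp: assms)
  also have "\<dots> = (\<Prod>i<n. A i i)"
    by (simp add: prod_list_diag_prod atLeast0LessThan)
  finally show ?thesis .
qed

text \<open>\<open>B\<close> is the adjugate. As no division occurs, the identity also serves over
  the integers, where it later bounds denominators by the determinant.\<close>

lemma fdet_adjugate:
  obtains B where
    "\<And>i k. i < n \<Longrightarrow> k < n \<Longrightarrow> (\<Sum>j<n. B i j * A j k) = (if i = k then fdet n A else 0)"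
proof -
  let ?A = "mat n n (\<lambda>(i, j). A i j)"
  have adj: "adj_mat ?A \<in> carrier_mat n n" "adj_mat ?A * ?A = det ?A \<cdot>\<^sub>m 1\<^sub>m n"
    using adj_mat[of ?A n] by auto
  have "(\<Sum>j<n. adj_mat ?A $$ (i, j) * A j k) = (if i = k then fdet n A else 0)"
    if "i < n" "k < n" for i k
  proof -
    have "(\<Sum>j<n. adj_mat ?A $$ (i, j) * A j k) = (adj_mat ?A * ?A) $$ (i, k)"
      using that adj(1) by (auto simp: scalar_prod_def atLeast0LessThan)
    also have "\<dots> = (if i = k then fdet n A else 0)"
      using that by (subst adj(2)) (simp add: fdet_def)
    finally show ?thesis .
  qed
  then show ?thesis
    using that[of "\<lambda>i j. adj_mat ?A $$ (i, j)"] by blast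
qed

section \<open>Spans over the integers and over the rationals\<close>

text \<open>Families indexed by the numbers below \<open>n\<close> are used in place of sets, so
  that the passage from one family to another is a matrix in the sense of
  \<open>fdet\<close>.\<close>

definition zspan :: "nat \<Rightarrow> (nat \<Rightarrow> 'a::field_char_0) \<Rightarrow> 'a set" where
  "zspan n e = {x. \<exists>c::nat \<Rightarrow> int. x = (\<Sum>i<n. of_int (c i) * e i)}"

definition qspan :: "nat \<Rightarrow> (nat \<Rightarrow> 'a::field_char_0) \<Rightarrow> 'a set" where
  "qspan n e = {x. \<exists>c::nat \<Rightarrow> rat. x = (\<Sum>i<n. of_rat (c i) * e i)}"

definition qindep :: "nat \<Rightarrow> (nat \<Rightarrow> 'a::field_char_0) \<Rightarrow> bool" where
  "qindep n e \<longleftrightarrow> (\<forall>c::nat \<Rightarrow> rat. (\<Sum>i<n. of_rat (c i) * e i) = 0 \<longrightarrow> (\<forall>i<n. c i = 0))"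

lemma zspanI: "x = (\<Sum>i<n. of_int (c i) * e i) \<Longrightarrow> x \<in> zspan n e"
  by (auto simp: zspan_def)

lemma qspanI: "x = (\<Sum>i<n. of_rat (c i) * e i) \<Longrightarrow> x \<in> qspan n e"
  by (auto simp: qspan_def)

lemma zspanE:
  assumes "x \<in> zspan n e"
  obtains c where "x = (\<Sum>i<n. of_int (c i) * e i)"
  using assms by (auto simp: zspan_def)

lemma qspanE:
  assumes "x \<in> qspan n e"
  obtains c where "x = (\<Sum>i<n. of_rat (c i) * e i)"
  using assms by (auto simp: qspan_def)

lemma zspan_base: "i < n \<Longrightarrow> e i \<in> zspan n e"
  by (rule zspanI[of _ "\<lambda>j. if j = i then 1 else 0"]) (simp add: if_distrib[of of_int] if_distrib[of "\<lambda>x. x * _"] cong: if_cong)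

lemma qspan_base: "i < n \<Longrightarrow> e i \<in> qspan n e"
  by (rule qspanI[of _ "\<lambda>j. if j = i then 1 else 0"]) (simp add: if_distrib[of of_rat] if_distrib[of "\<lambda>x. x * _"] cong: if_cong)

lemma submodule_over_zspan: "submodule_over \<int> (zspan n e)"
  unfolding submodule_over_def
proof (intro conjI ballI)
  show "0 \<in> zspan n e"
    by (rule zspanI[of _ "\<lambda>_. 0"]) simp
next
  fix x y assume "x \<in> zspan n e" "y \<in> zspan n e"
  then obtain c d where "x = (\<Sum>i<n. of_int (c i) * e i)" "y = (\<Sum>i<n. of_int (d i) * e i)"
    by (metis zspanE)
  then show "x + y \<in> zspan n e"
    by (intro zspanI[of _ "\<lambda>i. c i + d i"]) (simp add: sum.distrib algebra_simps)
next
  fix r x :: 'a assume "r \<in> \<int>" "x \<in> zspan n e"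
  then obtain k c where "r = of_int k" "x = (\<Sum>i<n. of_int (c i) * e i)"
    by (metis Ints_cases zspanE)
  then show "r * x \<in> zspan n e"
    by (intro zspanI[of _ "\<lambda>i. k * c i"]) (simp add: sum_distrib_left algebra_simps)
qed

lemma submodule_over_qspan: "submodule_over \<rat> (qspan n e)"
  unfolding submodule_over_def
proof (intro conjI ballI)
  show "0 \<in> qspan n e"
    by (rule qspanI[of _ "\<lambda>_. 0"]) simp
next
  fix x y assume "x \<in> qspan n e" "y \<in> qspan n e"
  then obtain c d where "x = (\<Sum>i<n. of_rat (c i) * e i)" "y = (\<Sum>i<n. of_rat (d i) * e i)"
    by (metis qspanE)
  then show "x + y \<in> qspan n e"
    by (intro qspanI[of _ "\<lambda>i. c i + d i"]) (simp add: sum.distrib algebra_simps of_rat_add)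
next
  fix r x :: 'a assume "r \<in> \<rat>" "x \<in> qspan n e"
  then obtain k c where "r = of_rat k" "x = (\<Sum>i<n. of_rat (c i) * e i)"
    by (metis Rats_cases qspanE)
  then show "r * x \<in> qspan n e"
    by (intro qspanI[of _ "\<lambda>i. k * c i"]) (simp add: sum_distrib_left algebra_simps of_rat_mult)
qed

lemma zspan_subset:
  assumes "submodule_over \<int> M" "\<And>i. i < n \<Longrightarrow> e i \<in> M"
  shows "zspan n e \<subseteq> M"
  using assms by (auto elim!: zspanE intro!: submodule_over_sum submodule_over_mult)

lemma qspan_subset:
  assumes "submodule_over \<rat> M" "\<And>i. i < n \<Longrightarrow> e i \<in> M"
  shows "qspan n e \<subseteq> M"
  using assms by (auto elim!: qspanE intro!: submodule_over_sum submodule_over_mult)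

lemma zspan_subset_qspan: "zspan n e \<subseteq> qspan n e"
  by (intro zspan_subset submodule_over_subset[OF submodule_over_qspan] qspan_base)
     (auto simp: Ints_def)

lemma zspan_Suc:
  "x \<in> zspan (Suc k) e \<longleftrightarrow> (\<exists>c::int. \<exists>v\<in>zspan k e. x = of_int c * e k + v)"
proof
  assume "x \<in> zspan (Suc k) e"
  then obtain c where "x = (\<Sum>i<Suc k. of_int (c i) * e i)"
    by (rule zspanE)
  then show "\<exists>c::int. \<exists>v\<in>zspan k e. x = of_int c * e k + v"
    by (intro exI[of _ "c k"] bexI[of _ "\<Sum>i<k. of_int (c i) * e i"]) (auto intro: zspanI)
next
  assume "\<exists>c::int. \<exists>v\<in>zspan k e. x = of_int c * e k + v"
  then obtain c b where "x = of_int c * e k + (\<Sum>i<k. of_int (b i) * e i)"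
    by (auto elim!: zspanE)
  then show "x \<in> zspan (Suc k) e"
    by (intro zspanI[of _ "b(k := c)"]) simp
qed

lemma zspan_family:
  assumes "\<And>i. i < m \<Longrightarrow> f i \<in> zspan n e"
  obtains A where "\<And>i. i < m \<Longrightarrow> f i = (\<Sum>j<n. of_int (A i j) * e j)"
proof -
  have "\<forall>i. \<exists>c. i < m \<longrightarrow> f i = (\<Sum>j<n. of_int (c j) * e j)"
    using assms by (metis zspanE)
  then show ?thesis
    using that by metis
qed

lemma qspan_family:
  assumes "\<And>i. i < m \<Longrightarrow> f i \<in> qspan n e"
  obtains A where "\<And>i. i < m \<Longrightarrow> f i = (\<Sum>j<n. of_rat (A i j) * e j)"
proof -
  have "\<forall>i. \<exists>c. i < m \<longrightarrow> f i = (\<Sum>j<n. of_rat (c j) * e j)"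
    using assms by (metis qspanE)
  then show ?thesis
    using that by metis
qed

lemma qindep_eq:
  assumes "qindep n e" "(\<Sum>i<n. of_rat (c i) * e i) = (\<Sum>i<n. of_rat (d i) * e i)" "i < n"
  shows "c i = d i"
proof -
  have "(\<Sum>i<n. of_rat (c i - d i) * e i) = 0"
    using assms(2) by (simp add: of_rat_diff left_diff_distrib sum_subtractf)
  then have "c i - d i = 0"
    using assms(1,3) unfolding qindep_def by (elim allE[of _ "\<lambda>i. c i - d i"]) auto
  then show ?thesis by simp
qed

lemma qindep_eq_int:
  assumes "qindep n e" "(\<Sum>i<n. of_int (c i) * e i) = (\<Sum>i<n. of_int (d i) * e i)" "i < n"
  shows "c i = d i"
  using qindep_eq[OF assms(1), of "\<lambda>i. of_int (c i)" "\<lambda>i. of_int (d i)" i] assms(2,3) by simp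

lemma qindep_nonzero: "qindep n e \<Longrightarrow> i < n \<Longrightarrow> e i \<noteq> 0"
  unfolding qindep_def
  by (auto dest!: spec[of _ "\<lambda>j. if j = i then 1 else 0"]
      simp: if_distrib[of of_rat] if_distrib[of "\<lambda>x. x * _"] cong: if_cong)

lemma sum_swap_matrix:
  fixes c :: "nat \<Rightarrow> 'b::comm_semiring_0" and m n :: nat
  shows "(\<Sum>i<m. c i * (\<Sum>j<n. A i j * e j)) = (\<Sum>j<n. (\<Sum>i<m. c i * A i j) * e j)"
proof -
  have "(\<Sum>i<m. c i * (\<Sum>j<n. A i j * e j)) = (\<Sum>i<m. \<Sum>j<n. c i * A i j * e j)"
    by (simp add: sum_distrib_left mult.assoc)
  also have "\<dots> = (\<Sum>j<n. (\<Sum>i<m. c i * A i j) * e j)"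
    by (subst sum.swap) (simp add: sum_distrib_right)
  finally show ?thesis .
qed

lemma sum_swap_of_int:
  fixes m n :: nat
  shows "(\<Sum>i<m. of_int (c i) * (\<Sum>j<n. of_int (A i j) * e j))
    = (\<Sum>j<n. of_int (\<Sum>i<m. c i * A i j) * (e j :: 'a::comm_ring_1))"
  using sum_swap_matrix[where c = "\<lambda>i. of_int (c i)" and A = "\<lambda>i j. of_int (A i j)" and e = e and m = m and n = n] by simp

lemma sum_swap_of_rat:
  fixes m n :: nat
  shows "(\<Sum>i<m. of_rat (c i) * (\<Sum>j<n. of_rat (A i j) * e j))
    = (\<Sum>j<n. of_rat (\<Sum>i<m. c i * A i j) * (e j :: 'a::field_char_0))"
  using sum_swap_matrix[where c = "\<lambda>i. of_rat (c i)" and A = "\<lambda>i j. of_rat (A i j)" and e = e and m = m and n = n]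
  by (simp add: of_rat_sum of_rat_mult)

text \<open>Cramer's rule: the adjugate divided by the determinant expresses \<open>e\<close>
  through \<open>f\<close>.\<close>

lemma qspan_nonsingular:
  assumes f: "\<And>i. i < n \<Longrightarrow> f i = (\<Sum>j<n. of_rat (A i j) * e j)" and A: "fdet n A \<noteq> 0"
  shows "qspan n f = qspan n e"
proof
  show "qspan n f \<subseteq> qspan n e"
    by (rule qspan_subset[OF submodule_over_qspan]) (auto intro: qspanI f)
  obtain B where B: "\<And>i k. i < n \<Longrightarrow> k < n \<Longrightarrow> (\<Sum>j<n. B i j * A j k) = (if i = k then fdet n A else 0)"
    by (rule fdet_adjugate[of n A]) blast
  have "e i \<in> qspan n f" if "i < n" for i
  proof (rule qspanI[of _ "\<lambda>j. B i j / fdet n A"])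
    have "(\<Sum>j<n. of_rat (B i j / fdet n A) * f j)
        = (\<Sum>j<n. of_rat (B i j / fdet n A) * (\<Sum>k<n. of_rat (A j k) * e k))"
      by (rule sum.cong) (auto simp: f)
    also have "\<dots> = (\<Sum>k<n. of_rat (\<Sum>j<n. B i j / fdet n A * A j k) * e k)"
      by (rule sum_swap_of_rat)
    also have "\<dots> = (\<Sum>k<n. (if i = k then 1 else 0) * e k)"
    proof (rule sum.cong)
      fix k assume "k \<in> {..<n}"
      have "(\<Sum>j<n. B i j / fdet n A * A j k) = (\<Sum>j<n. B i j * A j k) / fdet n A"
        by (simp add: sum_divide_distrib)
      then show "of_rat (\<Sum>j<n. B i j / fdet n A * A j k) * e k = (if i = k then 1 else 0) * e k"
        using \<open>i < n\<close> \<open>k \<in> {..<n}\<close> A by (simp add: B)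
    qed simp
    also have "\<dots> = e i"
      using \<open>i < n\<close> by (simp add: if_distrib[of "\<lambda>x. x * _"] cong: if_cong)
    finally show "e i = (\<Sum>j<n. of_rat (B i j / fdet n A) * f j)" ..
  qed
  then show "qspan n e \<subseteq> qspan n f"
    by (rule qspan_subset[OF submodule_over_qspan])
qed

text \<open>The product of the matrices \<open>B\<close> and \<open>A\<close> lists the coordinates
  of the \<open>e i\<close> with respect to \<open>e\<close> itself.\<close>

lemma qindep_left_inverse:
  assumes e: "qindep n e" and f: "\<And>i. i < n \<Longrightarrow> f i = (\<Sum>j<n. of_rat (A i j) * e j)"
    and e_f: "\<And>i. i < n \<Longrightarrow> e i = (\<Sum>j<n. of_rat (B i j) * f j)" and ik: "i < n" "k < n"
  shows "(\<Sum>j<n. B i j * A j k) = (if i = k then 1 else 0)"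
proof -
  have "(\<Sum>k<n. of_rat (\<Sum>j<n. B i j * A j k) * e k) = (\<Sum>j<n. of_rat (B i j) * (\<Sum>k<n. of_rat (A j k) * e k))"
    by (rule sum_swap_of_rat[symmetric])
  also have "\<dots> = (\<Sum>j<n. of_rat (B i j) * f j)"
    by (rule sum.cong) (auto simp: f)
  also have "\<dots> = e i"
    using e_f[OF ik(1)] by simp
  also have "\<dots> = (\<Sum>k<n. of_rat (if i = k then 1 else 0) * e k)"
    using ik by (simp add: if_distrib[of of_rat] if_distrib[of "\<lambda>x. x * _"] cong: if_cong)
  finally show ?thesis
    by (rule qindep_eq[OF e _ ik(2)])
qed

lemma qindep_nonsingular:
  assumes e: "qindep n e" and f: "\<And>i. i < n \<Longrightarrow> f i = (\<Sum>j<n. of_rat (A i j) * e j)"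
    and A: "fdet n A \<noteq> 0"
  shows "qindep n f"
  unfolding qindep_def
proof (intro allI impI)
  fix c :: "nat \<Rightarrow> rat" and i assume c: "(\<Sum>i<n. of_rat (c i) * f i) = 0" and "i < n"
  \<comment> \<open>The coefficients multiply \<open>A\<close> from the left, so a right inverse up
    to the factor \<open>fdet n A\<close> is wanted; it comes from the adjugate of the
    transpose.\<close>
  obtain B where B: "\<And>i k. i < n \<Longrightarrow> k < n \<Longrightarrow> (\<Sum>j<n. B i j * A k j) = (if i = k then fdet n A else 0)"
    using fdet_adjugate[of n "\<lambda>i j. A j i"] unfolding fdet_transpose[of n A] by metis
  have "(\<Sum>j<n. of_rat (\<Sum>i<n. c i * A i j) * e j) = (\<Sum>i<n. of_rat (c i) * (\<Sum>j<n. of_rat (A i j) * e j))"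
    by (rule sum_swap_of_rat[symmetric])
  also have "\<dots> = (\<Sum>i<n. of_rat (c i) * f i)"
    by (rule sum.cong) (auto simp: f)
  finally have "(\<Sum>j<n. of_rat (\<Sum>i<n. c i * A i j) * e j) = 0"
    by (simp add: c)
  then have zero: "\<forall>j<n. (\<Sum>i<n. c i * A i j) = 0"
    using e unfolding qindep_def by (elim allE[of _ "\<lambda>j. \<Sum>i<n. c i * A i j"]) auto
  have "0 = (\<Sum>j<n. B i j * (\<Sum>k<n. c k * A k j))"
    using zero by simp
  also have "\<dots> = (\<Sum>k<n. c k * (\<Sum>j<n. B i j * A k j))"
    by (simp add: sum_distrib_left mult.left_commute) (rule sum.swap)
  also have "\<dots> = c i * fdet n A"
    using \<open>i < n\<close> by (simp add: B if_distrib[of "\<lambda>x. _ * x"] cong: if_cong)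
  finally show "c i = 0"
    using A by simp
qed

lemma fdet_nonzero_of_basis:
  assumes e: "qindep n e" and f: "\<And>i. i < n \<Longrightarrow> f i = (\<Sum>j<n. of_rat (A i j) * e j)"
    and sp: "\<And>i. i < n \<Longrightarrow> e i \<in> qspan n f"
  shows "fdet n A \<noteq> 0"
proof -
  obtain B where B: "\<And>i. i < n \<Longrightarrow> e i = (\<Sum>j<n. of_rat (B i j) * f j)"
    using qspan_family[of n e n f] sp by metis
  have "fdet n B * fdet n A = fdet n (\<lambda>i k. if i = k then 1 else 0)"
    unfolding fdet_mult[symmetric] using qindep_left_inverse[OF e f B] by (intro fdet_cong) auto
  then show ?thesis
    by (auto simp: fdet_one)
qed

text \<open>Both transition matrices are integral and their product is the identity, so the
  determinant divides \<open>1\<close>.\<close>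

lemma unimodular_of_zspan_eq:
  assumes e: "qindep n e" and eq: "zspan n f = zspan n e"
    and f: "\<And>i. i < n \<Longrightarrow> f i = (\<Sum>j<n. of_int (A i j) * e j)"
  shows "\<bar>fdet n A\<bar> = 1"
proof -
  obtain B where B: "\<And>i. i < n \<Longrightarrow> e i = (\<Sum>j<n. of_int (B i j) * f j)"
    using zspan_family[of n e n f] zspan_base[of _ n e] eq by metis
  have "of_int (\<Sum>j<n. B i j * A j k) = (of_int (if i = k then 1 else 0) :: rat)" if "i < n" "k < n" for i k
    using qindep_left_inverse[OF e, of f "\<lambda>i j. of_int (A i j)" "\<lambda>i j. of_int (B i j)"] f B that
    by simp
  then have BA: "(\<Sum>j<n. B i j * A j k) = (if i = k then 1 else 0)" if "i < n" "k < n" for i k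
    using that of_int_eq_iff by blast
  have "fdet n B * fdet n A = fdet n (\<lambda>i k. if i = k then 1 else 0)"
    unfolding fdet_mult[symmetric] by (rule fdet_cong) (rule BA)
  then have "fdet n A dvd 1"
    by (metis fdet_one dvdI mult.commute)
  then show ?thesis
    by simp
qed

section \<open>Sublattices of full rank\<close>

text \<open>The index of \<open>J\<close> in \<open>M\<close>; the coset of \<open>x\<close> is
  written as \<open>{y. y - x \<in> J}\<close>. Since \<open>card\<close> of an infinite set is
  \<open>0\<close>, \<open>qidx M J > 0\<close> also says that the index is finite.\<close>

definition qidx :: "'a::field_char_0 set \<Rightarrow> 'a set \<Rightarrow> nat" where
  "qidx M J = card ((\<lambda>x. {y. y - x \<in> J}) ` M)"

text \<open>Echelon form: the leading coefficient of \<open>f k\<close> is the least positive one that occurs in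
  \<open>J \<inter> zspan (Suc k) e\<close>, so division with remainder reduces the leading coefficient of every
  other element to \<open>0\<close>.\<close>

lemma triangular_basis:
  fixes e :: "nat \<Rightarrow> 'a::field_char_0"
  assumes J: "submodule_over \<int> J" "J \<subseteq> zspan n e"
    and full: "\<And>k. k < n \<Longrightarrow> \<exists>m::int. m > 0 \<and> of_int m * e k \<in> J"
  obtains d :: "nat \<Rightarrow> int" and f where
    "\<And>k. k < n \<Longrightarrow> d k > 0"
    "\<And>k. k < n \<Longrightarrow> \<exists>v\<in>zspan k e. f k = of_int (d k) * e k + v"
    "J = zspan n f"
proof -
  define P where "P k d f \<longleftrightarrow> d > 0 \<and> f \<in> J \<and> (\<exists>v\<in>zspan k e. f = of_int (int d) * e k + v)"
    for k and d :: nat and f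
  have ex: "\<exists>d f. P k d f" if k: "k < n" for k
  proof -
    obtain m :: int where m: "m > 0" "of_int m * e k \<in> J"
      using full[OF k] by auto
    then have "P k (nat m) (of_int m * e k)"
      using submodule_over_0[OF submodule_over_zspan[of k e]] unfolding P_def by auto
    then show ?thesis by blast
  qed
  define d where "d k = (LEAST d. \<exists>f. P k d f)" for k
  have "\<exists>f. P k (d k) f" if "k < n" for k
    using LeastI_ex[of "\<lambda>d. \<exists>f. P k d f"] ex[OF that] unfolding d_def by blast
  then obtain f where f: "P k (d k) (f k)" if "k < n" for k
    by metis
  have least: "d k \<le> d'" if "P k d' f'" for k d' f'
    unfolding d_def by (rule Least_le) (use that in blast)
  have minus1: "- 1 \<in> (\<int> :: 'a set)"
    by simp
  have echelon: "x \<in> zspan k f" if "k \<le> n" "x \<in> J" "x \<in> zspan k e" for k x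
    using that
  proof (induction k arbitrary: x)
    case 0
    then show ?case by (auto simp: zspan_def)
  next
    case (Suc k)
    then obtain c v where v: "v \<in> zspan k e" and x: "x = of_int c * e k + v"
      by (auto simp: zspan_Suc)
    obtain u where u: "u \<in> zspan k e" "f k = of_int (int (d k)) * e k + u" and dk: "d k > 0" "f k \<in> J"
      using f[of k] Suc.prems(1) unfolding P_def by auto
    define q where "q = c div int (d k)"
    define y where "y = x - of_int q * f k"
    have qf: "of_int q * f k \<in> J"
      by (rule submodule_over_mult[OF J(1)]) (use dk in auto)
    then have yJ: "y \<in> J"
      unfolding y_def using Suc.prems(2) by (intro submodule_over_diff[OF J(1) minus1])
    have vu: "v - of_int q * u \<in> zspan k e"
      by (intro submodule_over_diff[OF submodule_over_zspan minus1] v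
          submodule_over_mult[OF submodule_over_zspan] u) simp
    have "c = int (d k) * q + c mod int (d k)"
      by (simp add: q_def)
    then have "(of_int c :: 'a) = of_int (int (d k)) * of_int q + of_int (c mod int (d k))"
      by (metis of_int_add of_int_mult)
    then have y: "y = of_int (c mod int (d k)) * e k + (v - of_int q * u)"
      unfolding y_def x u(2) by (simp add: algebra_simps)
    have "c mod int (d k) = 0"
    proof (rule ccontr)
      assume "c mod int (d k) \<noteq> 0"
      moreover have "c mod int (d k) \<ge> 0" "c mod int (d k) < int (d k)"
        using dk by simp_all
      ultimately have "P k (nat (c mod int (d k))) y"
        unfolding P_def using yJ vu y by auto
      from least[OF this] show False
        using \<open>c mod int (d k) < int (d k)\<close> \<open>c mod int (d k) \<ge> 0\<close> by linarith
    qed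
    then have "y \<in> zspan k e"
      using y vu by simp
    then have "y \<in> zspan k f"
      using Suc.IH yJ Suc.prems(1) by simp
    then show ?case
      unfolding zspan_Suc using y_def by (intro exI[of _ q] bexI[of _ y]) auto
  qed
  have sub: "zspan n f \<subseteq> J"
    by (rule zspan_subset[OF J(1)]) (use f in \<open>auto simp: P_def\<close>)
  show thesis
  proof (rule that[of "\<lambda>k. int (d k)" f])
    show "J = zspan n f"
      using echelon[of n] J(2) sub by auto
  qed (use f in \<open>auto simp: P_def\<close>)
qed

text \<open>The remainder vectors with \<open>0 \<le> r i < d i\<close> represent each coset once.
  Division by the leading coefficients \<open>d k\<close>, from the last index down, finds the
  representative; comparing leading coefficients in the same order shows that it is unique.\<close>

lemma qidx_triangular:
  assumes e: "qindep n e"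
    and d: "\<And>k. k < n \<Longrightarrow> d k > 0"
    and f: "\<And>k. k < n \<Longrightarrow> \<exists>v\<in>zspan k e. f k = of_int (d k) * e k + v"
  shows "qidx (zspan n e) (zspan n f) = (\<Prod>k<n. nat (d k))"
proof -
  let ?coset = "\<lambda>x. {y. y - x \<in> zspan n f}"
  let ?R = "\<lambda>k. PiE {..<k} (\<lambda>i. {0..<d i})"
  let ?s = "\<lambda>k r. \<Sum>i<k. of_int (r i) * e i"
  have minus1: "- 1 \<in> (\<int> :: 'a set)"
    by simp
  have surj: "\<exists>r\<in>?R k. x - ?s k r \<in> zspan k f" if "k \<le> n" "x \<in> zspan k e" for k x
    using that
  proof (induction k arbitrary: x)
    case 0
    then show ?case by (auto simp: zspan_def)
  next
    case (Suc k)
    then obtain c v where v: "v \<in> zspan k e" and x: "x = of_int c * e k + v"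
      by (auto simp: zspan_Suc)
    obtain u where u: "u \<in> zspan k e" "f k = of_int (d k) * e k + u" and dk: "d k > 0"
      using f[of k] d[of k] Suc.prems(1) by auto
    define q where "q = c div d k"
    have vu: "v - of_int q * u \<in> zspan k e"
      by (intro submodule_over_diff[OF submodule_over_zspan minus1] v
          submodule_over_mult[OF submodule_over_zspan] u) simp
    obtain r where r: "r \<in> ?R k" "v - of_int q * u - ?s k r \<in> zspan k f"
      using Suc.IH[OF _ vu] Suc.prems(1) by auto
    have "(of_int c :: 'a) = of_int (d k) * of_int q + of_int (c mod d k)"
      unfolding q_def by (metis of_int_add of_int_mult mult_div_mod_eq)
    then have "x - ?s (Suc k) (r(k := c mod d k)) = of_int q * f k + (v - of_int q * u - ?s k r)"
      unfolding x u(2) by (simp add: algebra_simps)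
    then have "x - ?s (Suc k) (r(k := c mod d k)) \<in> zspan (Suc k) f"
      using r(2) unfolding zspan_Suc by blast
    moreover have "r(k := c mod d k) \<in> ?R (Suc k)"
      using r(1) dk by (auto simp: PiE_iff lessThan_Suc extensional_def less_Suc_eq)
    ultimately show ?case by blast
  qed
  have inj: "\<forall>i<k. r i = r' i"
    if "k \<le> n" "\<forall>i<k. 0 \<le> r i \<and> r i < d i" "\<forall>i<k. 0 \<le> r' i \<and> r' i < d i"
      "?s k r - ?s k r' \<in> zspan k f" for k r r'
    using that
  proof (induction k)
      case 0
      then show ?case by simp
    next
      case (Suc k)
      obtain u where u: "u \<in> zspan k e" "f k = of_int (d k) * e k + u" and dk: "d k > 0"
        using f[of k] d[of k] Suc.prems(1) by auto
      obtain c z where z: "z \<in> zspan k f" and eq: "?s (Suc k) r - ?s (Suc k) r' = of_int c * f k + z"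
        using Suc.prems(4) by (auto simp: zspan_Suc)
      have zspan_s: "?s k t \<in> zspan k e" for t
        by (rule zspanI) simp
      have "f i \<in> zspan k e" if "i < k" for i
      proof -
        obtain v where v: "v \<in> zspan i e" "f i = of_int (d i) * e i + v"
          using f[of i] \<open>i < k\<close> Suc.prems(1) by auto
        have "zspan i e \<subseteq> zspan k e"
          by (rule zspan_subset[OF submodule_over_zspan]) (use \<open>i < k\<close> in \<open>auto intro: zspan_base\<close>)
        then show ?thesis
          unfolding v(2) using v(1) \<open>i < k\<close>
          by (intro submodule_over_add[OF submodule_over_zspan] submodule_over_mult[OF submodule_over_zspan]
              zspan_base) auto
      qed
      then have "z \<in> zspan k e"
        using zspan_subset[OF submodule_over_zspan, of k f k e] z by auto
      then have "of_int c * u + z - (?s k r - ?s k r') \<in> zspan k e"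
        using u(1) by (intro submodule_over_diff[OF submodule_over_zspan minus1]
            submodule_over_add[OF submodule_over_zspan] submodule_over_mult[OF submodule_over_zspan]
            zspan_s) auto
      then obtain b where b: "of_int c * u + z - (?s k r - ?s k r') = ?s k b"
        by (rule zspanE)
      have "?s k b + of_int (c * d k - (r k - r' k)) * e k = 0"
        using eq unfolding b[symmetric] u(2) by (simp add: algebra_simps)
      then have "?s (Suc k) (b(k := c * d k - (r k - r' k))) = 0"
        by simp
      \<comment> \<open>Independence is given for the full family, so the relation is padded with
        zeros up to \<open>n\<close>.\<close>
      then have "(\<Sum>i<n. of_int (if i \<le> k then (b(k := c * d k - (r k - r' k))) i else 0) * e i) = 0"
        using sum.mono_neutral_right[of "{..<n}" "{..<Suc k}"
            "\<lambda>i. of_int (if i \<le> k then (b(k := c * d k - (r k - r' k))) i else 0) * e i"] Suc.prems(1)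
        by auto
      then have "c * d k = r k - r' k"
        using qindep_eq_int[OF e, of "\<lambda>i. if i \<le> k then (b(k := c * d k - (r k - r' k))) i else 0" "\<lambda>_. 0" k]
          Suc.prems(1) by auto
      \<comment> \<open>Two remainders modulo \<open>d k\<close> whose difference is a multiple of
        \<open>d k\<close> must coincide.\<close>
      moreover have "\<bar>r k - r' k\<bar> < d k"
        using Suc.prems(2,3)[rule_format, of k] by auto
      ultimately have "c = 0"
        using dk by (smt (verit) mult_le_cancel_right1 mult_minus_left)
      then have rk: "r k = r' k"
        using \<open>c * d k = r k - r' k\<close> by simp
      then have "?s k r - ?s k r' \<in> zspan k f"
        using eq \<open>c = 0\<close> z by simp
      then have "\<forall>i<k. r i = r' i"
        using Suc.prems(2,3) by (intro Suc.IH Suc_leD[OF Suc.prems(1)]) (auto simp del: sum.lessThan_Suc)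
      with rk show ?case
        by (simp add: less_Suc_eq)
  qed
  have "(\<lambda>x. ?coset x) ` zspan n e = (\<lambda>r. ?coset (?s n r)) ` ?R n"
  proof -
    have "\<exists>r\<in>?R n. ?coset x = ?coset (?s n r)" if x: "x \<in> zspan n e" for x
    proof -
      obtain r where r: "r \<in> ?R n" "x - ?s n r \<in> zspan n f"
        using surj[OF le_refl x] by blast
      have "y - x \<in> zspan n f \<longleftrightarrow> y - ?s n r \<in> zspan n f" for y
        using submodule_over_add[OF submodule_over_zspan _ r(2), of "y - x"]
          submodule_over_diff[OF submodule_over_zspan minus1 _ r(2), of "y - ?s n r"] by auto
      then show ?thesis using r(1) by auto
    qed
    then have "?coset x \<in> (\<lambda>r. ?coset (?s n r)) ` ?R n" if "x \<in> zspan n e" for x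
      using that unfolding image_iff .
    moreover have "?coset (?s n r) \<in> ?coset ` zspan n e" for r
      by (rule imageI) (rule zspanI, simp)
    ultimately show ?thesis
      by (intro subset_antisym image_subsetI)
  qed
  moreover have "inj_on (\<lambda>r. ?coset (?s n r)) (?R n)"
  proof (rule inj_onI)
    fix r r' assume r: "r \<in> ?R n" "r' \<in> ?R n" "?coset (?s n r) = ?coset (?s n r')"
    then have "?s n r - ?s n r' \<in> zspan n f"
      using submodule_over_0[OF submodule_over_zspan, of n f] by (auto simp: set_eq_iff)
    then have "\<forall>i<n. r i = r' i"
      using r(1,2) by (intro inj) (auto simp: PiE_iff)
    then show "r = r'"
      using r(1,2) by (intro PiE_ext[of r _ _ r']) auto
  qed
  ultimately have "qidx (zspan n e) (zspan n f) = card (?R n)"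
    unfolding qidx_def by (simp add: card_image)
  also have "\<dots> = (\<Prod>k<n. nat (d k))"
    by (simp add: card_PiE)
  finally show ?thesis .
qed

text \<open>For an echelon basis \<open>f\<close> of \<open>J\<close> the matrix is triangular with
  the \<open>d k\<close> on the diagonal, and their product is the index by
  \<open>qidx_triangular\<close>. The given generators \<open>g\<close> differ from \<open>f\<close>
  by a unimodular matrix, which leaves the absolute value unchanged.\<close>

lemma qidx_zspan:
  assumes e: "qindep n e" and J: "J = zspan n g"
    and g: "\<And>i. i < n \<Longrightarrow> g i = (\<Sum>j<n. of_int (G i j) * e j)"
    and full: "\<And>k. k < n \<Longrightarrow> \<exists>m::int. m > 0 \<and> of_int m * e k \<in> J"
  shows "int (qidx (zspan n e) J) = \<bar>fdet n G\<bar>" and "qidx (zspan n e) J > 0"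
proof -
  have sub: "J \<subseteq> zspan n e"
    unfolding J by (rule zspan_subset[OF submodule_over_zspan]) (auto intro: zspanI g)
  obtain d f where d: "\<And>k. k < n \<Longrightarrow> d k > 0"
    and fv: "\<And>k. k < n \<Longrightarrow> \<exists>v\<in>zspan k e. f k = of_int (d k) * e k + v" and Jf: "J = zspan n f"
    using triangular_basis[of J n e] J submodule_over_zspan[of n g] sub full by metis
  have "\<exists>c. f k = of_int (d k) * e k + (\<Sum>j<k. of_int (c j) * e j)" if "k < n" for k
    using fv[OF that] by (auto elim!: zspanE)
  then obtain c where c: "f k = of_int (d k) * e k + (\<Sum>j<k. of_int (c k j) * e j)" if "k < n" for k
    by metis
  define F where "F k j = (if j < k then c k j else if j = k then d k else 0)" for k j
  have f: "f k = (\<Sum>j<n. of_int (F k j) * e j)" if "k < n" for k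
  proof -
    have "(\<Sum>j<n. of_int (F k j) * e j) = (\<Sum>j<Suc k. of_int (F k j) * e j)"
      by (rule sum.mono_neutral_right) (use that in \<open>auto simp: F_def\<close>)
    also have "\<dots> = f k"
      using c[OF that] by (simp add: F_def)
    finally show ?thesis ..
  qed
  have F: "fdet n F = (\<Prod>k<n. d k)"
    by (subst fdet_lower_triangular) (auto simp: F_def)
  moreover have "(\<Prod>k<n. d k) > 0"
    using d by (intro prod_pos) auto
  ultimately have F0: "fdet n F > 0"
    by simp
  have f_indep: "qindep n f"
    by (rule qindep_nonsingular[OF e, of f "\<lambda>i j. of_int (F i j)"]) (use f F0 in \<open>auto simp: fdet_of_int\<close>)
  obtain U where U: "\<And>i. i < n \<Longrightarrow> g i = (\<Sum>j<n. of_int (U i j) * f j)"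
    using zspan_family[of n g n f] zspan_base[of _ n g] J Jf by metis
  have "zspan n g = zspan n f"
    using J Jf by simp
  then have U1: "\<bar>fdet n U\<bar> = 1"
    using unimodular_of_zspan_eq[OF f_indep _ U] by simp
  have G: "G i k = (\<Sum>j<n. U i j * F j k)" if "i < n" "k < n" for i k
  proof (rule qindep_eq_int[OF e _ that(2)])
    have "(\<Sum>k<n. of_int (G i k) * e k) = (\<Sum>j<n. of_int (U i j) * f j)"
      using U g that by simp
    also have "\<dots> = (\<Sum>j<n. of_int (U i j) * (\<Sum>k<n. of_int (F j k) * e k))"
      by (rule sum.cong) (auto simp: f)
    also have "\<dots> = (\<Sum>k<n. of_int (\<Sum>j<n. U i j * F j k) * e k)"
      by (rule sum_swap_of_int)
    finally show "(\<Sum>k<n. of_int (G i k) * e k) = (\<Sum>k<n. of_int (\<Sum>j<n. U i j * F j k) * e k)" .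
  qed
  have "fdet n G = fdet n U * fdet n F"
    unfolding fdet_mult[symmetric] by (rule fdet_cong) (rule G)
  then have GF: "\<bar>fdet n G\<bar> = fdet n F"
    using U1 F0 by (simp add: abs_mult)
  have q: "qidx (zspan n e) J = (\<Prod>k<n. nat (d k))"
    unfolding Jf by (rule qidx_triangular[OF e d fv])
  have "int (\<Prod>k<n. nat (d k)) = (\<Prod>k<n. d k)"
    using d by (auto simp: of_nat_prod intro!: prod.cong simp: order_less_imp_le)
  then show "int (qidx (zspan n e) J) = \<bar>fdet n G\<bar>"
    using q GF F by simp
  then show "qidx (zspan n e) J > 0"
    using GF F0 by simp
qed

lemma qidx_eq_1:
  assumes "submodule_over \<int> M" "submodule_over \<int> J" "J \<subseteq> M"
  shows "qidx M J = 1 \<longleftrightarrow> J = M"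
proof
  have 0: "0 \<in> M" "0 \<in> J"
    using assms by (auto intro: submodule_over_0)
  assume "qidx M J = 1"
  then obtain C where C: "(\<lambda>x. {y. y - x \<in> J}) ` M = {C}"
    unfolding qidx_def by (auto simp: card_1_singleton_iff)
  have "{y. y - x \<in> J} \<in> {C}" if "x \<in> M" for x
    unfolding C[symmetric] using that by (rule imageI)
  then have "{y. y - x \<in> J} = {y. y - 0 \<in> J}" if "x \<in> M" for x
    using that 0(1) by (simp only: singleton_iff)
  then have "x \<in> {y. y - 0 \<in> J}" if "x \<in> M" for x
    using that 0(2) by (metis (mono_tags, lifting) diff_self mem_Collect_eq)
  then show "J = M"
    using assms(3) by auto
next
  assume "J = M"
  moreover have minus1: "- 1 \<in> (\<int> :: 'a set)"
    by simp
  have mem: "(y - x \<in> M) = (y \<in> M)" if "x \<in> M" for x y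
    using submodule_over_add[OF assms(1), of x "y - x"] submodule_over_diff[OF assms(1) minus1, of y x] that
    by auto
  have "(\<lambda>x. {y. y - x \<in> M}) ` M = (\<lambda>x. M) ` M"
    by (rule image_cong[OF refl]) (simp only: mem Collect_mem_eq)
  then have "(\<lambda>x. {y. y - x \<in> M}) ` M = {M}"
    using submodule_over_0[OF assms(1)] by (simp only: image_constant_conv) (metis empty_iff)
  ultimately show "qidx M J = 1"
    unfolding qidx_def by simp
qed

section \<open>Number fields and their traces\<close>

lemma ring_of_type_algebra_simps [simp]:
  "carrier ring_of_type_algebra = UNIV" "\<one>\<^bsub>ring_of_type_algebra\<^esub> = 1"
  "\<zero>\<^bsub>ring_of_type_algebra\<^esub> = 0" "x \<otimes>\<^bsub>ring_of_type_algebra\<^esub> y = x * y"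
  "x \<oplus>\<^bsub>ring_of_type_algebra\<^esub> y = x + y"
  by (simp_all add: ring_of_type_algebra_def)

lemma ring_of_type_algebra_uminus [simp]:
  "\<ominus>\<^bsub>ring_of_type_algebra\<^esub> (x :: 'a::field) = - x"
proof -
  interpret ring "ring_of_type_algebra :: 'a ring"
    by (rule ring_from_type_algebra)
  show ?thesis
    by (rule minus_equality) auto
qed

lemma ring_of_type_algebra_inverse [simp]:
  assumes "(x :: 'a::field) \<noteq> 0"
  shows "inv\<^bsub>ring_of_type_algebra\<^esub> x = inverse x"
proof -
  interpret cring "ring_of_type_algebra :: 'a ring"
    by (rule cring_from_type_algebra)
  show ?thesis
    by (rule comm_inv_char) (use assms in auto)
qed

lemma subfield_ring_of_type_algebra:
  assumes "subfield (K :: 'a::field set) ring_of_type_algebra"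
  shows "0 \<in> K" "1 \<in> K" "x \<in> K \<Longrightarrow> y \<in> K \<Longrightarrow> x + y \<in> K" "x \<in> K \<Longrightarrow> y \<in> K \<Longrightarrow> x * y \<in> K"
    "x \<in> K \<Longrightarrow> - x \<in> K" "x \<in> K \<Longrightarrow> inverse x \<in> K"
proof -
  interpret field "ring_of_type_algebra :: 'a ring"
    by (rule field_from_type_algebra)
  note K = subringE[OF subfieldE(1)[OF assms]]
  show "0 \<in> K" "1 \<in> K" "x \<in> K \<Longrightarrow> y \<in> K \<Longrightarrow> x + y \<in> K" "x \<in> K \<Longrightarrow> y \<in> K \<Longrightarrow> x * y \<in> K"
    "x \<in> K \<Longrightarrow> - x \<in> K"
    using K(2,3) K(5)[of x] K(6,7)[of x y] by simp_all
  show "x \<in> K \<Longrightarrow> inverse x \<in> K"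
    using subfield_m_inv(1)[OF assms, of x] \<open>0 \<in> K\<close> by (cases "x = 0") auto
qed

lemma subfield_ring_of_type_algebraI:
  assumes "1 \<in> K" "\<And>x y. x \<in> K \<Longrightarrow> y \<in> K \<Longrightarrow> x + y \<in> K" "\<And>x y. x \<in> K \<Longrightarrow> y \<in> K \<Longrightarrow> x * y \<in> K"
    "\<And>x. x \<in> K \<Longrightarrow> - x \<in> K" "\<And>x. x \<in> K \<Longrightarrow> x \<noteq> 0 \<Longrightarrow> inverse x \<in> K"
  shows "subfield (K :: 'a::field set) ring_of_type_algebra"
proof -
  interpret field "ring_of_type_algebra :: 'a ring"
    by (rule field_from_type_algebra)
  show ?thesis
    by (rule subfieldI'[OF subringI]) (use assms in auto)
qed

lemma rat_vs_span_finite: "finite B \<Longrightarrow> rat_vs.span B = {x. \<exists>u. x = (\<Sum>b\<in>B. of_rat (u b) * b)}"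
  by (auto simp: rat_vs.span_finite)

lemma rat_vs_span_image:
  assumes "inj_on e {..<n}"
  shows "rat_vs.span (e ` {..<n}) = qspan n e"
proof (intro subset_antisym subsetI)
  fix x assume "x \<in> rat_vs.span (e ` {..<n})"
  then obtain u where "x = (\<Sum>b\<in>e ` {..<n}. of_rat (u b) * b)"
    by (auto simp: rat_vs_span_finite)
  then have "x = (\<Sum>i<n. of_rat (u (e i)) * e i)"
    using assms by (simp add: sum.reindex)
  then show "x \<in> qspan n e"
    by (rule qspanI)
next
  fix x assume "x \<in> qspan n e"
  then obtain c where "x = (\<Sum>i<n. of_rat (c i) * e i)"
    by (rule qspanE)
  also have "\<dots> = (\<Sum>b\<in>e ` {..<n}. of_rat (c (inv_into {..<n} e b)) * b)"
    using assms by (simp add: sum.reindex)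
  finally show "x \<in> rat_vs.span (e ` {..<n})"
    by (auto simp: rat_vs_span_finite)
qed

lemma qindep_inj_on:
  assumes "qindep n e"
  shows "inj_on e {..<n}"
proof (rule inj_onI)
  fix i j assume ij: "i \<in> {..<n}" "j \<in> {..<n}" "e i = e j"
  have "(\<Sum>k<n. of_rat (if k = i then 1 else 0) * e k) = (\<Sum>k<n. of_rat (if k = j then 1 else 0) * e k)"
    using ij by (simp add: if_distrib[of of_rat] if_distrib[of "\<lambda>x. x * _"] cong: if_cong)
  from qindep_eq[OF assms this, of i] ij show "i = j"
    by (simp split: if_splits)
qed

lemma independent_image_iff:
  assumes "inj_on e {..<n}"
  shows "rat_vs.independent (e ` {..<n}) \<longleftrightarrow> qindep n e"
proof
  assume indep: "rat_vs.independent (e ` {..<n})"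
  show "qindep n e"
    unfolding qindep_def
  proof (intro allI impI)
    fix c i assume c: "(\<Sum>i<n. of_rat (c i) * e i) = 0" and i: "i < n"
    let ?u = "\<lambda>b. c (inv_into {..<n} e b)"
    have "(\<Sum>b\<in>e ` {..<n}. of_rat (?u b) * b) = 0"
      using assms c by (simp add: sum.reindex)
    then have "\<forall>b\<in>e ` {..<n}. ?u b = 0"
      using indep rat_vs.dependent_finite[of "e ` {..<n}"] by auto
    then show "c i = 0"
      using i assms by auto
  qed
next
  assume indep: "qindep n e"
  show "rat_vs.independent (e ` {..<n})"
  proof
    assume "rat_vs.dependent (e ` {..<n})"
    then obtain u b where u: "(\<Sum>b\<in>e ` {..<n}. of_rat (u b) * b) = 0" and b: "b \<in> e ` {..<n}" "u b \<noteq> 0"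
      using rat_vs.dependent_finite[of "e ` {..<n}"] by auto
    then have "(\<Sum>i<n. of_rat (u (e i)) * e i) = 0"
      using assms by (simp add: sum.reindex)
    then have "\<forall>i<n. u (e i) = 0"
      using indep unfolding qindep_def by (elim allE[of _ "\<lambda>i. u (e i)"]) simp
    then show False
      using b by auto
  qed
qed

lemma dim_qspan:
  assumes "qindep n e"
  shows "rat_vs.dim (qspan n e) = n"
proof -
  have inj: "inj_on e {..<n}"
    by (rule qindep_inj_on[OF assms])
  have "rat_vs.independent (e ` {..<n})"
    using independent_image_iff[OF inj] assms by simp
  then have "rat_vs.dim (rat_vs.span (e ` {..<n})) = card (e ` {..<n})"
    by (rule rat_vs.dim_span_eq_card_independent)
  then show ?thesis
    using inj by (simp add: rat_vs_span_image card_image)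
qed

lemma finite_independent_enum:
  assumes "finite B" "rat_vs.independent B"
  obtains n e where "bij_betw e {..<n} B" "qindep n e" "qspan n e = rat_vs.span B"
proof -
  obtain e where e: "bij_betw e {..<card B} B"
    using ex_bij_betw_nat_finite[OF assms(1)] by (auto simp: atLeast0LessThan)
  then have inj: "inj_on e {..<card B}" and img: "e ` {..<card B} = B"
    by (auto simp: bij_betw_def)
  show ?thesis
    using that[OF e] independent_image_iff[OF inj] rat_vs_span_image[OF inj] assms(2) unfolding img by simp
qed

lemma number_field_basis:
  assumes "number_field K"
  obtains e where "qindep (degree_nf K) e" "qspan (degree_nf K) e = K"
proof -
  obtain G where G: "finite G" "rat_vs.span G = K"
    using assms by (auto simp: number_field_def)
  obtain B where B: "B \<subseteq> G" "rat_vs.independent B" "G \<subseteq> rat_vs.span B"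
    by (rule rat_vs.maximal_independent_subset[of G])
  have "rat_vs.span B = K"
    using B G rat_vs.span_mono[OF B(1)] rat_vs.span_minimal[OF B(3) rat_vs.subspace_span] by auto
  moreover obtain n e where "qindep n e" "qspan n e = rat_vs.span B"
    using finite_independent_enum[of B] finite_subset[OF B(1) G(1)] B(2) by metis
  ultimately show thesis
    using that[of e] dim_qspan[of n e] unfolding degree_nf_def by simp
qed

lemma number_fieldI:
  assumes "subfield K ring_of_type_algebra" "qspan n e = K"
  shows "number_field K"
proof -
  have "rat_vs.span (e ` {..<n}) = K"
  proof
    show "rat_vs.span (e ` {..<n}) \<subseteq> K"
    proof (rule rat_vs.span_minimal)
      show "e ` {..<n} \<subseteq> K"
        using assms(2) qspan_base[of _ n e] by auto
      show "rat_vs.subspace K"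
        using submodule_over_qspan[of n e] assms(2)
        by (intro rat_vs.subspaceI) (auto intro: submodule_over_0 submodule_over_add submodule_over_mult)
    qed
    show "K \<subseteq> rat_vs.span (e ` {..<n})"
    proof
      fix x assume "x \<in> K"
      then obtain c where "x = (\<Sum>i<n. of_rat (c i) * e i)"
        using assms(2) by (metis qspanE)
      then show "x \<in> rat_vs.span (e ` {..<n})"
        by (simp only:) (intro rat_vs.span_sum rat_vs.span_scale rat_vs.span_base imageI)
    qed
  qed
  then show ?thesis
    using assms(1) unfolding number_field_def by (intro conjI exI[of _ "e ` {..<n}"]) auto
qed

text \<open>Invariance of the trace under conjugation by \<open>P\<close>, in coordinates:
  \<open>comm\<close> is the matrix identity \<open>P A = A' P\<close>, and \<open>Q\<close> is the
  inverse of \<open>P\<close>.\<close>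

lemma trace_change_of_basis:
  fixes P Q A A' :: "nat \<Rightarrow> nat \<Rightarrow> 'b::comm_ring_1"
  assumes comm: "\<And>i k. i < n \<Longrightarrow> k < n \<Longrightarrow> (\<Sum>j<n. P i j * A j k) = (\<Sum>j<n. A' i j * P j k)"
    and PQ: "\<And>i k. i < n \<Longrightarrow> k < n \<Longrightarrow> (\<Sum>j<n. P i j * Q j k) = (if i = k then 1 else 0)"
    and QP: "\<And>i k. i < n \<Longrightarrow> k < n \<Longrightarrow> (\<Sum>j<n. Q i j * P j k) = (if i = k then 1 else 0)"
  shows "(\<Sum>i<n. A' i i) = (\<Sum>i<n. A i i)"
proof -
  have "(\<Sum>i<n. A' i i) = (\<Sum>i<n. \<Sum>k<n. A' i k * (if k = i then 1 else 0))"
    by (simp add: if_distrib[of "\<lambda>x. _ * x"] cong: if_cong)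
  also have "\<dots> = (\<Sum>i<n. \<Sum>k<n. \<Sum>j<n. A' i k * P k j * Q j i)"
    using PQ by (intro sum.cong) (auto simp: sum_distrib_left mult.assoc[symmetric] PQ[symmetric])
  also have "\<dots> = (\<Sum>i<n. \<Sum>j<n. (\<Sum>k<n. A' i k * P k j) * Q j i)"
    by (rule sum.cong[OF refl], subst sum.swap) (simp add: sum_distrib_right)
  also have "\<dots> = (\<Sum>i<n. \<Sum>j<n. (\<Sum>k<n. P i k * A k j) * Q j i)"
    using comm by (intro sum.cong) auto
  also have "\<dots> = (\<Sum>i<n. \<Sum>j<n. \<Sum>k<n. A k j * (Q j i * P i k))"
    by (simp only: sum_distrib_right) (intro sum.cong refl, simp add: mult_ac)
  also have "\<dots> = (\<Sum>j<n. \<Sum>k<n. \<Sum>i<n. A k j * (Q j i * P i k))"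
    by (subst sum.swap, rule sum.cong[OF refl], subst sum.swap) (rule refl)
  also have "\<dots> = (\<Sum>j<n. \<Sum>k<n. A k j * (if j = k then 1 else 0))"
    using QP by (intro sum.cong) (auto simp: sum_distrib_left[symmetric])
  also have "\<dots> = (\<Sum>i<n. A i i)"
    by (simp add: if_distrib[of "\<lambda>x. _ * x"] cong: if_cong)
  finally show ?thesis .
qed

text \<open>\<open>field_trace\<close> refers to a chosen basis \<open>B\<close>, given as a set.
  \<open>B\<close> is finite, being independent inside the span of finitely many elements, so it can
  be enumerated and compared with \<open>e\<close> by a change of basis.\<close>

lemma field_trace_eq:
  assumes e: "qindep n e" "qspan n e = K"
    and A: "\<And>i. i < n \<Longrightarrow> x * e i = (\<Sum>j<n. of_rat (A i j) * e j)"
  shows "field_trace K x = (\<Sum>i<n. A i i)"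
proof -
  have inj: "inj_on e {..<n}"
    by (rule qindep_inj_on[OF e(1)])
  define B where "B = (SOME B. rat_vs.independent B \<and> rat_vs.span B = K)"
  have "rat_vs.independent (e ` {..<n}) \<and> rat_vs.span (e ` {..<n}) = K"
    using independent_image_iff[OF inj] rat_vs_span_image[OF inj] e by simp
  then have B: "rat_vs.independent B" "rat_vs.span B = K"
    unfolding B_def by (metis (mono_tags, lifting) someI_ex)+
  have fin: "finite B"
  proof (rule conjunct1[OF rat_vs.independent_span_bound])
    show "B \<subseteq> rat_vs.span (e ` {..<n})"
      using B rat_vs.span_superset[of B] rat_vs_span_image[OF inj] e(2) by simp
  qed (use B in auto)
  obtain m b where b: "bij_betw b {..<m} B" "qindep m b" "qspan m b = K"
    using finite_independent_enum[OF fin B(1)] B(2) by metis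
  have mn: "m = n"
    using dim_qspan[OF e(1)] dim_qspan[OF b(2)] e b by simp
  note b = b[unfolded mn]
  have bK: "b i \<in> K" and eK: "e i \<in> K" if "i < n" for i
    using that qspan_base[of i n b] qspan_base[of i n e] e b by auto
  obtain P where P: "\<And>i. i < n \<Longrightarrow> b i = (\<Sum>j<n. of_rat (P i j) * e j)"
    using qspan_family[of n b n e] bK e(2) by metis
  obtain Q where Q: "\<And>i. i < n \<Longrightarrow> e i = (\<Sum>j<n. of_rat (Q i j) * b j)"
    using qspan_family[of n e n b] eK b(3) by metis
  define R where "R i j = rat_vs.representation B (x * b i) (b j)" for i j
  have xb: "x * b i = (\<Sum>j<n. of_rat (\<Sum>k<n. P i k * A k j) * e j)" if "i < n" for i
  proof -
    have "x * b i = (\<Sum>k<n. of_rat (P i k) * (x * e k))"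
      using that by (simp add: P sum_distrib_left mult_ac)
    also have "\<dots> = (\<Sum>k<n. of_rat (P i k) * (\<Sum>j<n. of_rat (A k j) * e j))"
      by (intro sum.cong refl) (simp add: A)
    also have "\<dots> = (\<Sum>j<n. of_rat (\<Sum>k<n. P i k * A k j) * e j)"
      by (rule sum_swap_of_rat)
    finally show ?thesis .
  qed
  have R: "x * b i = (\<Sum>j<n. of_rat (R i j) * b j)" if "i < n" for i
  proof -
    have "x * b i \<in> rat_vs.span B"
      unfolding B(2) e(2)[symmetric] by (rule qspanI[OF xb[OF that]])
    then have "x * b i = (\<Sum>v\<in>B. of_rat (rat_vs.representation B (x * b i) v) * v)"
      using rat_vs.sum_representation_eq[of B "x * b i" B] B(1) fin by simp
    also have "\<dots> = (\<Sum>j<n. of_rat (R i j) * b j)"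
      unfolding R_def by (rule sum.reindex_bij_betw[OF b(1), symmetric])
    finally show ?thesis .
  qed
  have comm: "(\<Sum>j<n. P i j * A j k) = (\<Sum>j<n. R i j * P j k)" if ik: "i < n" "k < n" for i k
  proof (rule qindep_eq[OF e(1) _ ik(2)])
    have "(\<Sum>j<n. of_rat (\<Sum>k<n. P i k * A k j) * e j) = (\<Sum>k<n. of_rat (R i k) * b k)"
      using xb R ik by simp
    also have "\<dots> = (\<Sum>k<n. of_rat (R i k) * (\<Sum>j<n. of_rat (P k j) * e j))"
      by (intro sum.cong refl) (simp add: P)
    also have "\<dots> = (\<Sum>j<n. of_rat (\<Sum>k<n. R i k * P k j) * e j)"
      by (rule sum_swap_of_rat)
    finally show "(\<Sum>j<n. of_rat (\<Sum>k<n. P i k * A k j) * e j) = \<dots>" .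
  qed
  have "field_trace K x = (\<Sum>v\<in>B. rat_vs.representation B (x * v) v)"
    unfolding field_trace_def B_def[symmetric] by (simp add: Let_def)
  also have "\<dots> = (\<Sum>i<n. R i i)"
    unfolding R_def by (rule sum.reindex_bij_betw[OF b(1), symmetric])
  also have "\<dots> = (\<Sum>i<n. A i i)"
  proof (rule trace_change_of_basis[OF comm])
    show "(\<Sum>j<n. P i j * Q j k) = (if i = k then 1 else 0)" if "i < n" "k < n" for i k
      using qindep_left_inverse[OF b(2) Q P that] .
    show "(\<Sum>j<n. Q i j * P j k) = (if i = k then 1 else 0)" if "i < n" "k < n" for i k
      using qindep_left_inverse[OF e(1) P Q that] .
  qed
  finally show ?thesis .
qed

section \<open>Algebraic integers\<close>

lemma lincomb_of_int_mem:
  assumes "submodule_over \<int> M" "\<And>i. i \<in> I \<Longrightarrow> f i \<in> M"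
  shows "(\<Sum>i\<in>I. of_int (c i) * f i) \<in> M"
  by (rule submodule_over_sum[OF assms(1)], rule submodule_over_mult[OF assms(1)]) (auto simp: assms(2))

lemma zspan_family_ex:
  assumes "\<And>i. i < m \<Longrightarrow> f i \<in> zspan n e"
  shows "\<exists>A. \<forall>i<m. f i = (\<Sum>j<n. of_int (A i j) * e j)"
  using zspan_family[of m f n e, OF assms] by blast

text \<open>The determinant trick: \<open>vec n f\<close> is an eigenvector of the integer matrix of
  multiplication by \<open>x\<close>, so \<open>x\<close> is a root of its characteristic
  polynomial, which is monic. The entry \<open>f k\<close> keeps the eigenvector from being
  zero.\<close>

lemma algebraic_int_stable:
  fixes x :: "'a::field_char_0"
  assumes stable: "\<And>i. i < n \<Longrightarrow> x * f i \<in> zspan n f" and nz: "k < n" "f k \<noteq> 0"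
  shows "algebraic_int x"
proof -
  obtain A where A: "\<And>i. i < n \<Longrightarrow> x * f i = (\<Sum>j<n. of_int (A i j) * f j)"
    using zspan_family[of n "\<lambda>i. x * f i" n f] stable by metis
  define M where "M = mat n n (\<lambda>(i, j). A i j)"
  have M: "M \<in> carrier_mat n n"
    by (simp add: M_def)
  let ?M = "map_mat of_int M :: 'a mat"
  have M': "?M \<in> carrier_mat n n"
    using M by simp
  have ev: "?M *\<^sub>v vec n f = x \<cdot>\<^sub>v vec n f"
    by (rule eq_vecI) (auto simp: M_def A scalar_prod_def atLeast0LessThan intro!: sum.cong)
  have "vec n f \<noteq> 0\<^sub>v n"
  proof
    assume "vec n f = 0\<^sub>v n"
    then have "vec n f $ k = 0\<^sub>v n $ k" by simp
    then show False using nz by simp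
  qed
  then have "eigenvalue ?M x"
    unfolding eigenvalue_def eigenvector_def using M' ev by (intro exI[of _ "vec n f"]) auto
  then have "poly (char_poly ?M) x = 0"
    using eigenvalue_root_char_poly[OF M'] by simp
  then have "poly (map_poly of_int (char_poly M)) x = 0"
    by (simp add: of_int_hom.char_poly_hom[OF M])
  moreover have "lead_coeff (char_poly M) = 1"
    using degree_monic_char_poly[OF M] by simp
  ultimately show ?thesis
    unfolding algebraic_int_altdef_ipoly by blast
qed

text \<open>A monic integer polynomial of degree \<open>d\<close> rewrites \<open>x ^ d\<close>
  through lower powers, so the powers below \<open>d\<close> span a module stable under
  \<open>x\<close>. The degree is positive because the constant polynomial \<open>1\<close> has no
  root.\<close>

lemma algebraic_int_powers:
  fixes x :: "'a::field_char_0"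
  assumes "algebraic_int x"
  obtains d where "d > 0" "\<And>i. i < d \<Longrightarrow> x * x ^ i \<in> zspan d (\<lambda>i. x ^ i)"
proof -
  obtain p where p: "poly (map_poly of_int p) x = 0" "lead_coeff p = 1"
    using assms by (auto simp: algebraic_int_altdef_ipoly)
  define d where "d = degree p"
  have sum0: "(\<Sum>i\<le>d. of_int (coeff p i) * x ^ i) = 0"
    using p(1) by (simp add: poly_altdef coeff_map_poly d_def degree_map_poly)
  have "(\<Sum>i<d. of_int (coeff p i) * x ^ i) + x ^ d = 0"
    using sum0 p(2) by (simp add: d_def lessThan_Suc_atMost[symmetric])
  then have xd: "x ^ d = (\<Sum>i<d. of_int (- coeff p i) * x ^ i)"
    by (simp add: sum_negf eq_neg_iff_add_eq_0 add.commute)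
  have "d > 0"
    using sum0 p(2) by (cases d) (auto simp: d_def)
  moreover have "x * x ^ i \<in> zspan d (\<lambda>i. x ^ i)" if "i < d" for i
  proof (cases "Suc i = d")
    case True
    then have "x * x ^ i = x ^ d"
      using power_Suc[of x i] by simp
    then show ?thesis
      using xd by (simp only:) (rule zspanI[OF refl])
  next
    case False
    then show ?thesis
      using zspan_base[of "Suc i" d "\<lambda>i. x ^ i"] that by simp
  qed
  ultimately show thesis
    by (rule that)
qed

text \<open>The pair \<open>(i, j)\<close> with \<open>j < q\<close> is coded as
  \<open>i * q + j\<close>, which turns the products \<open>a i * b j\<close> into one indexed
  family.\<close>

definition prod_family :: "nat \<Rightarrow> (nat \<Rightarrow> 'a) \<Rightarrow> (nat \<Rightarrow> 'a) \<Rightarrow> nat \<Rightarrow> 'a::times" where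
  "prod_family q a b k = a (k div q) * b (k mod q)"

lemma zspan_prod_family:
  assumes "u \<in> zspan p a" "v \<in> zspan q b"
  shows "u * v \<in> zspan (p * q) (prod_family q a b)"
proof -
  let ?M = "zspan (p * q) (prod_family q a b)"
  obtain c d where u: "u = (\<Sum>i<p. of_int (c i) * a i)" and v: "v = (\<Sum>j<q. of_int (d j) * b j)"
    using assms by (metis zspanE)
  have "a i * b j \<in> ?M" if "i < p" "j < q" for i j
  proof -
    have "i * q + j < Suc i * q"
      using that by simp
    also have "\<dots> \<le> p * q"
      using that by (intro mult_le_mono1) simp
    finally show ?thesis
      using zspan_base[of "i * q + j" "p * q" "prod_family q a b"] that by (simp add: prod_family_def)
  qed
  then have "(\<Sum>i<p. of_int (c i) * (\<Sum>j<q. of_int (d j) * (a i * b j))) \<in> ?M"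
    by (intro lincomb_of_int_mem[OF submodule_over_zspan]) auto
  also have "(\<Sum>i<p. of_int (c i) * (\<Sum>j<q. of_int (d j) * (a i * b j))) = u * v"
    unfolding u v unfolding sum_product by (simp only: sum_distrib_left) (intro sum.cong refl, simp add: mult_ac)
  finally show ?thesis .
qed

lemma prod_family_index:
  assumes "k < p * q"
  shows "k div q < p" "k mod q < (q :: nat)"
proof -
  show "k div q < p"
    using assms by (simp add: less_mult_imp_div_less)
  show "k mod q < q"
    using assms by (cases q) auto
qed

lemma zspan_stable:
  assumes "\<And>i. i < n \<Longrightarrow> x * f i \<in> zspan n f" "v \<in> zspan n f"
  shows "x * v \<in> zspan n f"
proof -
  obtain c where v: "v = (\<Sum>i<n. of_int (c i) * f i)"
    using assms(2) by (rule zspanE)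
  have "(\<Sum>i<n. of_int (c i) * (x * f i)) \<in> zspan n f"
    using assms(1) by (intro lincomb_of_int_mem[OF submodule_over_zspan]) auto
  then show ?thesis
    unfolding v by (simp add: sum_distrib_left mult_ac)
qed

text \<open>The module spanned by the products \<open>x ^ i * y ^ j\<close> of bounded exponents is
  stable under \<open>x\<close> and under \<open>y\<close>, hence under their sum and product. Its
  entry at index \<open>0\<close> is \<open>1\<close>, the nonzero entry that the determinant trick
  asks for.\<close>

lemma algebraic_int_add_mult:
  fixes x y :: "'a::field_char_0"
  assumes "algebraic_int x" "algebraic_int y"
  shows "algebraic_int (x + y)" "algebraic_int (x * y)"
proof -
  obtain p where p: "p > 0" "\<And>i. i < p \<Longrightarrow> x * x ^ i \<in> zspan p (\<lambda>i. x ^ i)"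
    by (rule algebraic_int_powers[OF assms(1)]) blast
  obtain q where q: "q > 0" "\<And>i. i < q \<Longrightarrow> y * y ^ i \<in> zspan q (\<lambda>i. y ^ i)"
    by (rule algebraic_int_powers[OF assms(2)]) blast
  let ?f = "prod_family q (\<lambda>i. x ^ i) (\<lambda>i. y ^ i)"
  let ?M = "zspan (p * q) ?f"
  have x: "x * ?f k \<in> ?M" if "k < p * q" for k
    using zspan_prod_family[OF p(2)[OF prod_family_index(1)[OF that]] zspan_base[OF prod_family_index(2)[OF that]],
        of "\<lambda>i. y ^ i"] by (simp add: prod_family_def mult_ac)
  have y: "y * ?f k \<in> ?M" if "k < p * q" for k
    using zspan_prod_family[OF zspan_base[OF prod_family_index(1)[OF that]] q(2)[OF prod_family_index(2)[OF that]],
        of "\<lambda>i. x ^ i"] by (simp add: prod_family_def mult_ac)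
  have nz: "0 < p * q" "?f 0 \<noteq> 0"
    using p(1) q(1) by (simp_all add: prod_family_def)
  show "algebraic_int (x + y)"
  proof (rule algebraic_int_stable[where f = ?f, OF _ nz])
    show "(x + y) * ?f i \<in> ?M" if "i < p * q" for i
      using submodule_over_add[OF submodule_over_zspan x y, OF that that] by (simp add: distrib_right)
  qed
  show "algebraic_int (x * y)"
  proof (rule algebraic_int_stable[where f = ?f, OF _ nz])
    show "(x * y) * ?f i \<in> ?M" if "i < p * q" for i
      using zspan_stable[OF x y[OF that]] by (simp add: mult.assoc)
  qed
qed

section \<open>Denominators and lattices of full rank\<close>

lemma common_denominator:
  assumes "finite (F :: rat set)"
  shows "\<exists>m::int. m > 0 \<and> (\<forall>q\<in>F. of_int m * q \<in> \<int>)"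
  using assms
proof induction
  case empty
  then show ?case by (intro exI[of _ 1]) simp
next
  case (insert q F)
  then obtain m :: int where m: "m > 0" "\<forall>q\<in>F. of_int m * q \<in> \<int>" by auto
  obtain a b where ab: "quotient_of q = (a, b)"
    by (cases "quotient_of q")
  then have q: "q = of_int a / of_int b" "b > 0"
    by (rule quotient_of_div, rule quotient_of_denom_pos)
  have "of_int (m * b) * r \<in> \<int>" if "r \<in> insert q F" for r
  proof (cases "r = q")
    case True
    then have "of_int (m * b) * r = of_int (m * a)"
      using q by simp
    then show ?thesis
      by (simp only: Ints_of_int)
  next
    case False
    then have "of_int m * r \<in> \<int>"
      using that m(2) by auto
    from Ints_mult[OF Ints_of_int[of b] this] show ?thesis
      by (simp add: mult.assoc mult.left_commute)
  qed
  then show ?case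
    using m(1) q(2) by (intro exI[of _ "m * b"]) simp
qed

lemma denominator_family:
  fixes f e :: "nat \<Rightarrow> 'a::field_char_0" and m n :: nat
  assumes "\<And>i. i < m \<Longrightarrow> f i \<in> qspan n e"
  shows "\<exists>k::int. k > 0 \<and> (\<forall>i<m. of_int k * f i \<in> zspan n e)"
proof -
  obtain A where A: "\<And>i. i < m \<Longrightarrow> f i = (\<Sum>j<n. of_rat (A i j) * e j)"
    using qspan_family[of m f n e] assms by metis
  obtain k :: int where k: "k > 0" "\<forall>q\<in>(\<lambda>(i, j). A i j) ` ({..<m} \<times> {..<n}). of_int k * q \<in> \<int>"
    using common_denominator[OF finite_imageI[OF finite_cartesian_product[OF finite_lessThan finite_lessThan]]]
    by blast
  have "of_int k * f i \<in> zspan n e" if "i < m" for i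
  proof -
    have "of_int k * A i j \<in> \<int>" if "j < n" for j
      using k(2) \<open>i < m\<close> that by (auto dest!: bspec[of _ _ "(i, j)"])
    then have "\<forall>j. \<exists>z. j < n \<longrightarrow> of_int k * A i j = of_int z"
      by (metis Ints_cases)
    then obtain z where "\<forall>j. j < n \<longrightarrow> of_int k * A i j = of_int (z j)"
      by metis
    then have "of_rat (of_int k * A i j) = (of_int (z j) :: 'a)" if "j < n" for j
      using that by (metis of_rat_of_int_eq)
    then have "of_int k * f i = (\<Sum>j<n. of_int (z j) * e j)"
      using A[OF \<open>i < m\<close>] by (simp add: sum_distrib_left of_rat_mult mult.assoc[symmetric])
    then show ?thesis
      by (rule zspanI)
  qed
  then show ?thesis
    using k(1) by blast
qed

text \<open>\<open>M\<close> is caught between two lattices: \<open>m * M\<close> is contained in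
  \<open>zspan n e\<close>, and multiples of all \<open>e i\<close> lie in \<open>M\<close>. So
  \<open>m * M\<close> has an echelon basis, and dividing it by \<open>m\<close> gives a basis of
  \<open>M\<close>.\<close>

lemma lattice_basis:
  fixes e :: "nat \<Rightarrow> 'a::field_char_0"
  assumes e: "qindep n e" and M: "submodule_over \<int> M" and m: "m > (0::int)"
    and bounded: "\<And>x. x \<in> M \<Longrightarrow> of_int m * x \<in> zspan n e"
    and full: "\<And>i. i < n \<Longrightarrow> \<exists>k::int. k > 0 \<and> of_int k * e i \<in> M"
  obtains f where "qindep n f" "qspan n f = qspan n e" "M = zspan n f"
proof -
  let ?J = "(*) (of_int m) ` M"
  have "\<exists>k::int. k > 0 \<and> of_int k * e i \<in> ?J" if "i < n" for i
  proof -
    obtain k :: int where "k > 0" "of_int k * e i \<in> M"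
      using full[OF \<open>i < n\<close>] by auto
    then show ?thesis
      using m by (intro exI[of _ "m * k"]) (auto simp: mult.assoc)
  qed
  then obtain g where g: "?J = zspan n g"
    by (rule triangular_basis[of ?J n e, rotated 2]) (use submodule_over_image_mult[OF M] bounded in auto)
  define f where "f i = g i / of_int m" for i
  have gf: "g i = of_int m * f i" for i
    using m by (simp add: f_def)
  have "zspan n g = (*) (of_int m) ` zspan n f"
  proof (intro subset_antisym subsetI)
    fix x assume "x \<in> zspan n g"
    then obtain c where "x = (\<Sum>i<n. of_int (c i) * g i)"
      by (rule zspanE)
    then have "x = of_int m * (\<Sum>i<n. of_int (c i) * f i)"
      by (simp add: gf sum_distrib_left mult_ac)
    then show "x \<in> (*) (of_int m) ` zspan n f"
      by (rule image_eqI) (rule zspanI[OF refl])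
  next
    fix x assume "x \<in> (*) (of_int m) ` zspan n f"
    then obtain y where "y \<in> zspan n f" "x = of_int m * y"
      by auto
    moreover from this(1) obtain c where "y = (\<Sum>i<n. of_int (c i) * f i)"
      by (rule zspanE)
    ultimately have "x = (\<Sum>i<n. of_int (c i) * g i)"
      by (simp add: gf sum_distrib_left mult_ac)
    then show "x \<in> zspan n g"
      by (rule zspanI)
  qed
  then have Mf: "M = zspan n f"
    using m g inj_image_eq_iff[of "(*) (of_int m :: 'a)" M "zspan n f"] by (simp add: inj_on_def)
  have fe: "f i \<in> qspan n e" if "i < n" for i
  proof -
    have "g i \<in> zspan n e"
      using bounded[of "f i"] Mf zspan_base[OF that, of f] by (simp add: gf)
    then have "of_rat (1 / of_int m) * g i \<in> qspan n e"
      using zspan_subset_qspan[of n e] by (intro submodule_over_mult[OF submodule_over_qspan]) auto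
    then show ?thesis
      by (simp add: f_def of_rat_divide)
  qed
  have ef: "e i \<in> qspan n f" if "i < n" for i
  proof -
    obtain k :: int where k: "k > 0" "of_int k * e i \<in> M"
      using full[OF \<open>i < n\<close>] by auto
    then have "of_int k * e i \<in> qspan n f"
      using Mf zspan_subset_qspan[of n f] by auto
    from submodule_over_mult[OF submodule_over_qspan _ this, of "of_rat (1 / of_int k)"] show ?thesis
      using k(1) by (simp add: of_rat_divide)
  qed
  obtain A where A: "\<And>i. i < n \<Longrightarrow> f i = (\<Sum>j<n. of_rat (A i j) * e j)"
    by (rule qspan_family[of n f n e, OF fe]) blast+
  have "fdet n A \<noteq> 0"
    by (rule fdet_nonzero_of_basis[OF e A ef])
  then show thesis
    using that[of f] qindep_nonsingular[OF e A] qspan_nonsingular[OF A] Mf by simp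
qed

section \<open>Rings of integers\<close>

lemma ex1_unique: "\<exists>!x. P x \<Longrightarrow> P a \<Longrightarrow> P b \<Longrightarrow> a = b"
  by auto

locale nfield =
  fixes K :: "'a::field_char_0 set"
  assumes nf: "number_field K"
begin

abbreviation "ndeg \<equiv> degree_nf K"
abbreviation "tr \<equiv> field_trace K"
abbreviation "ints \<equiv> integers_of K"

lemma subfield_K: "subfield K ring_of_type_algebra"
  using nf by (simp add: number_field_def)

lemmas K_zero = subfield_ring_of_type_algebra(1)[OF subfield_K]
  and K_one = subfield_ring_of_type_algebra(2)[OF subfield_K]
  and K_add = subfield_ring_of_type_algebra(3)[OF subfield_K]
  and K_mult = subfield_ring_of_type_algebra(4)[OF subfield_K]
  and K_uminus = subfield_ring_of_type_algebra(5)[OF subfield_K]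
  and K_inverse = subfield_ring_of_type_algebra(6)[OF subfield_K]

lemma K_diff: "x \<in> K \<Longrightarrow> y \<in> K \<Longrightarrow> x - y \<in> K"
  using K_add[of x "- y"] K_uminus[of y] by simp

lemma K_divide: "x \<in> K \<Longrightarrow> y \<in> K \<Longrightarrow> x / y \<in> K"
  using K_mult[of x "inverse y"] K_inverse[of y] by (simp add: divide_inverse)

lemma K_power: "x \<in> K \<Longrightarrow> x ^ k \<in> K"
  by (induction k) (auto intro: K_one K_mult)

lemma submodule_over_Rats_K: "submodule_over \<rat> K"
proof -
  obtain e where "qindep ndeg e" "qspan ndeg e = K"
    by (rule number_field_basis[OF nf])
  then show ?thesis
    using submodule_over_qspan[of ndeg e] by simp
qed

lemma K_of_rat: "of_rat q \<in> K"
  using submodule_over_mult[OF submodule_over_Rats_K _ K_one, of "of_rat q"] by simp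

lemma K_of_int: "of_int k \<in> K"
  using K_of_rat[of "of_int k"] by simp

lemma K_numeral: "numeral k \<in> K"
  using K_of_int[of "numeral k"] by simp

lemma deg_eq: "qindep n e \<Longrightarrow> qspan n e = K \<Longrightarrow> n = ndeg"
  using dim_qspan[of n e] by (simp add: degree_nf_def)

lemma basis_mem: "qspan n e = K \<Longrightarrow> i < n \<Longrightarrow> e i \<in> K"
  using qspan_base[of i n e] by simp

section \<open>Linearity and nondegeneracy of the trace form\<close>

lemma mult_matrix:
  assumes "qspan n e = K" "x \<in> K"
  shows "\<exists>A. \<forall>i<n. x * e i = (\<Sum>j<n. of_rat (A i j) * e j)"
proof -
  have "\<forall>i. \<exists>c. i < n \<longrightarrow> x * e i = (\<Sum>j<n. of_rat (c j) * e j)"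
    using assms K_mult basis_mem[OF assms(1)] by (metis qspanE)
  then show ?thesis
    by metis
qed

lemma tr_add:
  assumes "x \<in> K" "y \<in> K"
  shows "tr (x + y) = tr x + tr y"
proof -
  obtain e where e: "qindep ndeg e" "qspan ndeg e = K"
    by (rule number_field_basis[OF nf])
  obtain A where A: "\<And>i. i < ndeg \<Longrightarrow> x * e i = (\<Sum>j<ndeg. of_rat (A i j) * e j)"
    using mult_matrix[OF e(2) assms(1)] by metis
  obtain B where B: "\<And>i. i < ndeg \<Longrightarrow> y * e i = (\<Sum>j<ndeg. of_rat (B i j) * e j)"
    using mult_matrix[OF e(2) assms(2)] by metis
  have xy: "(x + y) * e i = (\<Sum>j<ndeg. of_rat (A i j + B i j) * e j)" if "i < ndeg" for i
    using A[OF that] B[OF that] by (simp add: distrib_right of_rat_add sum.distrib)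
  have "tr (x + y) = (\<Sum>i<ndeg. A i i + B i i)"
    by (rule field_trace_eq[where A = "\<lambda>i j. A i j + B i j", OF e xy])
  also have "\<dots> = tr x + tr y"
    using field_trace_eq[where A = A, OF e A] field_trace_eq[where A = B, OF e B] by (simp add: sum.distrib)
  finally show ?thesis .
qed

lemma tr_of_rat_mult:
  assumes "x \<in> K"
  shows "tr (of_rat q * x) = q * tr x"
proof -
  obtain e where e: "qindep ndeg e" "qspan ndeg e = K"
    by (rule number_field_basis[OF nf])
  obtain A where A: "\<And>i. i < ndeg \<Longrightarrow> x * e i = (\<Sum>j<ndeg. of_rat (A i j) * e j)"
    using mult_matrix[OF e(2) assms(1)] by metis
  have qx: "of_rat q * x * e i = (\<Sum>j<ndeg. of_rat (q * A i j) * e j)" if "i < ndeg" for i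
    by (simp only: mult.assoc A[OF that] sum_distrib_left of_rat_mult)
  have "tr (of_rat q * x) = (\<Sum>i<ndeg. q * A i i)"
    by (rule field_trace_eq[where A = "\<lambda>i j. q * A i j", OF e qx])
  also have "\<dots> = q * tr x"
    using field_trace_eq[where A = A, OF e A] by (simp add: sum_distrib_left)
  finally show ?thesis .
qed

lemma tr_zero: "tr 0 = 0"
  using tr_of_rat_mult[OF K_zero, of 0] by simp

lemma tr_sum: "(\<And>i. i \<in> I \<Longrightarrow> f i \<in> K) \<Longrightarrow> tr (\<Sum>i\<in>I. f i) = (\<Sum>i\<in>I. tr (f i))"
proof (induction I rule: infinite_finite_induct)
  case (insert i I)
  then show ?case
    using submodule_over_sum[OF submodule_over_Rats_K, of I f] by (simp add: tr_add)
qed (simp_all add: tr_zero)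

lemma tr_lincomb:
  "(\<And>i. i \<in> I \<Longrightarrow> f i \<in> K) \<Longrightarrow> tr (\<Sum>i\<in>I. of_rat (c i) * f i) = (\<Sum>i\<in>I. c i * tr (f i))"
  by (subst tr_sum) (auto simp: tr_of_rat_mult K_mult K_of_rat)

lemma tr_one: "tr 1 = of_nat ndeg"
proof -
  obtain e where e: "qindep ndeg e" "qspan ndeg e = K"
    by (rule number_field_basis[OF nf])
  have one: "1 * e i = (\<Sum>j<ndeg. of_rat (if i = j then 1 else 0) * e j)" if "i < ndeg" for i
    using that by (simp add: if_distrib[of of_rat] if_distrib[of "\<lambda>x. x * _"] cong: if_cong)
  from field_trace_eq[where A = "\<lambda>i j. if i = j then 1 else 0", OF e one] show ?thesis
    by simp
qed

lemma deg_pos: "ndeg > 0"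
proof (rule ccontr)
  assume "\<not> ndeg > 0"
  moreover obtain e where "qindep ndeg e" "qspan ndeg e = K"
    by (rule number_field_basis[OF nf])
  ultimately have "K = {0}"
    by (auto simp: qspan_def)
  then show False
    using K_one by simp
qed

text \<open>The Gram matrix is multiplied by \<open>U\<close> from the left and by the transpose of
  \<open>V\<close> from the right. Two pairs of families are kept apart because the trace is later
  used to pair bases of two different ideals.\<close>

lemma trace_form_change:
  assumes g: "\<And>i. i < n \<Longrightarrow> g i = (\<Sum>a<n. of_rat (U i a) * e a)"
    and h: "\<And>i. i < n \<Longrightarrow> h i = (\<Sum>a<n. of_rat (V i a) * f a)"
    and K: "\<And>i. i < n \<Longrightarrow> e i \<in> K" "\<And>i. i < n \<Longrightarrow> f i \<in> K"
  shows "fdet n (\<lambda>i j. tr (g i * h j)) = fdet n U * fdet n (\<lambda>i j. tr (e i * f j)) * fdet n V"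
proof -
  have entry: "tr (g i * h j) = (\<Sum>b<n. (\<Sum>a<n. U i a * tr (e a * f b)) * V j b)" if "i < n" "j < n" for i j
  proof -
    have "g i * h j = (\<Sum>a<n. \<Sum>b<n. of_rat (U i a) * e a * (of_rat (V j b) * f b))"
      using that by (simp add: g h sum_product)
    also have "\<dots> = (\<Sum>b<n. \<Sum>a<n. of_rat (U i a) * e a * (of_rat (V j b) * f b))"
      by (rule sum.swap)
    also have "\<dots> = (\<Sum>b<n. \<Sum>a<n. of_rat (U i a * V j b) * (e a * f b))"
      by (intro sum.cong refl) (simp add: of_rat_mult mult_ac)
    finally have gh: "g i * h j = (\<Sum>b<n. \<Sum>a<n. of_rat (U i a * V j b) * (e a * f b))" .
    have "tr (g i * h j) = (\<Sum>b<n. tr (\<Sum>a<n. of_rat (U i a * V j b) * (e a * f b)))"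
      unfolding gh by (rule tr_sum, rule submodule_over_sum[OF submodule_over_Rats_K])
        (use K in \<open>auto intro: K_mult K_of_rat\<close>)
    also have "\<dots> = (\<Sum>b<n. \<Sum>a<n. U i a * V j b * tr (e a * f b))"
      by (rule sum.cong[OF refl], rule tr_lincomb) (use K in \<open>auto intro: K_mult\<close>)
    also have "\<dots> = (\<Sum>b<n. (\<Sum>a<n. U i a * tr (e a * f b)) * V j b)"
      by (simp only: sum_distrib_right) (intro sum.cong refl, simp add: mult_ac)
    finally show ?thesis .
  qed
  have "fdet n (\<lambda>i j. tr (g i * h j)) = fdet n (\<lambda>i j. \<Sum>b<n. (\<Sum>a<n. U i a * tr (e a * f b)) * V j b)"
    by (rule fdet_cong) (rule entry)
  also have "\<dots> = fdet n (\<lambda>i b. \<Sum>a<n. U i a * tr (e a * f b)) * fdet n (\<lambda>b j. V j b)"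
    by (rule fdet_mult)
  also have "\<dots> = fdet n U * fdet n (\<lambda>i j. tr (e i * f j)) * fdet n V"
    by (simp only: fdet_mult fdet_transpose[of n V])
  finally show ?thesis .
qed

text \<open>A nonzero vector in the kernel of the Gram matrix is an element
  \<open>y \<noteq> 0\<close> whose products with all basis elements have trace \<open>0\<close>.
  Then \<open>1 = inverse y * y\<close> has trace \<open>0\<close>, whereas its trace is the
  degree.\<close>

lemma trace_form_nondegenerate:
  assumes e: "qindep n e" "qspan n e = K"
  shows "fdet n (\<lambda>i j. tr (e i * e j)) \<noteq> 0"
proof
  let ?T = "mat n n (\<lambda>(i, j). tr (e i * e j))"
  assume "fdet n (\<lambda>i j. tr (e i * e j)) = 0"
  then obtain v where v: "v \<in> carrier_vec n" "v \<noteq> 0\<^sub>v n" "?T *\<^sub>v v = 0\<^sub>v n"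
    using det_0_iff_vec_prod_zero_field[of ?T n] by (auto simp: fdet_def)
  define y where "y = (\<Sum>j<n. of_rat (v $ j) * e j)"
  have yK: "y \<in> K"
    using e(2) unfolding y_def by (auto intro: qspanI)
  have "y \<noteq> 0"
  proof
    assume "y = 0"
    then have "\<forall>i<n. v $ i = 0"
      using e(1) unfolding y_def qindep_def by (elim allE[of _ "\<lambda>i. v $ i"]) simp
    then have "v = 0\<^sub>v n"
      using v(1) by (intro eq_vecI) auto
    then show False
      using v(2) by simp
  qed
  have "tr (e i * y) = 0" if "i < n" for i
  proof -
    have "e i * y = (\<Sum>j<n. of_rat (v $ j) * (e i * e j))"
      unfolding y_def by (simp add: sum_distrib_left mult_ac)
    then have "tr (e i * y) = (\<Sum>j<n. v $ j * tr (e i * e j))"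
      by (simp only:) (intro tr_lincomb, use that in \<open>auto intro: K_mult basis_mem[OF e(2)]\<close>)
    also have "\<dots> = (?T *\<^sub>v v) $ i"
      using that v(1) by (auto simp: scalar_prod_def atLeast0LessThan mult.commute intro!: sum.cong)
    also have "\<dots> = 0"
      using that v(3) by simp
    finally show ?thesis .
  qed
  moreover obtain c where c: "inverse y = (\<Sum>i<n. of_rat (c i) * e i)"
    using K_inverse[OF yK] e(2) by (metis qspanE)
  have "inverse y * y = (\<Sum>i<n. of_rat (c i) * (e i * y))"
    unfolding c by (simp add: sum_distrib_right mult.assoc)
  then have "tr (inverse y * y) = (\<Sum>i<n. c i * tr (e i * y))"
    by (simp only:) (intro tr_lincomb, use yK in \<open>auto intro: K_mult basis_mem[OF e(2)]\<close>)
  ultimately have "tr (inverse y * y) = 0"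
    by simp
  then show False
    using \<open>y \<noteq> 0\<close> tr_one deg_pos by simp
qed

section \<open>Integers, integral bases and the discriminant\<close>

lemma ints_K: "x \<in> ints \<Longrightarrow> x \<in> K"
  by (simp add: integers_of_def)

lemma ints_of_int: "of_int k \<in> ints"
  by (simp add: integers_of_def K_of_int int_imp_algebraic_int)

lemma ints_zero: "0 \<in> ints" and ints_one: "1 \<in> ints"
  using ints_of_int[of 0] ints_of_int[of 1] by simp_all

lemma ints_add: "x \<in> ints \<Longrightarrow> y \<in> ints \<Longrightarrow> x + y \<in> ints"
  and ints_mult: "x \<in> ints \<Longrightarrow> y \<in> ints \<Longrightarrow> x * y \<in> ints"
  by (simp_all add: integers_of_def K_add K_mult algebraic_int_add_mult)

lemma ints_uminus: "x \<in> ints \<Longrightarrow> - x \<in> ints"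
  using ints_mult[OF ints_of_int[of "- 1"], of x] by simp

lemma ints_diff: "x \<in> ints \<Longrightarrow> y \<in> ints \<Longrightarrow> x - y \<in> ints"
  using ints_add[of x "- y"] ints_uminus[of y] by simp

lemma ints_power: "x \<in> ints \<Longrightarrow> x ^ k \<in> ints"
  by (induction k) (auto intro: ints_one ints_mult)

lemma minus_one_ints: "- 1 \<in> ints"
  using ints_of_int[of "- 1"] by simp

lemma Ints_subset_ints: "\<int> \<subseteq> ints"
  by (auto simp: Ints_def ints_of_int)

lemma submodule_over_ints: "submodule_over ints ints"
  by (auto simp: submodule_over_def ints_zero ints_add ints_mult)

lemma submodule_over_Ints: "submodule_over ints M \<Longrightarrow> submodule_over \<int> M"
  by (rule submodule_over_subset[OF _ Ints_subset_ints])

text \<open>When \<open>m\<close> clears the denominators in the matrix of multiplication by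
  \<open>x\<close>, the lattice \<open>zspan ndeg e\<close> is stable under
  \<open>m * x\<close>.\<close>

lemma ints_denominator:
  assumes "x \<in> K"
  obtains m :: int where "m > 0" "of_int m * x \<in> ints"
proof -
  obtain e where e: "qindep ndeg e" "qspan ndeg e = K"
    by (rule number_field_basis[OF nf])
  obtain m :: int where m: "m > 0" "\<forall>i<ndeg. of_int m * (x * e i) \<in> zspan ndeg e"
    using denominator_family[of ndeg "\<lambda>i. x * e i" ndeg e] assms basis_mem[OF e(2)] K_mult e(2) by auto
  have "algebraic_int (of_int m * x)"
    by (rule algebraic_int_stable[where f = e and n = ndeg and k = 0])
       (use m(2) deg_pos qindep_nonzero[OF e(1)] in \<open>auto simp: mult.assoc\<close>)
  then show thesis
    using that[OF m(1)] assms by (simp add: integers_of_def K_mult K_of_int)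
qed

text \<open>The products of powers of \<open>x\<close> with a rational basis span a full lattice
  stable under \<open>x\<close>. In a basis of this lattice the matrix of multiplication by
  \<open>x\<close> is integral, and so is its trace.\<close>

lemma tr_ints:
  assumes "x \<in> ints"
  shows "tr x \<in> \<int>"
proof -
  obtain e where e: "qindep ndeg e" "qspan ndeg e = K"
    by (rule number_field_basis[OF nf])
  have xK: "x \<in> K" and "algebraic_int x"
    using assms by (simp_all add: integers_of_def)
  then obtain d where d: "d > 0" "\<And>i. i < d \<Longrightarrow> x * x ^ i \<in> zspan d (\<lambda>i. x ^ i)"
    using algebraic_int_powers[of x] by metis
  let ?g = "prod_family ndeg (\<lambda>i. x ^ i) e"
  let ?M = "zspan (d * ndeg) ?g"
  have stable: "x * ?g k \<in> ?M" if "k < d * ndeg" for k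
    using zspan_prod_family[OF d(2)[OF prod_family_index(1)[OF that]] zspan_base[OF prod_family_index(2)[OF that]],
        of e] by (simp add: prod_family_def mult_ac)
  have gK: "?g k \<in> qspan ndeg e" if "k < d * ndeg" for k
    using basis_mem[OF e(2) prod_family_index(2)[OF that]] K_mult K_power[OF xK]
    by (simp add: prod_family_def e(2))
  obtain m :: int where m: "m > 0" "\<forall>k<d * ndeg. of_int m * ?g k \<in> zspan ndeg e"
    using denominator_family[of "d * ndeg" ?g ndeg e, OF gK] by auto
  have bounded: "of_int m * y \<in> zspan ndeg e" if y: "y \<in> ?M" for y
  proof -
    obtain c where "y = (\<Sum>k<d * ndeg. of_int (c k) * ?g k)"
      using y by (rule zspanE)
    then have "of_int m * y = (\<Sum>k<d * ndeg. of_int (c k) * (of_int m * ?g k))"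
      by (simp add: sum_distrib_left mult_ac)
    then show ?thesis
      using m(2) by (simp only:) (intro lincomb_of_int_mem[OF submodule_over_zspan], simp)
  qed
  have full: "\<exists>k::int. k > 0 \<and> of_int k * e i \<in> ?M" if "i < ndeg" for i
    using zspan_prod_family[OF zspan_base[of 0 d "\<lambda>i. x ^ i"] zspan_base[OF that], of e] d(1)
    by (intro exI[of _ 1]) simp
  obtain f where f: "qindep ndeg f" "qspan ndeg f = qspan ndeg e" "?M = zspan ndeg f"
    by (rule lattice_basis[OF e(1) submodule_over_zspan m(1) bounded full])
  have "x * f i \<in> zspan ndeg f" if "i < ndeg" for i
    using zspan_stable[OF stable, of "f i"] zspan_base[OF that, of f] f(3) by simp
  then obtain A where A: "\<forall>i<ndeg. x * f i = (\<Sum>j<ndeg. of_int (A i j) * f j)"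
    using zspan_family_ex[of ndeg "\<lambda>i. x * f i" ndeg f] by auto
  have "tr x = (\<Sum>i<ndeg. of_int (A i i))"
    by (rule field_trace_eq[where A = "\<lambda>i j. of_int (A i j)", OF f(1)])
       (use f(2) e(2) in \<open>simp_all add: A\<close>)
  then show ?thesis
    by (simp only: of_int_sum[symmetric] Ints_of_int)
qed

text \<open>For a basis \<open>e\<close> consisting of integers, the coordinates of an integer
  \<open>x\<close> solve a linear system with the Gram matrix \<open>T\<close> and the integral
  right-hand sides \<open>tr (x * e j)\<close>. By Cramer's rule \<open>fdet ndeg T\<close> is a
  common denominator of all such coordinates, which is the bound that \<open>lattice_basis\<close>
  demands.\<close>

lemma ints_basis:
  obtains e where "qindep ndeg e" "qspan ndeg e = K" "zspan ndeg e = ints"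
proof -
  obtain b where b: "qindep ndeg b" "qspan ndeg b = K"
    by (rule number_field_basis[OF nf])
  have "\<exists>m::int. m > 0 \<and> of_int m * b i \<in> ints" if "i < ndeg" for i
    by (rule ints_denominator[OF basis_mem[OF b(2) that]]) auto
  then obtain m where m: "\<And>i. i < ndeg \<Longrightarrow> (m i :: int) > 0" "\<And>i. i < ndeg \<Longrightarrow> of_int (m i) * b i \<in> ints"
    by metis
  define e where "e i = of_int (m i) * b i" for i
  define S where "S i j = (if i = j then of_int (m i) else 0 :: rat)" for i j :: nat
  have eS: "e i = (\<Sum>j<ndeg. of_rat (S i j) * b j)" if "i < ndeg" for i
    using that by (simp add: S_def e_def if_distrib[of of_rat] if_distrib[of "\<lambda>x. x * _"] cong: if_cong)
  have "fdet ndeg S = (\<Prod>i<ndeg. of_int (m i))"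
    by (subst fdet_lower_triangular) (auto simp: S_def)
  then have "fdet ndeg S \<noteq> 0"
    using m(1) by (auto simp: less_le)
  then have e: "qindep ndeg e" "qspan ndeg e = K"
    using qindep_nonsingular[OF b(1) eS] qspan_nonsingular[OF eS] b(2) by auto
  have e_ints: "e i \<in> ints" if "i < ndeg" for i
    using m(2)[OF that] by (simp add: e_def)
  let ?T = "\<lambda>i j. tr (e i * e j)"
  have "\<exists>z. i < ndeg \<longrightarrow> j < ndeg \<longrightarrow> ?T i j = of_int z" for i j
    using tr_ints[OF ints_mult[OF e_ints e_ints], of i j] by (metis Ints_cases)
  then obtain T where T: "\<And>i j. i < ndeg \<Longrightarrow> j < ndeg \<Longrightarrow> ?T i j = of_int (T i j)"
    by metis
  \<comment> \<open>By symmetry of the trace form the indices can be swapped into the order in which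
    the adjugate \<open>B\<close> multiplies \<open>T\<close>.\<close>
  have Tsym: "?T i j = of_int (T j i)" if "i < ndeg" "j < ndeg" for i j
    using T[OF that(2,1)] by (simp only: mult.commute[of "e i"])
  have "fdet ndeg ?T = fdet ndeg (\<lambda>i j. of_int (T i j))"
    by (rule fdet_cong) (rule T)
  then have dT: "fdet ndeg T \<noteq> 0"
    using trace_form_nondegenerate[OF e] by (simp add: fdet_of_int)
  obtain B where B: "\<And>i k. i < ndeg \<Longrightarrow> k < ndeg \<Longrightarrow> (\<Sum>j<ndeg. B i j * T j k) = (if i = k then fdet ndeg T else 0)"
    by (rule fdet_adjugate[of ndeg T]) blast
  have bounded: "of_int \<bar>fdet ndeg T\<bar> * x \<in> zspan ndeg e" if x: "x \<in> ints" for x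
  proof -
    obtain c where c: "x = (\<Sum>i<ndeg. of_rat (c i) * e i)"
      using ints_K[OF x] e(2) by (metis qspanE)
    have "\<forall>j. \<exists>z. j < ndeg \<longrightarrow> (\<Sum>i<ndeg. c i * ?T i j) = of_int z"
    proof (rule allI, goal_cases)
      case (1 j)
      show ?case
      proof (cases "j < ndeg")
        case True
        have "x * e j = (\<Sum>i<ndeg. of_rat (c i) * (e i * e j))"
          unfolding c by (simp add: sum_distrib_right mult.assoc)
        then have "tr (x * e j) = (\<Sum>i<ndeg. c i * ?T i j)"
          by (simp only:) (intro tr_lincomb, use True in \<open>auto intro: K_mult basis_mem[OF e(2)]\<close>)
        then show ?thesis
          using tr_ints[OF ints_mult[OF x e_ints[OF True]]] by (auto elim: Ints_cases)
      qed auto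
    qed
    then obtain z where "\<forall>j. j < ndeg \<longrightarrow> (\<Sum>i<ndeg. c i * ?T i j) = of_int (z j)"
      unfolding choice_iff by blast
    then have z: "(\<Sum>i<ndeg. c i * ?T i j) = of_int (z j)" if "j < ndeg" for j
      using that by blast
    have "of_int (fdet ndeg T) * c k = of_int (\<Sum>j<ndeg. B k j * z j)" if "k < ndeg" for k
    proof -
      have "(\<Sum>j<ndeg. of_int (B k j) * (\<Sum>i<ndeg. c i * ?T i j)) = (\<Sum>i<ndeg. c i * (\<Sum>j<ndeg. of_int (B k j) * ?T i j))"
        by (simp only: sum_distrib_left mult.left_commute) (rule sum.swap)
      also have "\<dots> = (\<Sum>i<ndeg. c i * of_int (\<Sum>j<ndeg. B k j * T j i))"
        by (intro sum.cong refl) (simp add: Tsym)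
      also have "\<dots> = (\<Sum>i<ndeg. c i * (if k = i then of_int (fdet ndeg T) else 0))"
      proof (rule sum.cong[OF refl])
        fix i assume "i \<in> {..<ndeg}"
        then show "c i * of_int (\<Sum>j<ndeg. B k j * T j i) = c i * (if k = i then of_int (fdet ndeg T) else 0)"
          by (simp only: B[OF that] lessThan_iff) simp
      qed
      also have "\<dots> = of_int (fdet ndeg T) * c k"
        using that by (simp add: if_distrib[of "\<lambda>x. _ * x"] cong: if_cong)
      finally show ?thesis
        using z by simp
    qed
    then have "of_rat (of_int (fdet ndeg T) * c k) = (of_int (\<Sum>j<ndeg. B k j * z j) :: 'a)" if "k < ndeg" for k
      using that by (metis of_rat_of_int_eq)
    then have "of_int (fdet ndeg T) * x = (\<Sum>k<ndeg. of_int (\<Sum>j<ndeg. B k j * z j) * e k)"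
      unfolding c by (simp add: sum_distrib_left of_rat_mult mult.assoc[symmetric])
    then have "of_int (fdet ndeg T) * x \<in> zspan ndeg e"
      by (rule zspanI)
    then show ?thesis
      using submodule_over_uminus[OF submodule_over_zspan, of "of_int (fdet ndeg T) * x" ndeg e]
      by (cases "fdet ndeg T \<ge> 0") (auto simp: abs_if)
  qed
  have full: "\<exists>k::int. k > 0 \<and> of_int k * e i \<in> ints" if "i < ndeg" for i
    using e_ints[OF that] by (intro exI[of _ 1]) simp
  obtain f where "qindep ndeg f" "qspan ndeg f = qspan ndeg e" "ints = zspan ndeg f"
    by (rule lattice_basis[OF e(1) submodule_over_Ints[OF submodule_over_ints] _ bounded full]) (use dT in auto)
  then show thesis
    using that e(2) by simp
qed

text \<open>The transition determinant is \<open>1\<close> or \<open>- 1\<close>, and it enters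
  squared.\<close>

lemma discriminant_basis_change:
  assumes e: "qindep ndeg e" "qspan ndeg e = K" and eq: "zspan ndeg f = zspan ndeg e"
  shows "fdet ndeg (\<lambda>i j. tr (f i * f j)) = fdet ndeg (\<lambda>i j. tr (e i * e j))"
proof -
  obtain A where A: "\<And>i. i < ndeg \<Longrightarrow> f i = (\<Sum>j<ndeg. of_int (A i j) * e j)"
    using zspan_family[of ndeg f ndeg e] zspan_base[of _ ndeg f] eq by metis
  have "fdet ndeg A * fdet ndeg A = 1"
    using unimodular_of_zspan_eq[OF e(1) eq A] by (metis abs_mult_self_eq mult.right_neutral)
  moreover have "fdet ndeg (\<lambda>i j. tr (f i * f j))
      = fdet ndeg (\<lambda>i j. of_int (A i j)) * fdet ndeg (\<lambda>i j. tr (e i * e j)) * fdet ndeg (\<lambda>i j. of_int (A i j))"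
    by (rule trace_form_change) (use A basis_mem[OF e(2)] in auto)
  ultimately show ?thesis
    by (simp add: fdet_of_int mult_ac) (metis mult.left_commute mult.right_neutral of_int_1 of_int_mult)
qed

text \<open>The list chosen in \<open>discriminant\<close> is known only through unique integer
  coordinates. Clearing denominators turns a rational relation into an integral one, and uniqueness
  for \<open>0\<close> makes that trivial; so the list is a rational basis and has length
  \<open>ndeg\<close>.\<close>

lemma discriminant_eq:
  assumes e: "qindep ndeg e" "qspan ndeg e = K" "zspan ndeg e = ints"
  shows "discriminant K = fdet ndeg (\<lambda>i j. tr (e i * e j))"
proof -
  define bs where "bs = (SOME bs. integral_basis K bs)"
  have "integral_basis K (map e [0..<ndeg])"
    unfolding integral_basis_def
  proof (intro conjI ballI)
    show "set (map e [0..<ndeg]) \<subseteq> ints"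
      using zspan_base[of _ ndeg e] e(3) by auto
    fix x assume "x \<in> ints"
    then obtain c where c: "x = (\<Sum>i<ndeg. of_int (c i) * e i)"
      using e(3) by (metis zspanE)
    show "\<exists>!c :: int list. length c = length (map e [0..<ndeg]) \<and>
        x = (\<Sum>i<length (map e [0..<ndeg]). of_int (c ! i) * map e [0..<ndeg] ! i)"
    proof (rule ex1I[of _ "map c [0..<ndeg]"])
      fix c' :: "int list" assume c': "length c' = length (map e [0..<ndeg]) \<and>
        x = (\<Sum>i<length (map e [0..<ndeg]). of_int (c' ! i) * map e [0..<ndeg] ! i)"
      then have "(\<Sum>i<ndeg. of_int (c' ! i) * e i) = (\<Sum>i<ndeg. of_int (c i) * e i)"
        using c by simp
      from qindep_eq_int[OF e(1) this] show "c' = map c [0..<ndeg]"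
        using c' by (intro nth_equalityI) auto
    qed (use c in auto)
  qed
  then have bs: "integral_basis K bs"
    unfolding bs_def by (rule someI)
  define b where "b i = bs ! i" for i
  have b_ints: "b i \<in> ints" if "i < length bs" for i
    using bs that unfolding integral_basis_def b_def by auto
  have zb: "zspan (length bs) b = ints"
  proof
    show "zspan (length bs) b \<subseteq> ints"
      by (rule zspan_subset[OF submodule_over_Ints[OF submodule_over_ints] b_ints])
    show "ints \<subseteq> zspan (length bs) b"
      using bs unfolding integral_basis_def b_def by (auto simp: zspan_def)
  qed
  have b_indep: "qindep (length bs) b"
    unfolding qindep_def
  proof (intro allI impI)
    fix c i assume c: "(\<Sum>i<length bs. of_rat (c i) * b i) = 0" and i: "i < length bs"
    obtain m :: int where m: "m > 0" "\<forall>q\<in>c ` {..<length bs}. of_int m * q \<in> \<int>"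
      using common_denominator[of "c ` {..<length bs}"] by auto
    then have "\<forall>i. \<exists>z. i < length bs \<longrightarrow> of_int m * c i = of_int z"
      by (auto elim: Ints_cases)
    then obtain z where "\<forall>i. i < length bs \<longrightarrow> of_int m * c i = of_int (z i)"
      unfolding choice_iff by blast
    then have z: "of_int m * c i = of_int (z i)" if "i < length bs" for i
      using that by blast
    have "(of_int (z i) :: 'a) = of_int m * of_rat (c i)" if "i < length bs" for i
      using z[OF that] by (metis of_rat_mult of_rat_of_int_eq)
    then have "(\<Sum>i<length bs. of_int (z i) * b i) = of_int m * (\<Sum>i<length bs. of_rat (c i) * b i)"
      by (simp add: sum_distrib_left mult.assoc)
    then have z0: "(\<Sum>i<length bs. of_int (z i) * b i) = 0"
      using c by simp
    let ?Q = "\<lambda>c :: int list. length c = length bs \<and> 0 = (\<Sum>i<length bs. of_int (c ! i) * bs ! i)"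
    have "\<exists>!c. ?Q c"
      using bs ints_zero unfolding integral_basis_def by (elim conjE ballE[of _ _ 0]) simp_all
    moreover have "?Q (map z [0..<length bs])"
      using z0 by (simp add: b_def)
    moreover have "?Q (replicate (length bs) 0)"
      by simp
    ultimately have "map z [0..<length bs] = replicate (length bs) 0"
      by (rule ex1_unique)
    then have "map z [0..<length bs] ! i = replicate (length bs) 0 ! i"
      by simp
    then have "of_int m * c i = 0"
      using z i by simp
    then show "c i = 0"
      using m(1) by simp
  qed
  have "qspan (length bs) b = K"
  proof
    show "qspan (length bs) b \<subseteq> K"
      by (rule qspan_subset[OF submodule_over_Rats_K]) (rule ints_K[OF b_ints])
    show "K \<subseteq> qspan (length bs) b"
    proof
      fix x assume "x \<in> K"
      then obtain m :: int where m: "m > 0" "of_int m * x \<in> ints"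
        by (rule ints_denominator)
      then have "of_int m * x \<in> qspan (length bs) b"
        using zspan_subset_qspan[of "length bs" b] zb by auto
      from submodule_over_mult[OF submodule_over_qspan _ this, of "of_rat (1 / of_int m)"]
      show "x \<in> qspan (length bs) b"
        using m(1) by (simp add: of_rat_divide)
    qed
  qed
  then have len: "length bs = ndeg"
    by (rule deg_eq[OF b_indep])
  have "discriminant K = fdet ndeg (\<lambda>i j. tr (b i * b j))"
    unfolding discriminant_def bs_def[symmetric] Let_def fdet_def len b_def ..
  also have "\<dots> = fdet ndeg (\<lambda>i j. tr (e i * e j))"
    by (rule discriminant_basis_change[OF e(1,2)]) (use zb len e(3) in simp)
  finally show ?thesis .
qed

lemma discriminant_nonzero: "discriminant K \<noteq> 0"
proof -
  obtain e where e: "qindep ndeg e" "qspan ndeg e = K" "zspan ndeg e = ints"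
    by (rule ints_basis)
  then show ?thesis
    using discriminant_eq[OF e] trace_form_nondegenerate[OF e(1,2)] by simp
qed

end

section \<open>Ideals of the ring of integers\<close>

lemma coset_eq_iff:
  assumes "submodule_over \<int> J"
  shows "{y. y - x \<in> J} = {y. y - x' \<in> J} \<longleftrightarrow> x - x' \<in> (J :: 'a::field_char_0 set)"
proof
  assume eq: "{y. y - x \<in> J} = {y. y - x' \<in> J}"
  have "x \<in> {y. y - x \<in> J}"
    using submodule_over_0[OF assms] by simp
  then show "x - x' \<in> J"
    unfolding eq by simp
next
  assume d: "x - x' \<in> J"
  have "y - x \<in> J \<longleftrightarrow> y - x' \<in> J" for y
    using submodule_over_add[OF assms _ d, of "y - x"] submodule_over_diff[OF assms _ _ d, of "y - x'"]
    by (auto simp del: add_diff_eq diff_diff_eq2)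
  then show "{y. y - x \<in> J} = {y. y - x' \<in> J}"
    by simp
qed

text \<open>Choosing a preimage under \<open>f\<close> and applying \<open>g\<close> is a bijection
  between the images. It serves to count cosets through a different parametrisation.\<close>

lemma card_image_cong_iff:
  assumes "\<And>x y. x \<in> A \<Longrightarrow> y \<in> A \<Longrightarrow> f x = f y \<longleftrightarrow> g x = g y"
  shows "card (f ` A) = card (g ` A)"
proof -
  let ?h = "\<lambda>c. g (SOME x. x \<in> A \<and> f x = c)"
  have some: "(SOME x. x \<in> A \<and> f x = f a) \<in> A \<and> f (SOME x. x \<in> A \<and> f x = f a) = f a" if "a \<in> A" for a
    by (rule someI[where x = a]) (use that in simp)
  have h: "?h (f a) = g a" if "a \<in> A" for a
    by (rule iffD1[OF assms]) (use some[OF that] that in blast)+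
  have "inj_on ?h (f ` A)"
  proof (rule inj_onI)
    fix c d assume "c \<in> f ` A" "d \<in> f ` A" "?h c = ?h d"
    then obtain a b where "a \<in> A" "b \<in> A" "c = f a" "d = f b" by auto
    then show "c = d"
      using h[of a] h[of b] \<open>?h c = ?h d\<close> assms[of a b] by simp
  qed
  moreover have "?h ` (f ` A) = g ` A"
    unfolding image_image by (rule image_cong[OF refl h])
  ultimately show ?thesis
    using card_image[of ?h "f ` A"] by simp
qed

context nfield
begin

definition int_ideal :: "'a set \<Rightarrow> bool" where
  "int_ideal I \<longleftrightarrow> submodule_over ints I \<and> I \<subseteq> ints"

definition nz_ideal :: "'a set \<Rightarrow> bool" where
  "nz_ideal I \<longleftrightarrow> int_ideal I \<and> I \<noteq> {0}"

definition max_ideal :: "'a set \<Rightarrow> bool" where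
  "max_ideal P \<longleftrightarrow> nz_ideal P \<and> P \<noteq> ints \<and> (\<forall>J. int_ideal J \<and> P \<subseteq> J \<longrightarrow> J = P \<or> J = ints)"

text \<open>Formed as a hull and not as an ideal of the ring record, so that it also multiplies
  fractional ideals that are not contained in \<open>ints\<close>.\<close>

definition imul :: "'a set \<Rightarrow> 'a set \<Rightarrow> 'a set" where
  "imul I J = submodule_over ints hull {x * y | x y. x \<in> I \<and> y \<in> J}"

definition isum :: "'a set \<Rightarrow> 'a set \<Rightarrow> 'a set" where
  "isum I J = {x + y | x y. x \<in> I \<and> y \<in> J}"

definition smul :: "'a \<Rightarrow> 'a set \<Rightarrow> 'a set" where
  "smul a M = (*) a ` M"

lemma smulI: "x \<in> M \<Longrightarrow> a * x \<in> smul a M"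
  unfolding smul_def by (rule imageI)

lemma smulE:
  assumes "z \<in> smul a M"
  obtains x where "x \<in> M" "z = a * x"
  using assms by (auto simp: smul_def)

lemma smul_mono_iff: "a \<noteq> 0 \<Longrightarrow> smul a M \<subseteq> smul a N \<longleftrightarrow> M \<subseteq> N"
  unfolding smul_def by (rule inj_image_subset_iff) (simp add: inj_on_def)

lemma smul_inj: "a \<noteq> 0 \<Longrightarrow> smul a M = smul a N \<Longrightarrow> M = N"
  by (metis smul_mono_iff order_antisym order_refl)

lemma smul_smul: "smul a (smul b M) = smul (a * b) M"
  by (simp add: smul_def image_image mult.assoc)

lemma submodule_smul: "submodule_over S M \<Longrightarrow> submodule_over S (smul a M)"
  unfolding smul_def by (rule submodule_over_image_mult)

lemma int_idealD:
  assumes "int_ideal I"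
  shows "submodule_over ints I" "I \<subseteq> ints" "submodule_over \<int> I"
  using assms submodule_over_Ints by (auto simp: int_ideal_def)

lemma ideal_closed:
  assumes "int_ideal I"
  shows "0 \<in> I" "x \<in> I \<Longrightarrow> y \<in> I \<Longrightarrow> x + y \<in> I" "x \<in> I \<Longrightarrow> y \<in> I \<Longrightarrow> x - y \<in> I"
    "r \<in> ints \<Longrightarrow> x \<in> I \<Longrightarrow> r * x \<in> I" "x \<in> I \<Longrightarrow> r \<in> ints \<Longrightarrow> x * r \<in> I" "x \<in> I \<Longrightarrow> x \<in> ints"
proof -
  note I = int_idealD[OF assms]
  show "0 \<in> I"
    by (rule submodule_over_0[OF I(1)])
  show "x \<in> I \<Longrightarrow> y \<in> I \<Longrightarrow> x + y \<in> I"
    by (rule submodule_over_add[OF I(1)])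
  show "x \<in> I \<Longrightarrow> y \<in> I \<Longrightarrow> x - y \<in> I"
    by (rule submodule_over_diff[OF I(1) minus_one_ints])
  show "r \<in> ints \<Longrightarrow> x \<in> I \<Longrightarrow> r * x \<in> I"
    by (rule submodule_over_mult[OF I(1)])
  then show "x \<in> I \<Longrightarrow> r \<in> ints \<Longrightarrow> x * r \<in> I"
    by (simp add: mult.commute)
  show "x \<in> I \<Longrightarrow> x \<in> ints"
    using I(2) by blast
qed

lemma int_ideal_ints: "int_ideal ints"
  by (simp add: int_ideal_def submodule_over_ints)

lemma ideal_eq_ints: "int_ideal I \<Longrightarrow> 1 \<in> I \<Longrightarrow> I = ints"
  using ideal_closed(4)[of I _ 1] ideal_closed(6)[of I] by fastforce

lemma nz_ideal_ints: "nz_ideal ints"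
  using ints_one unfolding nz_ideal_def by (auto simp: int_ideal_ints)

lemma nz_idealD: "nz_ideal I \<Longrightarrow> int_ideal I"
  by (simp add: nz_ideal_def)

lemma nz_ideal_witness:
  assumes "nz_ideal I"
  obtains x where "x \<in> I" "x \<noteq> 0"
  using assms ideal_closed(1)[of I] unfolding nz_ideal_def by blast

lemma nz_idealI: "int_ideal I \<Longrightarrow> x \<in> I \<Longrightarrow> x \<noteq> 0 \<Longrightarrow> nz_ideal I"
  unfolding nz_ideal_def by blast

lemma nz_ideal_mono: "nz_ideal I \<Longrightarrow> int_ideal J \<Longrightarrow> I \<subseteq> J \<Longrightarrow> nz_ideal J"
  by (meson nz_ideal_witness nz_idealI subsetD)

lemma max_idealD:
  assumes "max_ideal P"
  shows "nz_ideal P" "int_ideal P" "P \<noteq> ints" "1 \<notin> P"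
    "int_ideal J \<Longrightarrow> P \<subseteq> J \<Longrightarrow> J = P \<or> J = ints"
  using assms ideal_eq_ints[of P] by (auto simp: max_ideal_def nz_ideal_def)

lemma int_ideal_smul_ints: "a \<in> ints \<Longrightarrow> int_ideal (smul a ints)"
  unfolding int_ideal_def
  by (intro conjI submodule_smul submodule_over_ints subsetI) (auto elim!: smulE simp: ints_mult)

lemma int_ideal_isum:
  assumes "int_ideal I" "int_ideal J"
  shows "int_ideal (isum I J)"
  unfolding int_ideal_def
proof
  note I = ideal_closed[OF assms(1)] and J = ideal_closed[OF assms(2)]
  show "isum I J \<subseteq> ints"
    using I(6) J(6) ints_add unfolding isum_def by blast
  show "submodule_over ints (isum I J)"
  proof (rule submodule_overI)
    show "0 \<in> isum I J"
      unfolding isum_def using I(1) J(1) by force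
  next
    fix x y assume "x \<in> isum I J" "y \<in> isum I J"
    then obtain a b c d where "x = a + b" "y = c + d" "a \<in> I" "b \<in> J" "c \<in> I" "d \<in> J"
      unfolding isum_def by blast
    moreover from this have "x + y = (a + c) + (b + d)" by simp
    ultimately show "x + y \<in> isum I J"
      unfolding isum_def using I(2) J(2) by blast
  next
    fix r x assume "r \<in> ints" "x \<in> isum I J"
    then obtain a b where "x = a + b" "a \<in> I" "b \<in> J" "r \<in> ints"
      unfolding isum_def by blast
    moreover from this have "r * x = r * a + r * b" by (simp add: distrib_left)
    ultimately show "r * x \<in> isum I J"
      unfolding isum_def using I(4) J(4) by blast
  qed
qed

lemma isum_upper:
  assumes "int_ideal I" "int_ideal J"
  shows "I \<subseteq> isum I J" "J \<subseteq> isum I J"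
  using ideal_closed(1)[OF assms(1)] ideal_closed(1)[OF assms(2)] unfolding isum_def by force+

lemma int_ideal_colon:
  assumes "submodule_over ints M"
  shows "int_ideal {z \<in> ints. z * x \<in> M}"
  unfolding int_ideal_def
  by (auto intro!: submodule_overI simp: ints_zero ints_add ints_mult distrib_right mult.assoc
      submodule_over_0[OF assms] submodule_over_add[OF assms] submodule_over_mult[OF assms])

lemma submodule_imul: "submodule_over ints (imul I J)"
  unfolding imul_def by (rule submodule_over_hull)

lemma imulI: "x \<in> I \<Longrightarrow> y \<in> J \<Longrightarrow> x * y \<in> imul I J"
  unfolding imul_def by (rule hull_inc) blast

lemma imul_least:
  assumes "submodule_over ints M" "\<And>x y. x \<in> I \<Longrightarrow> y \<in> J \<Longrightarrow> x * y \<in> M"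
  shows "imul I J \<subseteq> M"
  unfolding imul_def by (rule hull_minimal) (use assms in auto)

lemma imul_mono: "I \<subseteq> I' \<Longrightarrow> J \<subseteq> J' \<Longrightarrow> imul I J \<subseteq> imul I' J'"
  by (rule imul_least[OF submodule_imul]) (auto intro: imulI)

lemma imul_commute: "imul I J = imul J I"
proof -
  have "imul I J \<subseteq> imul J I" for I J
    by (rule imul_least[OF submodule_imul]) (metis imulI mult.commute)
  then show ?thesis by blast
qed

text \<open>Together with \<open>imul_least\<close> it reduces a claim on \<open>u * x\<close>, for
  all \<open>u\<close> in a product of ideals, to the generators of the product.\<close>

lemma submodule_multiplier:
  assumes "submodule_over ints M"
  shows "submodule_over ints {u. u * x \<in> M}"
  by (auto intro!: submodule_overI simp: distrib_right mult.assoc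
      submodule_over_0[OF assms] submodule_over_add[OF assms] submodule_over_mult[OF assms])

lemma imul_assoc: "imul (imul I J) M = imul I (imul J M)"
proof
  show "imul (imul I J) M \<subseteq> imul I (imul J M)"
  proof (rule imul_least[OF submodule_imul])
    fix u z assume u: "u \<in> imul I J" and z: "z \<in> M"
    have "imul I J \<subseteq> {u. u * z \<in> imul I (imul J M)}"
      by (rule imul_least[OF submodule_multiplier[OF submodule_imul]]) (simp add: z imulI mult.assoc)
    then show "u * z \<in> imul I (imul J M)"
      using u by blast
  qed
  show "imul I (imul J M) \<subseteq> imul (imul I J) M"
  proof (rule imul_least[OF submodule_imul])
    fix z u assume u: "u \<in> imul J M" and z: "z \<in> I"
    have "imul J M \<subseteq> {u. u * z \<in> imul (imul I J) M}"
    proof (rule imul_least[OF submodule_multiplier[OF submodule_imul]])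
      fix x y assume "x \<in> J" "y \<in> M"
      then have "z * x * y \<in> imul (imul I J) M"
        using z by (intro imulI)
      then show "x * y \<in> {u. u * z \<in> imul (imul I J) M}"
        by (simp add: mult_ac)
    qed
    then show "z * u \<in> imul (imul I J) M"
      using u by (auto simp: mult.commute)
  qed
qed

lemma imul_left_commute: "imul I (imul J M) = imul J (imul I M)"
  by (metis imul_assoc imul_commute)

lemma imul_ints: "submodule_over ints I \<Longrightarrow> imul ints I = I"
proof
  assume I: "submodule_over ints I"
  show "imul ints I \<subseteq> I"
    by (rule imul_least[OF I]) (rule submodule_over_mult[OF I])
  show "I \<subseteq> imul ints I"
    using imulI[OF ints_one, of _ I] by auto
qed

lemma imul_smul: "imul (smul a I) J = smul a (imul I J)"
proof
  show "imul (smul a I) J \<subseteq> smul a (imul I J)"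
  proof (rule imul_least[OF submodule_smul[OF submodule_imul]])
    fix x y assume "x \<in> smul a I" "y \<in> J"
    then show "x * y \<in> smul a (imul I J)"
      by (auto elim!: smulE simp: mult.assoc intro!: smulI imulI)
  qed
  have "imul I J \<subseteq> {u. u * a \<in> imul (smul a I) J}"
  proof (rule imul_least[OF submodule_multiplier[OF submodule_imul]])
    fix x y assume "x \<in> I" "y \<in> J"
    then have "a * x * y \<in> imul (smul a I) J"
      by (intro imulI smulI)
    then show "x * y \<in> {u. u * a \<in> imul (smul a I) J}"
      by (simp add: mult_ac)
  qed
  then show "smul a (imul I J) \<subseteq> imul (smul a I) J"
    by (auto elim!: smulE simp: mult.commute)
qed

lemma imul_princ: "submodule_over ints M \<Longrightarrow> imul (smul a ints) M = smul a M"
  by (simp add: imul_smul imul_ints)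

lemma int_ideal_imul:
  assumes "int_ideal I" "int_ideal J"
  shows "int_ideal (imul I J)" "imul I J \<subseteq> I" "imul I J \<subseteq> J"
proof -
  note I = int_idealD[OF assms(1)] and J = int_idealD[OF assms(2)]
  show sub: "imul I J \<subseteq> I"
    using J(2) by (intro imul_least[OF I(1)]) (metis mult.commute subsetD submodule_over_mult[OF I(1)])
  show "imul I J \<subseteq> J"
    using I(2) by (intro imul_least[OF J(1)]) (metis subsetD submodule_over_mult[OF J(1)])
  show "int_ideal (imul I J)"
    unfolding int_ideal_def using sub I(2) submodule_imul by blast
qed

lemma nz_ideal_imul:
  assumes "nz_ideal I" "nz_ideal J"
  shows "nz_ideal (imul I J)"
proof -
  obtain x y where "x \<in> I" "x \<noteq> 0" "y \<in> J" "y \<noteq> 0"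
    using assms by (metis nz_ideal_witness)
  then show ?thesis
    by (intro nz_idealI[OF int_ideal_imul(1)[OF nz_idealD nz_idealD], OF assms imulI[of x _ y]]) auto
qed

section \<open>Nonzero ideals as lattices and their indices\<close>

lemma nz_ideal_integer:
  assumes "nz_ideal I"
  obtains m :: int where "m > 0" "of_int m \<in> I"
proof -
  obtain x where x: "x \<in> I" "x \<noteq> 0"
    by (rule nz_ideal_witness[OF assms])
  have "x \<in> K"
    using ideal_closed(6)[OF nz_idealD[OF assms] x(1)] by (rule ints_K)
  then obtain m :: int where m: "m > 0" "of_int m * inverse x \<in> ints"
    by (rule ints_denominator[OF K_inverse])
  \<comment> \<open>\<open>m\<close> is the product of the integer \<open>m * inverse x\<close> and
    the element \<open>x\<close> of \<open>I\<close>.\<close>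
  from ideal_closed(4)[OF nz_idealD[OF assms] m(2) x(1)] show thesis
    using that[OF m(1)] x(2) by (simp add: mult.assoc)
qed

lemma nz_ideal_basis:
  assumes "nz_ideal I"
  obtains f where "qindep ndeg f" "qspan ndeg f = K" "I = zspan ndeg f"
proof -
  obtain e where e: "qindep ndeg e" "qspan ndeg e = K" "zspan ndeg e = ints"
    by (rule ints_basis)
  obtain m :: int where m: "m > 0" "of_int m \<in> I"
    by (rule nz_ideal_integer[OF assms])
  note I = nz_idealD[OF assms]
  have full: "\<exists>k::int. k > 0 \<and> of_int k * e i \<in> I" if "i < ndeg" for i
    using ideal_closed(5)[OF I m(2), of "e i"] m(1) zspan_base[OF that, of e] e(3) by auto
  have bounded: "of_int 1 * x \<in> zspan ndeg e" if "x \<in> I" for x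
    using ideal_closed(6)[OF I that] e(3) by simp
  obtain f where "qindep ndeg f" "qspan ndeg f = qspan ndeg e" "I = zspan ndeg f"
    by (rule lattice_basis[of ndeg e I 1, OF e(1) int_idealD(3)[OF I] _ bounded full]) simp_all
  then show thesis
    using that e(2) by simp
qed

lemma nz_ideal_matrix:
  assumes J: "J = zspan ndeg e" "qindep ndeg e" and I: "I = zspan ndeg f"
    and nz: "nz_ideal J" "nz_ideal I" "I \<subseteq> J"
  obtains A where "\<And>i. i < ndeg \<Longrightarrow> f i = (\<Sum>j<ndeg. of_int (A i j) * e j)"
    "int (qidx J I) = \<bar>fdet ndeg A\<bar>" "qidx J I > 0"
proof -
  have "\<exists>A. \<forall>i<ndeg. f i = (\<Sum>j<ndeg. of_int (A i j) * e j)"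
    by (rule zspan_family_ex) (use zspan_base[of _ ndeg f] I J nz(3) in auto)
  then obtain A where A: "\<forall>i<ndeg. f i = (\<Sum>j<ndeg. of_int (A i j) * e j)"
    by blast
  obtain m :: int where m: "m > 0" "of_int m \<in> I"
    by (rule nz_ideal_integer[OF nz(2)])
  have full: "\<exists>k::int. k > 0 \<and> of_int k * e i \<in> I" if "i < ndeg" for i
  proof -
    have "e i \<in> ints"
      using zspan_base[OF that, of e] J(1) ideal_closed(6)[OF nz_idealD[OF nz(1)]] by auto
    then show ?thesis
      using ideal_closed(5)[OF nz_idealD[OF nz(2)] m(2)] m(1) by auto
  qed
  note q = qidx_zspan[where G = A, OF J(2) I _ full]
  show thesis
    by (rule that[of A]) (use A q J(1) in auto)
qed

lemma qidx_pos:
  assumes "nz_ideal J" "nz_ideal I" "I \<subseteq> J"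
  shows "qidx J I > 0"
proof -
  obtain e where e: "qindep ndeg e" "qspan ndeg e = K" "J = zspan ndeg e"
    by (rule nz_ideal_basis[OF assms(1)])
  obtain f where f: "qindep ndeg f" "qspan ndeg f = K" "I = zspan ndeg f"
    by (rule nz_ideal_basis[OF assms(2)])
  show ?thesis
    by (rule nz_ideal_matrix[OF e(3,1) f(3) assms])
qed

text \<open>The transition matrices multiply along the chain, and so do their determinants.\<close>

lemma qidx_tower:
  assumes "nz_ideal M" "nz_ideal J" "nz_ideal I" "I \<subseteq> J" "J \<subseteq> M"
  shows "qidx M I = qidx M J * qidx J I"
proof -
  obtain e where e: "qindep ndeg e" "qspan ndeg e = K" "M = zspan ndeg e"
    by (rule nz_ideal_basis[OF assms(1)])
  obtain f where f: "qindep ndeg f" "qspan ndeg f = K" "J = zspan ndeg f"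
    by (rule nz_ideal_basis[OF assms(2)])
  obtain g where g: "qindep ndeg g" "qspan ndeg g = K" "I = zspan ndeg g"
    by (rule nz_ideal_basis[OF assms(3)])
  obtain A where A: "\<And>i. i < ndeg \<Longrightarrow> f i = (\<Sum>j<ndeg. of_int (A i j) * e j)"
    "int (qidx M J) = \<bar>fdet ndeg A\<bar>"
    by (rule nz_ideal_matrix[OF e(3,1) f(3) assms(1,2,5)]) blast
  obtain B where B: "\<And>i. i < ndeg \<Longrightarrow> g i = (\<Sum>j<ndeg. of_int (B i j) * f j)"
    "int (qidx J I) = \<bar>fdet ndeg B\<bar>"
    by (rule nz_ideal_matrix[OF f(3,1) g(3) assms(2,3,4)]) blast
  obtain C where C: "\<And>i. i < ndeg \<Longrightarrow> g i = (\<Sum>j<ndeg. of_int (C i j) * e j)"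
    "int (qidx M I) = \<bar>fdet ndeg C\<bar>"
    by (rule nz_ideal_matrix[OF e(3,1) g(3) assms(1,3) order_trans[OF assms(4,5)]]) blast
  have "C i k = (\<Sum>j<ndeg. B i j * A j k)" if "i < ndeg" "k < ndeg" for i k
  proof (rule qindep_eq_int[OF e(1) _ that(2)])
    have "(\<Sum>k<ndeg. of_int (C i k) * e k) = (\<Sum>j<ndeg. of_int (B i j) * f j)"
      using B(1) C(1) that by simp
    also have "\<dots> = (\<Sum>j<ndeg. of_int (B i j) * (\<Sum>k<ndeg. of_int (A j k) * e k))"
      by (rule sum.cong[OF refl]) (simp add: A(1))
    also have "\<dots> = (\<Sum>k<ndeg. of_int (\<Sum>j<ndeg. B i j * A j k) * e k)"
      by (rule sum_swap_of_int)
    finally show "(\<Sum>k<ndeg. of_int (C i k) * e k) = (\<Sum>k<ndeg. of_int (\<Sum>j<ndeg. B i j * A j k) * e k)" .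
  qed
  then have "fdet ndeg C = fdet ndeg B * fdet ndeg A"
    unfolding fdet_mult[symmetric] by (rule fdet_cong)
  then have "int (qidx M I) = int (qidx M J * qidx J I)"
    using A(2) B(2) C(2) by (simp add: abs_mult)
  then show ?thesis
    by (simp only: of_nat_eq_iff)
qed

text \<open>The index in \<open>ints\<close> is the measure for all inductions on ideals below; it
  takes the place of the Noetherian property.\<close>

lemma qidx_less:
  assumes "nz_ideal J" "nz_ideal I" "I \<subset> J"
  shows "qidx ints J < qidx ints I"
proof -
  have J: "J \<subseteq> ints" and "I \<subseteq> J"
    using int_idealD(2)[OF nz_idealD[OF assms(1)]] assms(3) by auto
  then have "qidx ints I = qidx ints J * qidx J I"
    using qidx_tower[OF nz_ideal_ints assms(1,2)] by simp
  moreover have "qidx J I \<noteq> 1"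
    using qidx_eq_1[OF int_idealD(3)[OF nz_idealD[OF assms(1)]] int_idealD(3)[OF nz_idealD[OF assms(2)]]]
      assms(3) by blast
  moreover have "qidx J I > 0" "qidx ints J > 0"
    using qidx_pos[OF assms(1,2)] qidx_pos[OF nz_ideal_ints assms(1) J] assms(3) by auto
  ultimately have "qidx ints J * 1 < qidx ints J * qidx J I"
    by (intro mult_strict_left_mono) auto
  then show ?thesis
    using \<open>qidx ints I = _\<close> by simp
qed

text \<open>A nonzero ideal is a full lattice, so the determinant trick applies to a basis of it.
  This is how integral closedness enters the factorisation theory.\<close>

lemma stabilizer_integral:
  assumes "nz_ideal I" "\<And>y. y \<in> I \<Longrightarrow> x * y \<in> I" "x \<in> K"
  shows "x \<in> ints"
proof -
  obtain f where f: "qindep ndeg f" "qspan ndeg f = K" "I = zspan ndeg f"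
    by (rule nz_ideal_basis[OF assms(1)])
  have "algebraic_int x"
    by (rule algebraic_int_stable[where n = ndeg and f = f and k = 0])
       (use assms(2) f zspan_base[of _ ndeg f] deg_pos qindep_nonzero[OF f(1)] in auto)
  then show ?thesis
    using assms(3) by (simp add: integers_of_def)
qed

section \<open>Unique factorisation and the norm\<close>

lemma max_ideal_exists:
  assumes "nz_ideal I" "I \<noteq> ints"
  obtains P where "max_ideal P" "I \<subseteq> P"
  using assms
proof (induction "qidx ints I" arbitrary: I thesis rule: less_induct)
  case less
  show ?case
  proof (cases "max_ideal I")
    case True
    then show ?thesis
      using less.prems(1) by blast
  next
    case False
    then obtain J where J: "int_ideal J" "I \<subseteq> J" "J \<noteq> I" "J \<noteq> ints"
      using less.prems(2,3) unfolding max_ideal_def by blast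
    have nzJ: "nz_ideal J"
      by (rule nz_ideal_mono[OF less.prems(2) J(1,2)])
    have "qidx ints J < qidx ints I"
      by (rule qidx_less[OF nzJ less.prems(2)]) (use J in blast)
    then obtain P where "max_ideal P" "J \<subseteq> P"
      using less.hyps[of J] nzJ J(4) by blast
    then show ?thesis
      using less.prems(1) J(2) by blast
  qed
qed

text \<open>If \<open>y\<close> is not in \<open>P\<close>, the colon ideal
  \<open>{z \<in> ints. z * y \<in> P}\<close> contains \<open>P\<close> but not \<open>1\<close>,
  so by maximality it equals \<open>P\<close>; and \<open>x\<close> belongs to it.\<close>

lemma max_ideal_prime:
  assumes P: "max_ideal P" and xy: "x \<in> ints" "y \<in> ints" "x * y \<in> P"
  shows "x \<in> P \<or> y \<in> P"
proof (rule disjCI)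
  assume "y \<notin> P"
  note Pi = max_idealD(2)[OF P]
  have colon: "int_ideal {z \<in> ints. z * y \<in> P}"
    by (rule int_ideal_colon[OF int_idealD(1)[OF Pi]])
  moreover have "P \<subseteq> {z \<in> ints. z * y \<in> P}"
    using ideal_closed(5,6)[OF Pi] xy(2) by auto
  ultimately have "{z \<in> ints. z * y \<in> P} = P \<or> {z \<in> ints. z * y \<in> P} = ints"
    by (rule max_idealD(5)[OF P])
  moreover have "1 \<notin> {z \<in> ints. z * y \<in> P}"
    using \<open>y \<notin> P\<close> by simp
  ultimately have "{z \<in> ints. z * y \<in> P} = P"
    using ints_one by metis
  then show "x \<in> P"
    using xy by blast
qed

lemma coset_finite:
  assumes "nz_ideal Q"
  shows "finite ((\<lambda>x. {y. y - x \<in> Q}) ` ints)"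
  using qidx_pos[OF nz_ideal_ints assms int_idealD(2)[OF nz_idealD[OF assms]]]
  unfolding qidx_def by (simp add: card_gt_0_iff)

text \<open>Modulo a nonzero prime two powers of any element agree, so outside the prime it is a unit.\<close>

lemma prime_imp_max_ideal:
  assumes P: "nz_ideal P" "1 \<notin> P"
    and prime: "\<And>x y. x \<in> ints \<Longrightarrow> y \<in> ints \<Longrightarrow> x * y \<in> P \<Longrightarrow> x \<in> P \<or> y \<in> P"
  shows "max_ideal P"
proof -
  note Pi = nz_idealD[OF P(1)]
  have "J = ints" if J: "int_ideal J" "P \<subseteq> J" "J \<noteq> P" for J
  proof -
    obtain x where x: "x \<in> J" "x \<notin> P"
      using J by blast
    then have xi: "x \<in> ints"
      using ideal_closed(6)[OF J(1)] by blast
    have "\<not> inj (\<lambda>i::nat. {y. y - x ^ i \<in> P})"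
    proof
      assume "inj (\<lambda>i::nat. {y. y - x ^ i \<in> P})"
      moreover have "finite (range (\<lambda>i::nat. {y. y - x ^ i \<in> P}))"
        by (rule finite_subset[OF _ coset_finite[OF P(1)]]) (use ints_power[OF xi] in auto)
      ultimately show False
        using finite_imageD infinite_UNIV_nat by blast
    qed
    then obtain i j :: nat where "i \<noteq> j" "{y. y - x ^ i \<in> P} = {y. y - x ^ j \<in> P}"
      unfolding inj_def by blast
    then have "x ^ i - x ^ j \<in> P" "x ^ j - x ^ i \<in> P"
      using coset_eq_iff[OF int_idealD(3)[OF Pi]] by metis+
    then obtain i k where ik: "x ^ i - x ^ (i + Suc k) \<in> P"
      using \<open>i \<noteq> j\<close> less_imp_Suc_add[of i j] less_imp_Suc_add[of j i] by (metis add_Suc_right nat_neq_iff)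
    have notP: "x ^ m \<notin> P" for m
    proof (induction m)
      case (Suc m)
      then show ?case
        using prime[OF xi ints_power[OF xi, of m]] x(2) by auto
    qed (use P(2) in simp)
    have "x ^ i * (1 - x ^ Suc k) \<in> P"
      using ik by (simp add: algebra_simps power_add)
    then have "1 - x ^ Suc k \<in> P"
      using prime[OF ints_power[OF xi] ints_diff[OF ints_one ints_power[OF xi]]] notP by blast
    then have "1 - x ^ Suc k \<in> J"
      using J(2) by blast
    moreover have "x ^ Suc k \<in> J"
      using ideal_closed(5)[OF J(1) x(1) ints_power[OF xi, of k]] by simp
    ultimately have "1 \<in> J"
      using ideal_closed(2)[OF J(1)] by fastforce
    then show ?thesis
      by (rule ideal_eq_ints[OF J(1)])
  qed
  then show ?thesis
    unfolding max_ideal_def using P ints_one by blast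
qed

text \<open>In other words, \<open>P\<close> is an associated prime of the residue ring modulo
  \<open>I\<close>. If \<open>I \<noteq> P\<close> then \<open>I\<close> is not prime, which yields
  an element outside \<open>I\<close> whose colon ideal is strictly larger than \<open>I\<close> and
  still inside \<open>P\<close>. A witness for that colon ideal, multiplied by the element, is a
  witness for \<open>I\<close>.\<close>

lemma max_ideal_annihilator:
  assumes P: "max_ideal P" and I: "nz_ideal I" "I \<subseteq> P"
  shows "\<exists>b\<in>ints. b \<notin> I \<and> (\<forall>p\<in>P. b * p \<in> I)"
  using I
proof (induction "qidx ints I" arbitrary: I rule: less_induct)
  case less
  note I = less.prems
  note Ii = nz_idealD[OF I(1)] and Pi = max_idealD(2)[OF P]
  show ?case
  proof (cases "I = P")
    case True
    then show ?thesis
      using ints_one max_idealD(4)[OF P] by (intro bexI[of _ 1]) auto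
  next
    case False
    have step: ?thesis if x: "x \<in> ints" "x \<notin> I" and sub: "{z \<in> ints. z * x \<in> I} \<subseteq> P"
      and y: "y \<in> ints" "y * x \<in> I" "y \<notin> I" for x y
    proof -
      let ?C = "{z \<in> ints. z * x \<in> I}"
      have C: "int_ideal ?C"
        by (rule int_ideal_colon[OF int_idealD(1)[OF Ii]])
      have IC: "I \<subset> ?C"
        using ideal_closed(5,6)[OF Ii] x(1) y by auto
      have nzC: "nz_ideal ?C"
        by (rule nz_ideal_mono[OF I(1) C]) (use IC in blast)
      obtain b where b: "b \<in> ints" "b \<notin> ?C" "\<forall>p\<in>P. b * p \<in> ?C"
        using less.hyps[OF qidx_less[OF nzC I(1) IC] nzC sub] by blast
      have "b * x * p \<in> I" if "p \<in> P" for p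
        using b(3) that by (auto simp: mult_ac)
      then show ?thesis
        using b(1,2) x(1) ints_mult by (intro bexI[of _ "b * x"]) auto
    qed
    have "\<not> max_ideal I"
      using max_idealD(5)[of I P] Pi I(2) max_idealD(3)[OF P] False by auto
    moreover have "1 \<notin> I"
      using I(2) max_idealD(4)[OF P] by blast
    ultimately obtain x y where xy: "x \<in> ints" "y \<in> ints" "x * y \<in> I" "x \<notin> I" "y \<notin> I"
      using prime_imp_max_ideal[OF I(1)] by blast
    show ?thesis
    proof (cases "{z \<in> ints. z * y \<in> I} \<subseteq> P")
      case True
      show ?thesis
        by (rule step[OF xy(2,5) True xy(1,3,4)])
    next
      case False
      \<comment> \<open>When the colon ideal of \<open>y\<close> leaves \<open>P\<close>, an element
        \<open>u\<close> of it outside \<open>P\<close> takes the place of \<open>y\<close>: from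
        \<open>z * u \<in> I \<subseteq> P\<close> follows \<open>z \<in> P\<close>.\<close>
      then obtain u where u: "u \<in> ints" "u * y \<in> I" "u \<notin> P"
        by blast
      have sub: "{z \<in> ints. z * u \<in> I} \<subseteq> P"
      proof
        fix z assume z: "z \<in> {z \<in> ints. z * u \<in> I}"
        then have "z * u \<in> P"
          using I(2) by blast
        then show "z \<in> P"
          using max_ideal_prime[OF P, of z u] z u by blast
      qed
      have "u \<notin> I" "y * u \<in> I"
        using u I(2) by (auto simp: mult.commute)
      then show ?thesis
        using step[OF u(1) _ sub xy(2) _ xy(5)] by blast
    qed
  qed
qed

text \<open>\<open>J\<close> is generated by \<open>a\<close> and by some \<open>b\<close> outside
  \<open>smul a ints\<close> that multiplies \<open>P\<close> into \<open>smul a ints\<close>. Then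
  \<open>imul P J\<close> lies in \<open>smul a ints\<close>, and the elements that multiply
  \<open>a\<close> into \<open>imul P J\<close> form \<open>P\<close> or \<open>ints\<close>. If
  they formed \<open>P\<close>, then \<open>b / a\<close> would map \<open>P\<close> into itself and
  be integral, contrary to the choice of \<open>b\<close>.\<close>

lemma max_ideal_invertible:
  assumes P: "max_ideal P"
  obtains J a where "int_ideal J" "a \<in> P" "a \<noteq> 0" "imul P J = smul a ints"
proof -
  note Pi = max_idealD(2)[OF P]
  obtain a where a: "a \<in> P" "a \<noteq> 0"
    by (rule nz_ideal_witness[OF max_idealD(1)[OF P]])
  have ai: "a \<in> ints"
    by (rule ideal_closed(6)[OF Pi a(1)])
  have aI: "int_ideal (smul a ints)"
    by (rule int_ideal_smul_ints[OF ai])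
  have a_mem: "a \<in> smul a ints"
    using smulI[OF ints_one, of a] by simp
  have "smul a ints \<subseteq> P"
    using ideal_closed(5)[OF Pi a(1)] by (auto elim!: smulE)
  then obtain b where b: "b \<in> ints" "b \<notin> smul a ints" "\<And>p. p \<in> P \<Longrightarrow> b * p \<in> smul a ints"
    using max_ideal_annihilator[OF P nz_idealI[OF aI a_mem a(2)]] by blast
  have bI: "int_ideal (smul b ints)"
    by (rule int_ideal_smul_ints[OF b(1)])
  define J where "J = isum (smul a ints) (smul b ints)"
  have J: "int_ideal J"
    unfolding J_def by (rule int_ideal_isum[OF aI bI])
  have aJ: "a \<in> J" and bJ: "b \<in> J"
    using isum_upper[OF aI bI] a_mem smulI[OF ints_one, of b] unfolding J_def by auto
  let ?M = "imul P J"
  have sub: "?M \<subseteq> smul a ints"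
  proof (rule imul_least[OF int_idealD(1)[OF aI]])
    fix p j assume p: "p \<in> P" and "j \<in> J"
    then obtain r t where rt: "r \<in> ints" "t \<in> ints" "j = a * r + b * t"
      unfolding J_def isum_def by (auto elim!: smulE)
    have "p * j = a * (p * r) + (b * p) * t"
      unfolding rt(3) by (simp add: algebra_simps)
    moreover have "a * (p * r) \<in> smul a ints"
      using ideal_closed(6)[OF Pi p] rt(1) by (intro smulI ints_mult)
    moreover have "(b * p) * t \<in> smul a ints"
      by (rule ideal_closed(5)[OF aI b(3)[OF p] rt(2)])
    ultimately show "p * j \<in> smul a ints"
      using ideal_closed(2)[OF aI] by simp
  qed
  let ?N = "{z \<in> ints. z * a \<in> ?M}"
  have N: "int_ideal ?N"
    by (rule int_ideal_colon[OF submodule_imul])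
  have "P \<subseteq> ?N"
    using ideal_closed(6)[OF Pi] imulI[OF _ aJ, of _ P] by auto
  then have "?N = P \<or> ?N = ints"
    by (rule max_idealD(5)[OF P N])
  moreover have "?N \<noteq> P"
  proof
    assume NP: "?N = P"
    have "b / a * p \<in> P" if p: "p \<in> P" for p
    proof -
      obtain q where q: "q \<in> ints" "b * p = a * q"
        using b(3)[OF p] by (rule smulE)
      have "q * a \<in> ?M"
        using imulI[OF p bJ] q(2) by (simp add: mult.commute)
      then have "q \<in> P"
        using q(1) NP by blast
      moreover have "b / a * p = q"
        using q(2) a(2) by (simp add: field_simps)
      ultimately show ?thesis by simp
    qed
    then have "b / a \<in> ints"
      by (rule stabilizer_integral[OF max_idealD(1)[OF P]]) (use b(1) ai ints_K K_divide in auto)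
    then have "a * (b / a) \<in> smul a ints"
      by (rule smulI)
    then show False
      using b(2) a(2) by simp
  qed
  ultimately have "1 \<in> ?N"
    using ints_one by blast
  then have "a \<in> ?M"
    by simp
  then have "smul a ints \<subseteq> ?M"
    using submodule_over_mult[OF submodule_imul] by (auto elim!: smulE simp: mult.commute)
  then show thesis
    using that[OF J a] sub by blast
qed

text \<open>For a maximal \<open>P\<close> containing \<open>I\<close>, with
  \<open>imul P J = smul a ints\<close>, the ideal \<open>I'\<close> in
  \<open>imul I J = smul a I'\<close> is the quotient of \<open>I\<close> by \<open>P\<close>, to
  which induction on the index applies. It contains \<open>I\<close> strictly: otherwise all
  \<open>j / a\<close> would stabilise \<open>I\<close> and be integral, and \<open>P\<close> would
  be all of \<open>ints\<close>.\<close>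

lemma ideal_invertible:
  assumes "nz_ideal I"
  obtains J c where "int_ideal J" "c \<in> ints" "c \<noteq> 0" "imul I J = smul c ints"
  using assms
proof (induction "qidx ints I" arbitrary: I thesis rule: less_induct)
  case less
  note I = less.prems(2)
  note Ii = nz_idealD[OF I]
  show ?case
  proof (cases "I = ints")
    case True
    show ?thesis
      by (rule less.prems(1)[OF int_ideal_ints ints_one one_neq_zero])
         (simp add: True imul_ints submodule_over_ints smul_def)
  next
    case False
    obtain P where P: "max_ideal P" "I \<subseteq> P"
      by (rule max_ideal_exists[OF I False])
    note Pi = max_idealD(2)[OF P(1)]
    obtain J a where J: "int_ideal J" and a: "a \<in> P" "a \<noteq> 0" and PJ: "imul P J = smul a ints"
      by (rule max_ideal_invertible[OF P(1)])
    have ai: "a \<in> ints"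
      by (rule ideal_closed(6)[OF Pi a(1)])
    let ?M = "imul I J"
    define I' where "I' = {z \<in> ints. z * a \<in> ?M}"
    have I': "int_ideal I'"
      unfolding I'_def by (rule int_ideal_colon[OF submodule_imul])
    have MI': "?M = smul a I'"
    proof
      have "?M \<subseteq> smul a ints"
        using imul_mono[OF P(2) order_refl, of J] PJ by simp
      then show "?M \<subseteq> smul a I'"
        unfolding I'_def by (fastforce elim!: smulE intro: smulI simp: mult.commute)
      show "smul a I' \<subseteq> ?M"
        unfolding I'_def by (auto elim!: smulE simp: mult.commute)
    qed
    have sub: "I \<subseteq> I'"
    proof
      fix x assume x: "x \<in> I"
      have "imul P J \<subseteq> {u. u * x \<in> ?M}"
      proof (rule imul_least[OF submodule_multiplier[OF submodule_imul]])
        fix p j assume "p \<in> P" "j \<in> J"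
        then have "(p * x) * j \<in> ?M"
          using ideal_closed(4)[OF Ii ideal_closed(6)[OF Pi] x] by (intro imulI)
        then show "p * j \<in> {u. u * x \<in> ?M}"
          by (simp add: mult_ac)
      qed
      moreover have "a \<in> imul P J"
        using smulI[OF ints_one, of a] PJ by simp
      ultimately show "x \<in> I'"
        using ideal_closed(6)[OF Ii x] unfolding I'_def by (auto simp: mult.commute)
    qed
    have "I' \<noteq> I"
    proof
      assume eq: "I' = I"
      have "j / a \<in> ints" if j: "j \<in> J" for j
      proof (rule stabilizer_integral[OF I])
        fix x assume "x \<in> I"
        then have "x * j \<in> smul a I"
          using imulI[OF _ j] MI' eq by auto
        then show "j / a * x \<in> I"
          using a(2) by (auto elim!: smulE simp: field_simps)
      qed (use ideal_closed(6)[OF J j] ai ints_K K_divide in auto)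
      then have "imul P J \<subseteq> smul a P"
      proof (intro imul_least[OF submodule_smul[OF int_idealD(1)[OF Pi]]])
        fix p j assume p: "p \<in> P" and "j \<in> J" and h: "\<And>j. j \<in> J \<Longrightarrow> j / a \<in> ints"
        then have "a * (p * (j / a)) \<in> smul a P"
          by (intro smulI ideal_closed(5)[OF Pi p])
        then show "p * j \<in> smul a P"
          using a(2) by simp
      qed
      then have "ints \<subseteq> P"
        unfolding PJ using smul_mono_iff[OF a(2)] by simp
      then show False
        using max_idealD(4)[OF P(1)] ints_one by blast
    qed
    then have ss: "I \<subset> I'"
      using sub by blast
    have nz: "nz_ideal I'"
      by (rule nz_ideal_mono[OF I I' sub])
    obtain J' c where J': "int_ideal J'" "c \<in> ints" "c \<noteq> 0" "imul I' J' = smul c ints"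
      using less.hyps[OF qidx_less[OF nz I ss] _ nz] by blast
    have "imul I (imul J J') = smul (a * c) ints"
      using J'(4) by (simp add: imul_assoc[symmetric] MI' imul_smul smul_smul)
    then show ?thesis
      using J'(2,3) ai a(2) by (intro less.prems(1)[OF int_ideal_imul(1)[OF J J'(1)] ints_mult]) auto
  qed
qed

text \<open>Multiplication by an ideal that inverts \<open>I\<close> up to a principal factor leaves
  a scalar, which can be cancelled.\<close>

lemma imul_cancel_subset:
  assumes I: "nz_ideal I" and M: "submodule_over ints M" "submodule_over ints N"
    and sub: "imul I M \<subseteq> imul I N"
  shows "M \<subseteq> N"
proof -
  obtain J c where J: "int_ideal J" "c \<in> ints" "c \<noteq> 0" "imul I J = smul c ints"
    by (rule ideal_invertible[OF I])
  have eq: "imul J (imul I M) = smul c M" if "submodule_over ints M" for M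
  proof -
    have "imul J (imul I M) = imul (imul I J) M"
      unfolding imul_assoc by (rule imul_left_commute)
    then show ?thesis
      using J(4) imul_princ[OF that] by simp
  qed
  have "smul c M \<subseteq> smul c N"
    using imul_mono[OF order_refl sub, of J] eq M by simp
  then show ?thesis
    using smul_mono_iff[OF J(3)] by simp
qed

lemma imul_cancel:
  assumes "nz_ideal I" "submodule_over ints M" "submodule_over ints N" "imul I M = imul I N"
  shows "M = N"
  using imul_cancel_subset[OF assms(1-3)] imul_cancel_subset[OF assms(1,3,2)] assms(4) by auto

text \<open>To contain is to divide: the quotient is \<open>imul I B\<close> divided by
  \<open>c\<close>, where \<open>imul J B = smul c ints\<close>.\<close>

lemma contains_imp_divides:
  assumes J: "nz_ideal J" and I: "int_ideal I" "I \<subseteq> J"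
  obtains J' where "int_ideal J'" "I = imul J J'"
proof -
  obtain B c where B: "int_ideal B" "c \<in> ints" "c \<noteq> 0" "imul J B = smul c ints"
    by (rule ideal_invertible[OF J])
  define J' where "J' = {z \<in> ints. z * c \<in> imul I B}"
  have J': "int_ideal J'"
    unfolding J'_def by (rule int_ideal_colon[OF submodule_imul])
  have "imul I B \<subseteq> smul c ints"
    using imul_mono[OF I(2) order_refl, of B] B(4) by simp
  then have "imul I B \<subseteq> smul c J'"
    unfolding J'_def by (fastforce elim!: smulE intro: smulI simp: mult.commute)
  moreover have "smul c J' \<subseteq> imul I B"
    unfolding J'_def by (auto elim!: smulE simp: mult.commute)
  ultimately have eq: "imul I B = smul c J'"
    by blast
  have "smul c (imul J J') = imul J (smul c J')"
    by (metis imul_smul imul_commute)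
  also have "\<dots> = imul I (imul J B)"
    unfolding eq[symmetric] by (rule imul_left_commute)
  also have "\<dots> = smul c I"
    unfolding B(4) using imul_princ[OF int_idealD(1)[OF I(1)], of c] imul_commute by metis
  finally have "imul J J' = I"
    by (rule smul_inj[OF B(3)])
  then show thesis
    using that[OF J'] by simp
qed

lemma imul_proper:
  assumes "nz_ideal I" "int_ideal J" "J \<noteq> ints"
  shows "imul I J \<noteq> I"
proof
  assume "imul I J = I"
  then have "imul I J = imul I ints"
    using imul_ints[OF int_idealD(1)[OF nz_idealD[OF assms(1)]]] imul_commute by metis
  then show False
    using imul_cancel[OF assms(1) int_idealD(1)[OF assms(2)] submodule_over_ints] assms(3) by simp
qed

text \<open>\<open>I\<close> modulo \<open>imul I P\<close> is a line over the residue field. For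
  \<open>a\<close> in \<open>I\<close> outside \<open>imul I P\<close>, the ideal generated by
  \<open>a\<close> and \<open>imul I P\<close> is divisible by \<open>I\<close>; the quotient
  contains \<open>P\<close> and differs from it, so the ideal is \<open>I\<close>. Hence
  \<open>r \<mapsto> a * r\<close> reaches every coset, and by maximality its kernel is
  \<open>P\<close>.\<close>

lemma qidx_imul_max_ideal:
  assumes I: "nz_ideal I" and P: "max_ideal P"
  shows "qidx I (imul I P) = qidx ints P"
proof -
  note Ii = nz_idealD[OF I] and Pi = max_idealD(2)[OF P]
  let ?Q = "imul I P"
  note Q = int_ideal_imul[OF Ii Pi]
  obtain a where a: "a \<in> I" "a \<notin> ?Q"
    using imul_proper[OF I Pi max_idealD(3)[OF P]] Q(2) by blast
  have ai: "a \<in> ints"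
    by (rule ideal_closed(6)[OF Ii a(1)])
  have aI: "int_ideal (smul a ints)"
    by (rule int_ideal_smul_ints[OF ai])
  let ?N = "isum (smul a ints) ?Q"
  have N: "int_ideal ?N"
    by (rule int_ideal_isum[OF aI Q(1)])
  have aN: "a \<in> ?N"
    using isum_upper(1)[OF aI Q(1)] smulI[OF ints_one, of a] by auto
  have "?N \<subseteq> I"
    using ideal_closed(2,5)[OF Ii] a(1) Q(2) unfolding isum_def by (auto elim!: smulE)
  then obtain J' where J': "int_ideal J'" "?N = imul I J'"
    by (rule contains_imp_divides[OF I N])
  have "P \<subseteq> J'"
    by (rule imul_cancel_subset[OF I int_idealD(1)[OF Pi] int_idealD(1)[OF J'(1)]])
       (use isum_upper(2)[OF aI Q(1)] J'(2) in simp)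
  then have "J' = P \<or> J' = ints"
    by (rule max_idealD(5)[OF P J'(1)])
  moreover have "J' \<noteq> P"
    using J'(2) aN a(2) by auto
  ultimately have "J' = ints"
    by blast
  then have NI: "?N = I"
    using J'(2) imul_ints[OF int_idealD(1)[OF Ii]] imul_commute by metis
  let ?C = "\<lambda>x. {y. y - x \<in> ?Q}"
  have img: "?C ` I = (\<lambda>r. ?C (a * r)) ` ints"
  proof (intro subset_antisym image_subsetI)
    fix x assume "x \<in> I"
    then have "x \<in> ?N"
      by (simp only: NI)
    then obtain r q where rq: "r \<in> ints" "q \<in> ?Q" "x = a * r + q"
      unfolding isum_def by (auto elim!: smulE)
    then have "?C x = ?C (a * r)"
      by (subst coset_eq_iff[OF int_idealD(3)[OF Q(1)]]) simp
    then show "?C x \<in> (\<lambda>r. ?C (a * r)) ` ints"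
      using rq(1) by (rule image_eqI)
  next
    fix r assume "r \<in> ints"
    then show "?C (a * r) \<in> ?C ` I"
      by (intro imageI ideal_closed(5)[OF Ii a(1)])
  qed
  let ?R = "{z \<in> ints. z * a \<in> ?Q}"
  have R: "int_ideal ?R"
    by (rule int_ideal_colon[OF submodule_imul])
  have "P \<subseteq> ?R"
    using ideal_closed(6)[OF Pi] imulI[OF a(1), of _ P] by (auto simp: mult.commute)
  then have "?R = P \<or> ?R = ints"
    by (rule max_idealD(5)[OF P R])
  moreover have "1 \<notin> ?R"
    using a(2) by simp
  ultimately have RP: "?R = P"
    using ints_one by metis
  have memP: "z * a \<in> ?Q \<longleftrightarrow> z \<in> P" if "z \<in> ints" for z
  proof -
    have "z \<in> ?R \<longleftrightarrow> z \<in> P"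
      by (simp only: RP)
    then show ?thesis
      using that by simp
  qed
  have "card ((\<lambda>r. ?C (a * r)) ` ints) = card ((\<lambda>r. {y. y - r \<in> P}) ` ints)"
  proof (rule card_image_cong_iff)
    fix r r' assume r: "r \<in> ints" "r' \<in> ints"
    have "?C (a * r) = ?C (a * r') \<longleftrightarrow> (r - r') * a \<in> ?Q"
      by (subst coset_eq_iff[OF int_idealD(3)[OF Q(1)]]) (simp add: algebra_simps)
    also have "\<dots> \<longleftrightarrow> r - r' \<in> P"
      using memP[OF ints_diff[OF r]] .
    also have "\<dots> \<longleftrightarrow> {y. y - r \<in> P} = {y. y - r' \<in> P}"
      by (rule coset_eq_iff[OF int_idealD(3)[OF Pi], symmetric])
    finally show "?C (a * r) = ?C (a * r') \<longleftrightarrow> {y. y - r \<in> P} = {y. y - r' \<in> P}" .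
  qed
  then show ?thesis
    unfolding qidx_def img .
qed

text \<open>Maximal ideals are split off \<open>J\<close> one at a time. The induction is for all
  \<open>I\<close> at once because its hypothesis is applied to \<open>imul I P\<close>.\<close>

lemma qidx_imul:
  assumes "nz_ideal I" "nz_ideal J"
  shows "qidx I (imul I J) = qidx ints J"
  using assms
proof (induction "qidx ints J" arbitrary: I J rule: less_induct)
  case less
  note I = less.prems(1) and J = less.prems(2)
  show ?case
  proof (cases "J = ints")
    case True
    have "imul I J = I"
      using True imul_ints[OF int_idealD(1)[OF nz_idealD[OF I]]] imul_commute by metis
    then show ?thesis
      using qidx_eq_1[of I I] qidx_eq_1[of ints ints] True
        int_idealD(3)[OF nz_idealD[OF I]] int_idealD(3)[OF int_ideal_ints] by simp
  next
    case False
    obtain P where P: "max_ideal P" "J \<subseteq> P"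
      by (rule max_ideal_exists[OF J False])
    note Pn = max_idealD(1)[OF P(1)]
    obtain J' where J': "int_ideal J'" "J = imul P J'"
      by (rule contains_imp_divides[OF Pn nz_idealD[OF J] P(2)])
    have JJ': "J \<subseteq> J'"
      using int_ideal_imul(3)[OF nz_idealD[OF Pn] J'(1)] J'(2) by simp
    have nzJ': "nz_ideal J'"
      by (rule nz_ideal_mono[OF J J'(1) JJ'])
    have "J \<noteq> J'"
      using imul_proper[OF nzJ' nz_idealD[OF Pn] max_idealD(3)[OF P(1)]] J'(2) imul_commute by metis
    then have "qidx ints J' < qidx ints J"
      using JJ' by (intro qidx_less[OF nzJ' J]) blast
    note IH = less.hyps[OF this _ nzJ']
    have tower: "qidx I (imul I J) = qidx ints P * qidx ints J'" if I: "nz_ideal I" for I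
    proof -
      note Ii = nz_idealD[OF I]
      have IP: "nz_ideal (imul I P)"
        by (rule nz_ideal_imul[OF I Pn])
      have eq: "imul I J = imul (imul I P) J'"
        unfolding J'(2) by (rule imul_assoc[symmetric])
      have "qidx I (imul I J) = qidx I (imul I P) * qidx (imul I P) (imul (imul I P) J')"
        unfolding eq
        by (rule qidx_tower[OF I IP nz_ideal_imul[OF IP nzJ'] int_ideal_imul(2)[OF nz_idealD[OF IP] J'(1)]
              int_ideal_imul(2)[OF Ii nz_idealD[OF Pn]]])
      then show ?thesis
        using qidx_imul_max_ideal[OF I P(1)] IH[OF IP] by simp
    qed
    \<comment> \<open>The case \<open>I = ints\<close> of \<open>tower\<close> evaluates the index
      of \<open>J\<close> itself.\<close>
    have "imul ints J = J"
      by (rule imul_ints[OF int_idealD(1)[OF nz_idealD[OF J]]])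
    then show ?thesis
      using tower[OF I] tower[OF nz_ideal_ints] by simp
  qed
qed

lemma qidx_ints_imul:
  assumes "nz_ideal I" "nz_ideal J"
  shows "qidx ints (imul I J) = qidx ints I * qidx ints J"
  using qidx_tower[OF nz_ideal_ints assms(1) nz_ideal_imul[OF assms]] qidx_imul[OF assms]
    int_ideal_imul(2)[OF nz_idealD[OF assms(1)] nz_idealD[OF assms(2)]] int_idealD(2)[OF nz_idealD[OF assms(1)]]
  by simp

section \<open>The ideals of the ring record\<close>

abbreviation "OK \<equiv> integer_ring K"

lemma integer_ring_simps [simp]:
  "carrier OK = ints" "\<one>\<^bsub>OK\<^esub> = 1" "\<zero>\<^bsub>OK\<^esub> = 0"
  "x \<otimes>\<^bsub>OK\<^esub> y = x * y" "x \<oplus>\<^bsub>OK\<^esub> y = x + y"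
  by (simp_all add: integer_ring_def ring_of_type_algebra_def)

lemma cring_integer_ring: "cring OK"
proof (rule cringI)
  show "abelian_group OK"
    by (rule abelian_groupI)
       (auto simp: ints_zero ints_add algebra_simps intro!: bexI[of _ "- x" for x] ints_uminus)
  show "comm_monoid OK"
    by (rule comm_monoidI) (auto simp: ints_one ints_mult)
qed (auto simp: algebra_simps)

lemma integer_ring_uminus: "x \<in> ints \<Longrightarrow> \<ominus>\<^bsub>OK\<^esub> x = - x"
proof -
  interpret cring OK by (rule cring_integer_ring)
  show "x \<in> ints \<Longrightarrow> \<ominus>\<^bsub>OK\<^esub> x = - x"
    by (rule minus_equality) (auto simp: ints_uminus)
qed

lemma ideal_integer_ring_iff: "ideal I OK \<longleftrightarrow> int_ideal I"
proof
  interpret cring OK by (rule cring_integer_ring)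
  assume I: "ideal I OK"
  then interpret ideal I OK .
  show "int_ideal I"
    unfolding int_ideal_def
    using zero_closed a_closed I_l_closed a_subset by (auto intro!: submodule_overI)
next
  interpret cring OK by (rule cring_integer_ring)
  assume I: "int_ideal I"
  note c = ideal_closed[OF I]
  show "ideal I OK"
  proof (rule idealI)
    show "ring OK" by (rule ring_axioms)
    show "subgroup I (add_monoid OK)"
    proof (rule add.subgroupI)
      fix a assume "a \<in> I"
      then show "\<ominus>\<^bsub>OK\<^esub> a \<in> I"
        using c(3)[OF c(1), of a] c(6)[of a] by (simp add: integer_ring_uminus)
    qed (use c in auto)
  qed (use c in auto)
qed

lemma ideal_prod_eq_imul:
  assumes "int_ideal I" "int_ideal J"
  shows "ideal_prod OK I J = imul I J"
proof
  interpret cring OK by (rule cring_integer_ring)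
  show "ideal_prod OK I J \<subseteq> imul I J"
  proof
    fix x assume "x \<in> ideal_prod OK I J"
    then show "x \<in> imul I J"
      by induction (auto intro: imulI submodule_over_add[OF submodule_imul])
  qed
  have "int_ideal (ideal_prod OK I J)"
    using ideal_prod_is_ideal assms by (simp add: ideal_integer_ring_iff)
  then show "imul I J \<subseteq> ideal_prod OK I J"
    using ideal_prod.prod[of _ I _ J OK] by (intro imul_least int_idealD(1)) auto
qed

primrec ipow :: "'a set \<Rightarrow> nat \<Rightarrow> 'a set" where
  "ipow I 0 = ints" |
  "ipow I (Suc n) = imul (ipow I n) I"

lemma int_ideal_ipow: "int_ideal I \<Longrightarrow> int_ideal (ipow I n)"
  by (induction n) (auto intro: int_ideal_ints int_ideal_imul(1))

lemma nz_ideal_ipow: "nz_ideal I \<Longrightarrow> nz_ideal (ipow I n)"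
  by (induction n) (auto intro: nz_ideal_ints nz_ideal_imul)

lemma ideals_set_simps:
  "carrier (ideals_set OK) = {I. int_ideal I}" "\<one>\<^bsub>ideals_set OK\<^esub> = ints"
  "int_ideal I \<Longrightarrow> int_ideal J \<Longrightarrow> I \<otimes>\<^bsub>ideals_set OK\<^esub> J = imul I J"
  by (simp_all add: ideals_set_def ideal_integer_ring_iff ideal_prod_eq_imul)

lemma ideals_set_pow: "int_ideal I \<Longrightarrow> I [^]\<^bsub>ideals_set OK\<^esub> n = ipow I n"
proof (induction n)
  case (Suc n)
  have "I [^]\<^bsub>ideals_set OK\<^esub> Suc n = (I [^]\<^bsub>ideals_set OK\<^esub> n) \<otimes>\<^bsub>ideals_set OK\<^esub> I"
    by (simp add: nat_pow_def)
  then show ?case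
    using Suc by (simp add: ideals_set_simps(3)[OF int_ideal_ipow])
qed (simp add: nat_pow_def ideals_set_simps)

lemma PIdl_eq_smul: "PIdl\<^bsub>OK\<^esub> u = smul u ints"
  by (auto simp: cgenideal_def smul_def mult.commute)

lemma int_ideal_hull:
  assumes "S \<subseteq> ints"
  shows "int_ideal (submodule_over ints hull S)"
  unfolding int_ideal_def 
  using submodule_over_hull[of ints S] submodule_hull_minimal[OF assms submodule_over_ints] by (rule conjI)

lemma genideal_eq_hull:
  assumes "S \<subseteq> ints"
  shows "Idl\<^bsub>OK\<^esub> S = submodule_over ints hull S"
proof -
  have "\<Inter>{I. int_ideal I \<and> S \<subseteq> I} = submodule_over ints hull S"
  proof
    show "\<Inter>{I. int_ideal I \<and> S \<subseteq> I} \<subseteq> submodule_over ints hull S"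
      using int_ideal_hull[OF assms] hull_subset[of S "submodule_over ints"] by blast
    show "submodule_over ints hull S \<subseteq> \<Inter>{I. int_ideal I \<and> S \<subseteq> I}"
      by (rule Inter_greatest) (use submodule_hull_minimal int_idealD(1) in blast)
  qed
  then show ?thesis
    by (simp add: genideal_def ideal_integer_ring_iff)
qed

lemma primeideal_integer_ring_iff: "primeideal P OK \<and> P \<noteq> {0} \<longleftrightarrow> max_ideal P"
proof
  interpret cring OK by (rule cring_integer_ring)
  assume P: "primeideal P OK \<and> P \<noteq> {0}"
  then interpret primeideal P OK by blast
  have I: "int_ideal P"
    using ideal_axioms by (simp add: ideal_integer_ring_iff)
  show "max_ideal P"
  proof (rule prime_imp_max_ideal)
    show "nz_ideal P"
      using P I by (simp add: nz_ideal_def)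
    show "1 \<notin> P"
      using I_notcarr ideal_eq_ints[OF I] by auto
  qed (use I_prime in simp)
next
  interpret cring OK by (rule cring_integer_ring)
  assume P: "max_ideal P"
  have "primeideal P OK"
  proof (rule primeidealI)
    show "ideal P OK"
      using max_idealD(2)[OF P] by (simp add: ideal_integer_ring_iff)
    show "cring OK" by (rule cring_integer_ring)
  qed (use max_idealD(3)[OF P] max_ideal_prime[OF P] in auto)
  then show "primeideal P OK \<and> P \<noteq> {0}"
    using max_idealD(1)[OF P] by (simp add: nz_ideal_def)
qed

section \<open>The ramification index as containment in powers\<close>

lemma ipow_divides_iff:
  assumes "nz_ideal Q" "int_ideal E"
  shows "(Q [^]\<^bsub>ideals_set OK\<^esub> e) divides\<^bsub>ideals_set OK\<^esub> E \<longleftrightarrow> E \<subseteq> ipow Q e"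
proof
  note Qe = nz_ideal_ipow[OF assms(1), of e]
  note pow = ideals_set_pow[OF nz_idealD[OF assms(1)], of e]
  show "E \<subseteq> ipow Q e" if "(Q [^]\<^bsub>ideals_set OK\<^esub> e) divides\<^bsub>ideals_set OK\<^esub> E"
    using that int_ideal_imul(2)[OF nz_idealD[OF Qe]]
    by (auto simp: factor_def pow ideals_set_simps nz_idealD[OF Qe])
  show "(Q [^]\<^bsub>ideals_set OK\<^esub> e) divides\<^bsub>ideals_set OK\<^esub> E" if sub: "E \<subseteq> ipow Q e"
  proof -
    obtain C where "int_ideal C" "E = imul (ipow Q e) C"
      by (rule contains_imp_divides[OF Qe assms(2) sub])
    then show ?thesis
      unfolding factor_def pow by (intro bexI[of _ C]) (simp_all add: ideals_set_simps nz_idealD[OF Qe])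
  qed
qed

lemma ipow_antimono:
  assumes "int_ideal Q" "m \<le> n"
  shows "ipow Q n \<subseteq> ipow Q m"
  using assms(2)
proof (induction n rule: dec_induct)
  case (step n)
  then show ?case
    using int_ideal_imul(2)[OF int_ideal_ipow[OF assms(1)] assms(1), of n] by auto
qed simp

lemma qidx_mono:
  assumes "nz_ideal J" "nz_ideal I" "I \<subseteq> J"
  shows "qidx ints J \<le> qidx ints I"
proof (cases "I = J")
  case False
  with assms(3) have "I \<subset> J"
    by blast
  from qidx_less[OF assms(1,2) this] show ?thesis
    by simp
qed simp

text \<open>Divisibility by a power of \<open>Q\<close> is containment in it, so the question is
  whether \<open>2\<close> is an admissible exponent. A greatest exponent exists because the index
  of \<open>ipow Q e\<close> is at least \<open>e\<close>, while the ideal generated by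
  \<open>S\<close> is nonzero and has finite index.\<close>

lemma ramification_index_eq_1_iff:
  assumes Q: "max_ideal Q" and S: "S \<subseteq> Q" "x \<in> S" "x \<noteq> 0"
  shows "ramification_index K S Q = 1 \<longleftrightarrow> \<not> S \<subseteq> imul Q Q"
proof -
  note Qn = max_idealD(1)[OF Q] and Qi = max_idealD(2)[OF Q]
  define E where "E = submodule_over ints hull S"
  have S_ints: "S \<subseteq> ints"
    using S(1) ideal_closed(6)[OF Qi] by blast
  have E: "int_ideal E"
    unfolding E_def by (rule int_ideal_hull[OF S_ints])
  have "S \<subseteq> E"
    unfolding E_def by (rule hull_subset)
  then have En: "nz_ideal E"
    using nz_idealI[OF E _ S(3)] S(2) by blast
  have E_sub: "E \<subseteq> M \<longleftrightarrow> S \<subseteq> M" if "int_ideal M" for M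
    using submodule_hull_minimal[of S M ints] int_idealD(1)[OF that] \<open>S \<subseteq> E\<close> unfolding E_def by blast
  have ram: "ramification_index K S Q = (GREATEST e. E \<subseteq> ipow Q e)"
    unfolding ramification_index_def Let_def genideal_eq_hull[OF S_ints] E_def[symmetric]
    by (simp only: ipow_divides_iff[OF Qn E])
  have one: "ipow Q 1 = Q"
    using imul_ints[OF int_idealD(1)[OF Qi]] by simp
  have two: "ipow Q 2 = imul Q Q"
    using one by (simp add: numeral_2_eq_2)
  have incr: "e \<le> qidx ints (ipow Q e)" for e
  proof (induction e)
    case (Suc e)
    have "imul (ipow Q e) Q \<noteq> ipow Q e"
      by (rule imul_proper[OF nz_ideal_ipow[OF Qn] Qi max_idealD(3)[OF Q]])
    then have "qidx ints (ipow Q e) < qidx ints (ipow Q (Suc e))"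
      using int_ideal_imul(2)[OF int_ideal_ipow[OF Qi] Qi, of e]
      by (intro qidx_less nz_ideal_ipow[OF Qn]) auto
    then show ?case
      using Suc by simp
  qed simp
  have bound: "e \<le> qidx ints E" if "E \<subseteq> ipow Q e" for e
    using incr[of e] qidx_mono[OF nz_ideal_ipow[OF Qn] En that] by simp
  show ?thesis
  proof
    assume r1: "ramification_index K S Q = 1"
    show "\<not> S \<subseteq> imul Q Q"
    proof
      assume "S \<subseteq> imul Q Q"
      then have "E \<subseteq> ipow Q 2"
        using E_sub[OF int_ideal_ipow[OF Qi], of 2] two by simp
      then have "2 \<le> (GREATEST e. E \<subseteq> ipow Q e)"
        by (rule Greatest_le_nat) (use bound in blast)
      then show False
        using r1 ram by simp
    qed
  next
    assume n2: "\<not> S \<subseteq> imul Q Q"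
    show "ramification_index K S Q = 1"
      unfolding ram
    proof (rule Greatest_equality)
      show "E \<subseteq> ipow Q 1"
        using E_sub[OF Qi] S(1) one by simp
      fix e assume e: "E \<subseteq> ipow Q e"
      show "e \<le> 1"
      proof (rule ccontr)
        assume "\<not> e \<le> 1"
        then have "ipow Q e \<subseteq> ipow Q 2"
          by (intro ipow_antimono[OF Qi]) simp
        then have "E \<subseteq> imul Q Q"
          using e two by simp
        then show False
          using n2 E_sub[OF int_ideal_imul(1)[OF Qi Qi]] by simp
      qed
    qed
  qed
qed

section \<open>Quadratic extensions\<close>

text \<open>A root \<open>y\<close> of a monic quadratic polynomial stabilises the module spanned by \<open>1\<close> and \<open>y\<close>.\<close>

lemma ints_quadratic:
  assumes y: "y \<in> K" "y * y = b * y + c" and bc: "b \<in> ints" "c \<in> ints"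
  shows "y \<in> ints"
proof -
  obtain m :: int where m: "m > 0" "of_int m * y \<in> ints"
    by (rule ints_denominator[OF y(1)])
  \<comment> \<open>Scaling by \<open>m\<close> moves the module spanned by \<open>1\<close> and
    \<open>y\<close> into \<open>ints\<close>, where it is a nonzero ideal.\<close>
  let ?A = "smul (of_int m) ints" and ?B = "smul (of_int m * y) ints"
  have A: "int_ideal ?A" and B: "int_ideal ?B"
    by (rule int_ideal_smul_ints, rule ints_of_int, rule int_ideal_smul_ints, rule m(2))
  have I: "int_ideal (isum ?A ?B)"
    by (rule int_ideal_isum[OF A B])
  have "of_int m \<in> isum ?A ?B"
    using isum_upper(1)[OF A B] smulI[OF ints_one, of "of_int m"] by auto
  then have "nz_ideal (isum ?A ?B)"
    by (rule nz_idealI[OF I]) (use m(1) in simp)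
  then show ?thesis
  proof (rule stabilizer_integral[OF _ _ y(1)])
    fix z assume "z \<in> isum ?A ?B"
    then obtain p q where pq: "p \<in> ints" "q \<in> ints" "z = of_int m * p + of_int m * y * q"
      unfolding isum_def by (auto elim!: smulE)
    have "y * z = of_int m * y * p + of_int m * q * (y * y)"
      unfolding pq(3) by (simp add: algebra_simps)
    then have "y * z = of_int m * (c * q) + of_int m * y * (p + b * q)"
      unfolding y(2) by (simp add: algebra_simps)
    moreover have "of_int m * (c * q) \<in> ?A" "of_int m * y * (p + b * q) \<in> ?B"
      using pq bc by (auto intro: smulI ints_mult ints_add)
    ultimately show "y * z \<in> isum ?A ?B"
      unfolding isum_def by blast
  qed
qed

lemma ints_square: "y \<in> K \<Longrightarrow> y * y \<in> ints \<Longrightarrow> y \<in> ints"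
  using ints_quadratic[of y 0 "y * y"] ints_zero by simp

section \<open>Arithmetic modulo a maximal ideal\<close>

lemma max_ideal_unit:
  assumes Q: "max_ideal Q" and d: "d \<in> ints" "d \<notin> Q"
  obtains d' where "d' \<in> ints" "1 - d * d' \<in> Q"
proof -
  note Qi = max_idealD(2)[OF Q]
  have dI: "int_ideal (smul d ints)"
    by (rule int_ideal_smul_ints[OF d(1)])
  have "isum Q (smul d ints) = Q \<or> isum Q (smul d ints) = ints"
    by (rule max_idealD(5)[OF Q int_ideal_isum[OF Qi dI] isum_upper(1)[OF Qi dI]])
  moreover have "d \<in> isum Q (smul d ints)"
    using isum_upper(2)[OF Qi dI] smulI[OF ints_one, of d] by auto
  ultimately have "1 \<in> isum Q (smul d ints)"
    using d(2) ints_one by metis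
  then obtain x d' where x: "x \<in> Q" "d' \<in> ints" "1 = x + d * d'"
    unfolding isum_def by (auto elim!: smulE)
  then have "1 - d * d' = x"
    by (simp add: algebra_simps)
  then show thesis
    using that[OF x(2)] x(1) by simp
qed

text \<open>Modulo \<open>Q\<close> the element \<open>d\<close> has an inverse \<open>d'\<close>,
  and \<open>x = x * (1 - d * d') + d' * (d * x)\<close>, where the first term is a product of two
  elements of \<open>Q\<close>.\<close>

lemma max_ideal_square_cancel:
  assumes Q: "max_ideal Q" and d: "d \<in> ints" "d \<notin> Q" and x: "x \<in> Q" "d * x \<in> imul Q Q"
  shows "x \<in> imul Q Q"
proof -
  obtain d' where d': "d' \<in> ints" "1 - d * d' \<in> Q"
    by (rule max_ideal_unit[OF Q d])
  have "x * (1 - d * d') + d' * (d * x) \<in> imul Q Q"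
    by (intro submodule_over_add[OF submodule_imul] imulI x(1) d'(2)
        submodule_over_mult[OF submodule_imul d'(1) x(2)])
  then show ?thesis
    by (simp add: algebra_simps)
qed

text \<open>The residue ring is a finite field of characteristic two, so squaring is injective on it
  and therefore surjective.\<close>

lemma square_residue:
  assumes Q: "max_ideal Q" and two: "2 \<in> Q" and y: "y \<in> ints"
  obtains z where "z \<in> ints" "y - z * z \<in> Q"
proof -
  note Qi = max_idealD(2)[OF Q]
  note Qz = int_idealD(3)[OF Qi]
  let ?C = "\<lambda>x. {y. y - x \<in> Q}"
  have "card ((\<lambda>x. ?C (x * x)) ` ints) = card (?C ` ints)"
  proof (rule card_image_cong_iff)
    fix a b assume ab: "a \<in> ints" "b \<in> ints"
    have "a * a - b * b \<in> Q \<longleftrightarrow> a - b \<in> Q"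
    proof
      assume "a - b \<in> Q"
      then have "(a + b) * (a - b) \<in> Q"
        by (intro ideal_closed(4)[OF Qi] ints_add ab)
      then show "a * a - b * b \<in> Q"
        by (simp add: algebra_simps)
    next
      assume h: "a * a - b * b \<in> Q"
      have "2 * (b * (a - b)) \<in> Q"
        by (intro ideal_closed(5)[OF Qi two] ints_mult ints_diff ab)
      from ideal_closed(3)[OF Qi h this] have "(a - b) * (a - b) \<in> Q"
        by (simp add: algebra_simps)
      then show "a - b \<in> Q"
        using max_ideal_prime[OF Q] ints_diff[OF ab] by blast
    qed
    then show "?C (a * a) = ?C (b * b) \<longleftrightarrow> ?C a = ?C b"
      unfolding coset_eq_iff[OF Qz] .
  qed
  moreover have "(\<lambda>x. ?C (x * x)) ` ints \<subseteq> ?C ` ints"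
    by (intro image_subsetI imageI ints_mult)
  ultimately have "(\<lambda>x. ?C (x * x)) ` ints = ?C ` ints"
    by (intro card_subset_eq coset_finite[OF max_idealD(1)[OF Q]])
  moreover have "?C y \<in> ?C ` ints"
    by (rule imageI[OF y])
  ultimately have "?C y \<in> (\<lambda>x. ?C (x * x)) ` ints"
    by simp
  then obtain z where z: "z \<in> ints" "?C y = ?C (z * z)"
    by (rule imageE)
  have "y - z * z \<in> Q"
    using z(2) unfolding coset_eq_iff[OF Qz] .
  then show thesis
    by (rule that[OF z(1)])
qed

section \<open>The square condition and the inverse ideal\<close>

lemma square_condition_iff:
  "square_condition K w \<beta> A \<longleftrightarrow> \<beta> \<in> K \<and> \<beta> \<noteq> 0 \<and> (\<exists>z\<in>ints. \<beta>\<^sup>2 * w = 1 + 4 * z) \<and>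
     int_ideal A \<and> smul (\<beta>\<^sup>2 * w) ints = imul A A"
proof -
  have "A [^]\<^bsub>ideals_set OK\<^esub> (2::nat) = imul A A" if "int_ideal A"
    using ideals_set_pow[OF that, of 2] imul_ints[OF int_idealD(1)[OF that]] by (simp add: numeral_2_eq_2)
  then show ?thesis
    unfolding square_condition_def ideal_integer_ring_iff PIdl_eq_smul by auto
qed

text \<open>\<open>u\<close> is generated by products \<open>a * b\<close> of elements of
  \<open>A\<close>, and \<open>x * x * (a * b)\<close> is the product of the integers
  \<open>x * a\<close> and \<open>x * b\<close>.\<close>

lemma inverse_ideal_square:
  assumes A: "int_ideal A" "smul u ints = imul A A" and x: "x \<in> inverse_ideal K A"
  shows "x * x * u \<in> ints"
proof -
  have "imul A A \<subseteq> {v. v * (x * x) \<in> ints}"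
  proof (rule imul_least[OF submodule_multiplier[OF submodule_over_ints]])
    fix a b assume "a \<in> A" "b \<in> A"
    then have "(x * a) * (x * b) \<in> ints"
      using x unfolding inverse_ideal_def by (auto intro: ints_mult)
    then show "a * b \<in> {v. v * (x * x) \<in> ints}"
      by (simp add: mult_ac)
  qed
  moreover have "u \<in> imul A A"
    using smulI[OF ints_one, of u] A(2) by simp
  ultimately show ?thesis
    by (auto simp: mult_ac)
qed

text \<open>For \<open>a\<close> in \<open>A\<close> the square of \<open>x * a\<close> is
  \<open>x * x * u\<close> times an integer, and an element of \<open>K\<close> with integral square
  is integral.\<close>

lemma inverse_idealI:
  assumes A: "int_ideal A" "smul u ints = imul A A" and x: "x \<in> K" "x * x * u \<in> ints"
  shows "x \<in> inverse_ideal K A"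
proof -
  have "x * a \<in> ints" if a: "a \<in> A" for a
  proof (rule ints_square)
    show "x * a \<in> K"
      using K_mult[OF x(1)] ints_K[OF ideal_closed(6)[OF A(1) a]] by blast
    have "a * a \<in> smul u ints"
      unfolding A(2) by (rule imulI[OF a a])
    then obtain r where r: "r \<in> ints" "a * a = u * r"
      by (rule smulE)
    have "(x * a) * (x * a) = x * x * (a * a)"
      by (simp add: mult_ac)
    then have eq: "(x * a) * (x * a) = x * x * u * r"
      unfolding r(2) by (simp add: mult_ac)
    show "(x * a) * (x * a) \<in> ints"
      unfolding eq by (rule ints_mult[OF x(2) r(1)])
  qed
  then show ?thesis
    using x(1) by (simp add: inverse_ideal_def)
qed

end

locale nfield_ext = L: nfield L + M: nfield M for L M :: "'a::field_char_0 set" +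
  assumes LM: "L \<subseteq> M"
begin

lemma L_ints_M: "x \<in> L.ints \<Longrightarrow> x \<in> M.ints"
  using LM by (auto simp: integers_of_def)

lemma M_ints_L: "x \<in> M.ints \<Longrightarrow> x \<in> L \<Longrightarrow> x \<in> L.ints"
  by (simp add: integers_of_def)

lemma submodule_over_L_ints: "submodule_over M.ints N \<Longrightarrow> submodule_over L.ints N"
  by (rule submodule_over_subset) (auto intro: L_ints_M)

text \<open>With \<open>\<beta>^2 w = 1 + 4 z\<close> the element \<open>(1 + \<beta> s) / 2\<close>
  is a root of \<open>y^2 = y + z\<close>, and \<open>x \<beta> s\<close> has the square
  \<open>x^2 \<beta>^2 w\<close>. \<open>M\<close> is any number field that contains
  \<open>L\<close> and \<open>s\<close>, so that the case \<open>s \<in> L\<close> is covered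
  too.\<close>

lemma square_condition_generators:
  assumes sc: "square_condition L w \<beta> A" and s: "s \<in> M" "s\<^sup>2 = w"
  shows "(1 + \<beta> * s) / 2 \<in> M.ints" "x \<in> inverse_ideal L A \<Longrightarrow> x * \<beta> * s \<in> M.ints"
proof -
  obtain z where z: "z \<in> L.ints" "\<beta>\<^sup>2 * w = 1 + 4 * z"
    and \<beta>: "\<beta> \<in> L" and A: "L.int_ideal A" "L.smul (\<beta>\<^sup>2 * w) L.ints = L.imul A A"
    using sc unfolding L.square_condition_iff by blast
  have t: "(\<beta> * s) * (\<beta> * s) = 1 + 4 * z"
    using z(2) s(2) by (simp add: power2_eq_square mult_ac)
  let ?y = "(1 + \<beta> * s) / 2"
  have "(1 + \<beta> * s) * (1 + \<beta> * s) = 1 + 2 * (\<beta> * s) + (\<beta> * s) * (\<beta> * s)"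
    by (simp only: distrib_left distrib_right) simp
  also have "\<dots> = 2 * (1 + \<beta> * s) + 4 * z"
    unfolding t by simp
  finally have "?y * ?y = (2 * (1 + \<beta> * s) + 4 * z) / 4"
    by simp
  then have y: "?y * ?y = 1 * ?y + z"
    by (simp add: add_divide_distrib)
  have "?y \<in> M"
    using \<beta> s LM by (intro M.K_divide M.K_add M.K_one M.K_mult M.K_numeral) auto
  then show "?y \<in> M.ints"
    by (rule M.ints_quadratic[OF _ y M.ints_one L_ints_M[OF z(1)]])
  assume x: "x \<in> inverse_ideal L A"
  show "x * \<beta> * s \<in> M.ints"
  proof (rule M.ints_square)
    show "x * \<beta> * s \<in> M"
      using x \<beta> s LM by (intro M.K_mult) (auto simp: inverse_ideal_def)
    have eq: "x * \<beta> * s * (x * \<beta> * s) = x * x * (\<beta>\<^sup>2 * w)"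
      using s(2) by (auto simp: power2_eq_square mult_ac)
    show "x * \<beta> * s * (x * \<beta> * s) \<in> M.ints"
      unfolding eq by (rule L_ints_M[OF L.inverse_ideal_square[OF A x]])
  qed
qed

end

section \<open>A proper quadratic extension in coordinates over the base field\<close>

locale quadratic =
  fixes L :: "'a::field_char_0 set" and w s :: 'a
  assumes nfL: "number_field L" and wL: "w \<in> L" and s2: "s * s = w" and sL: "s \<notin> L"
begin

sublocale L: nfield L
  by unfold_locales (rule nfL)

definition M :: "'a set" where
  "M = {a + b * s | a b. a \<in> L \<and> b \<in> L}"

lemma M_I: "a \<in> L \<Longrightarrow> b \<in> L \<Longrightarrow> a + b * s \<in> M"
  unfolding M_def by blast

lemma M_E:
  assumes "x \<in> M"
  obtains a b where "a \<in> L" "b \<in> L" "x = a + b * s"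
  using assms unfolding M_def by blast

lemma w_nonzero: "w \<noteq> 0"
  using sL s2 L.K_zero by auto

lemma coord_zero:
  assumes "a \<in> L" "b \<in> L" "a + b * s = 0"
  shows "a = 0" "b = 0"
proof -
  show "b = 0"
  proof (rule ccontr)
    assume "b \<noteq> 0"
    then have "s = - a / b"
      using assms(3) by (simp add: field_simps add_eq_0_iff)
    then show False
      using sL assms(1,2) L.K_divide[OF L.K_uminus] by simp
  qed
  then show "a = 0"
    using assms(3) by simp
qed

lemma coord_unique:
  assumes "a \<in> L" "b \<in> L" "c \<in> L" "d \<in> L" "a + b * s = c + d * s"
  shows "a = c" "b = d"
proof -
  have "(a - c) + (b - d) * s = 0"
    using assms(5) by (simp add: algebra_simps)
  note z = coord_zero[OF L.K_diff[OF assms(1,3)] L.K_diff[OF assms(2,4)] this]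
  show "a = c" "b = d"
    using z by simp_all
qed

text \<open>Coordinates are unique on \<open>M\<close>, so the choice is forced there. Outside
  \<open>M\<close> the value is unspecified, whence the side conditions \<open>x \<in> M\<close>
  below.\<close>

definition cj :: "'a \<Rightarrow> 'a" where
  "cj x = (SOME y. \<exists>a\<in>L. \<exists>b\<in>L. x = a + b * s \<and> y = a - b * s)"

lemma cj_eq:
  assumes "a \<in> L" "b \<in> L"
  shows "cj (a + b * s) = a - b * s"
  unfolding cj_def by (rule some_equality) (use assms coord_unique in blast)+

lemma L_M: "L \<subseteq> M"
  using M_I[OF _ L.K_zero] by auto

lemma s_M: "s \<in> M"
  using M_I[OF L.K_zero L.K_one] by simp

lemma M_mult_eq: "(a + b * s) * (c + d * s) = (a * c + b * d * w) + (a * d + b * c) * s"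
  by (simp add: algebra_simps s2[symmetric])

lemma M_add: "x \<in> M \<Longrightarrow> y \<in> M \<Longrightarrow> x + y \<in> M"
proof (elim M_E)
  fix a b c d assume h: "a \<in> L" "b \<in> L" "x = a + b * s" "c \<in> L" "d \<in> L" "y = c + d * s"
  then have "x + y = (a + c) + (b + d) * s" by (simp add: algebra_simps)
  then show "x + y \<in> M" using h by (simp only:) (intro M_I L.K_add)
qed

lemma M_mult: "x \<in> M \<Longrightarrow> y \<in> M \<Longrightarrow> x * y \<in> M"
  by (elim M_E) (simp only: M_mult_eq, intro M_I L.K_add L.K_mult wL)

lemma M_uminus: "x \<in> M \<Longrightarrow> - x \<in> M"
  using M_mult[of "- 1" x] L_M L.K_uminus[OF L.K_one] by auto

lemma M_inverse: "x \<in> M \<Longrightarrow> x \<noteq> 0 \<Longrightarrow> inverse x \<in> M"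
proof (elim M_E)
  fix a b assume h: "a \<in> L" "b \<in> L" "x = a + b * s" "x \<noteq> 0"
  \<comment> \<open>The norm of \<open>x\<close>: were it \<open>0\<close>, the factor
    \<open>a - b * s\<close> would vanish and \<open>a = b = 0\<close> would follow.\<close>
  define N where "N = a * a - b * b * w"
  have xN: "x * (a - b * s) = N"
    unfolding h(3) N_def by (simp add: algebra_simps s2[symmetric])
  have "N \<noteq> 0"
  proof
    assume "N = 0"
    then have "a + (- b) * s = 0"
      using xN h(4) by simp
    then have "a = 0" "- b = 0"
      by (rule coord_zero[OF h(1) L.K_uminus[OF h(2)]])+
    then show False
      using h(3,4) by simp
  qed
  then have "x * ((a - b * s) / N) = 1"
    using xN by simp
  then have "inverse x = (a - b * s) / N"
    by (rule inverse_unique)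
  also have "\<dots> = a / N + (- b / N) * s"
    by (simp add: diff_divide_distrib)
  also have "\<dots> \<in> M"
    unfolding N_def using h(1,2) by (intro M_I L.K_divide L.K_uminus L.K_diff L.K_mult wL)
  finally show "inverse x \<in> M" .
qed

lemma subfield_M: "subfield M ring_of_type_algebra"
  by (rule subfield_ring_of_type_algebraI)
     (use L_M L.K_one M_add M_mult M_uminus M_inverse in auto)

lemma adjoin_eq: "adjoin L s = M"
proof -
  interpret R: field "ring_of_type_algebra :: 'a ring"
    by (rule field_from_type_algebra)
  show ?thesis
    unfolding adjoin_def
  proof
    show "generate_field ring_of_type_algebra (insert s L) \<subseteq> M"
      by (rule R.generate_field_min_subfield1[OF _ subfield_M]) (use L_M s_M in auto)
    show "M \<subseteq> generate_field ring_of_type_algebra (insert s L)"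
    proof
      fix x assume "x \<in> M"
      then obtain a b where h: "a \<in> L" "b \<in> L" "x = a + b * s"
        by (rule M_E)
      have "a \<oplus>\<^bsub>ring_of_type_algebra\<^esub> (b \<otimes>\<^bsub>ring_of_type_algebra\<^esub> s)
          \<in> generate_field ring_of_type_algebra (insert s L)"
        using h by (intro generate_field.eng_add generate_field.eng_mult generate_field.incl) auto
      then show "x \<in> generate_field ring_of_type_algebra (insert s L)"
        using h(3) by simp
    qed
  qed
qed

text \<open>Concatenation of two families: a basis of \<open>M\<close> consists of \<open>n\<close>
  elements of \<open>L\<close> followed by \<open>n\<close> elements involving \<open>s\<close>, and
  its Gram matrix splits into blocks.\<close>

definition fam2 :: "nat \<Rightarrow> (nat \<Rightarrow> 'a) \<Rightarrow> (nat \<Rightarrow> 'a) \<Rightarrow> nat \<Rightarrow> 'a" where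
  "fam2 n f g k = (if k < n then f k else g (k - n))"

lemma sum_split:
  fixes F :: "nat \<Rightarrow> 'b::comm_monoid_add" and m n :: nat
  shows "(\<Sum>k<n + m. F k) = (\<Sum>k<n. F k) + (\<Sum>k<m. F (n + k))"
  by (induction m) (simp_all add: add.assoc)

lemma sum_fam2: "(\<Sum>k<n + m. c k * fam2 n f g k) = (\<Sum>k<n. c k * f k) + (\<Sum>k<m. c (n + k) * g k)"
  by (simp add: sum_split fam2_def)

text \<open>The coefficient of \<open>s\<close> in a relation involves the second half alone and is
  trivial by independence of \<open>\<gamma>\<close>; a relation among the \<open>e i\<close>
  remains. The \<open>\<alpha> i\<close> are arbitrary because the \<open>L\<close>-parts of an
  integral basis of \<open>M\<close> are not under control.\<close>

lemma qindep_fam2: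
  assumes e: "qindep n e" and ge: "qindep n \<gamma>"
    and L: "\<And>i. i < n \<Longrightarrow> e i \<in> L" "\<And>i. i < n \<Longrightarrow> \<alpha> i \<in> L" "\<And>i. i < n \<Longrightarrow> \<gamma> i \<in> L"
  shows "qindep (n + n) (fam2 n e (\<lambda>i. \<alpha> i + \<gamma> i * s))"
  unfolding qindep_def
proof (intro allI impI)
  fix c :: "nat \<Rightarrow> rat" and k
  assume c: "(\<Sum>k<n + n. of_rat (c k) * fam2 n e (\<lambda>i. \<alpha> i + \<gamma> i * s) k) = 0" and k: "k < n + n"
  let ?a = "(\<Sum>i<n. of_rat (c i) * e i) + (\<Sum>i<n. of_rat (c (n + i)) * \<alpha> i)"
  let ?b = "\<Sum>i<n. of_rat (c (n + i)) * \<gamma> i"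
  have sub: "(\<Sum>i<n. of_rat (d i) * f i) \<in> L" if "\<And>i. i < n \<Longrightarrow> f i \<in> L" for d f
    by (rule submodule_over_sum[OF L.submodule_over_Rats_K]) (use that in \<open>auto intro: L.K_mult L.K_of_rat\<close>)
  have z: "?a + ?b * s = 0"
    using c unfolding sum_fam2 by (simp add: distrib_left sum.distrib sum_distrib_right mult.assoc add.assoc)
  have aL: "?a \<in> L"
    by (rule L.K_add[OF sub[OF L(1)] sub[OF L(2)]])
  have bL: "?b \<in> L"
    by (rule sub[OF L(3)])
  note ab = coord_zero[OF aL bL z]
  have c2: "\<forall>i<n. c (n + i) = 0"
    using ge ab(2) unfolding qindep_def by (elim allE[of _ "\<lambda>i. c (n + i)"]) simp
  then have "(\<Sum>i<n. of_rat (c i) * e i) = 0"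
    using ab(1) by simp
  then have c1: "\<forall>i<n. c i = 0"
    using e unfolding qindep_def by (elim allE[of _ c]) simp
  show "c k = 0"
    using c1 c2[rule_format, of "k - n"] k by (cases "k < n") auto
qed

text \<open>The summand \<open>0\<close> keeps the shape of \<open>qindep_fam2\<close>, with
  \<open>\<alpha> i = 0\<close> and \<open>\<gamma> i = e i\<close>.\<close>

lemma qspan_fam2:
  assumes e: "qspan n e = L"
  shows "qspan (n + n) (fam2 n e (\<lambda>i. 0 + e i * s)) = M"
proof (intro subset_antisym subsetI)
  fix x assume "x \<in> M"
  then obtain a b where h: "a \<in> L" "b \<in> L" "x = a + b * s"
    by (rule M_E)
  obtain c d where "a = (\<Sum>i<n. of_rat (c i) * e i)" "b = (\<Sum>i<n. of_rat (d i) * e i)"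
    using h(1,2) e by (metis qspanE)
  then have "x = (\<Sum>k<n + n. of_rat (if k < n then c k else d (k - n)) * fam2 n e (\<lambda>i. 0 + e i * s) k)"
    unfolding h(3) sum_fam2 by (simp add: sum_distrib_right mult.assoc)
  then show "x \<in> qspan (n + n) (fam2 n e (\<lambda>i. 0 + e i * s))"
    by (rule qspanI)
next
  fix x assume "x \<in> qspan (n + n) (fam2 n e (\<lambda>i. 0 + e i * s))"
  then obtain c where "x = (\<Sum>k<n + n. of_rat (c k) * fam2 n e (\<lambda>i. 0 + e i * s) k)"
    by (rule qspanE)
  then have "x = (\<Sum>i<n. of_rat (c i) * e i) + (\<Sum>i<n. of_rat (c (n + i)) * e i) * s"
    unfolding sum_fam2 by (simp add: sum_distrib_right mult.assoc)
  moreover have "(\<Sum>i<n. of_rat (d i) * e i) \<in> L" for d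
    using e by (auto intro: qspanI)
  ultimately show "x \<in> M"
    by (simp only:) (intro M_I)
qed

lemma number_field_M: "number_field M"
proof -
  obtain e where "qindep L.ndeg e" "qspan L.ndeg e = L"
    by (rule number_field_basis[OF nfL])
  then show ?thesis
    using number_fieldI[OF subfield_M qspan_fam2] by blast
qed

sublocale M: nfield M
  by unfold_locales (rule number_field_M)

sublocale nfield_ext L M
  by unfold_locales (rule L_M)

lemma degree_M: "M.ndeg = L.ndeg + L.ndeg"
proof -
  obtain e where e: "qindep L.ndeg e" "qspan L.ndeg e = L"
    by (rule number_field_basis[OF nfL])
  have "qindep (L.ndeg + L.ndeg) (fam2 L.ndeg e (\<lambda>i. 0 + e i * s))"
    by (rule qindep_fam2[OF e(1) e(1)]) (use L.basis_mem[OF e(2)] L.K_zero in auto)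
  from M.deg_eq[OF this qspan_fam2[OF e(2)]] show ?thesis
    by simp
qed

section \<open>Conjugation, relative trace and relative norm\<close>

lemma cj_L: "a \<in> L \<Longrightarrow> cj a = a"
  using cj_eq[of a 0] L.K_zero by simp

lemma cj_M: "x \<in> M \<Longrightarrow> cj x \<in> M"
proof (elim M_E)
  fix a b assume "a \<in> L" "b \<in> L" "x = a + b * s"
  then show "cj x \<in> M"
    using M_I[OF _ L.K_uminus, of a b] by (simp add: cj_eq)
qed

lemma cj_add: "x \<in> M \<Longrightarrow> y \<in> M \<Longrightarrow> cj (x + y) = cj x + cj y"
proof (elim M_E)
  fix a b c d assume h: "a \<in> L" "b \<in> L" "x = a + b * s" "c \<in> L" "d \<in> L" "y = c + d * s"
  have eq: "x + y = (a + c) + (b + d) * s"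
    using h by (simp add: algebra_simps)
  have "cj (x + y) = (a + c) - (b + d) * s"
    unfolding eq by (intro cj_eq L.K_add h)
  also have "\<dots> = (a - b * s) + (c - d * s)"
    by (simp add: algebra_simps)
  finally show "cj (x + y) = cj x + cj y"
    using h by (simp add: cj_eq)
qed

lemma cj_mult: "x \<in> M \<Longrightarrow> y \<in> M \<Longrightarrow> cj (x * y) = cj x * cj y"
proof (elim M_E)
  fix a b c d assume h: "a \<in> L" "b \<in> L" "x = a + b * s" "c \<in> L" "d \<in> L" "y = c + d * s"
  have "cj (x * y) = (a * c + b * d * w) - (a * d + b * c) * s"
    unfolding h M_mult_eq by (intro cj_eq L.K_add L.K_mult h wL)
  also have "\<dots> = (a - b * s) * (c - d * s)"
    by (simp add: algebra_simps s2[symmetric])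
  finally show "cj (x * y) = cj x * cj y"
    using h by (simp add: cj_eq)
qed

lemma cj_cj: "x \<in> M \<Longrightarrow> cj (cj x) = x"
proof (elim M_E)
  fix a b assume h: "a \<in> L" "b \<in> L" "x = a + b * s"
  then show "cj (cj x) = x"
    using cj_eq[OF h(1) L.K_uminus[OF h(2)]] by (simp add: cj_eq)
qed

lemma cj_trace_norm: "x \<in> M \<Longrightarrow> x + cj x \<in> L" "x \<in> M \<Longrightarrow> x * cj x \<in> L"
proof -
  have "x + cj x \<in> L \<and> x * cj x \<in> L" if x: "x \<in> M"
  proof -
    obtain a b where h: "a \<in> L" "b \<in> L" "x = a + b * s"
      using x by (rule M_E)
    have "x + cj x = a + a" "x * cj x = a * a - b * b * w"
      using h by (simp_all add: cj_eq algebra_simps s2[symmetric])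
    then show ?thesis
      using h(1,2) wL by (simp only:) (intro conjI L.K_add L.K_diff L.K_mult)
  qed
  then show "x \<in> M \<Longrightarrow> x + cj x \<in> L" "x \<in> M \<Longrightarrow> x * cj x \<in> L"
    by auto
qed

lemma cj_fixed: "x \<in> M \<Longrightarrow> cj x = x \<Longrightarrow> x \<in> L"
proof -
  assume x: "x \<in> M" "cj x = x"
  then have "(x + x) / 2 \<in> L"
    using cj_trace_norm(1)[of x] by (intro L.K_divide L.K_numeral) simp
  then show "x \<in> L"
    by simp
qed

text \<open>Conjugation fixes integer coefficients and so carries a root of an integer polynomial to
  a root. Membership in \<open>M\<close> goes along in the induction because \<open>cj_add\<close>
  and \<open>cj_mult\<close> demand it.\<close>

lemma cj_ints: "x \<in> M.ints \<Longrightarrow> cj x \<in> M.ints"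
proof -
  assume x: "x \<in> M.ints"
  then have xM: "x \<in> M" by (rule M.ints_K)
  obtain p where p: "poly (map_poly of_int p) x = 0" "lead_coeff p = 1"
    using x by (auto simp: integers_of_def algebraic_int_altdef_ipoly)
  have "poly (map_poly of_int q) x \<in> M \<and> poly (map_poly of_int q) (cj x) = cj (poly (map_poly of_int q) x)" for q
  proof (induction q)
    case 0
    then show ?case using L_M L.K_zero cj_L by auto
  next
    case (pCons a q)
    have "of_int a \<in> L"
      by (rule L.K_of_int)
    then have "of_int a \<in> M" "cj (of_int a) = of_int a"
      using L_M cj_L by auto
    then show ?case
      using pCons.IH xM by (simp add: of_int_hom.map_poly_pCons_hom M_add M_mult cj_add cj_mult)
  qed
  then have "poly (map_poly of_int p) (cj x) = 0"
    using p(1) cj_L[OF L.K_zero] by simp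
  then show "cj x \<in> M.ints"
    using p(2) cj_M[OF xM] by (auto simp: integers_of_def algebraic_int_altdef_ipoly)
qed

lemma norm_ints: "x \<in> M.ints \<Longrightarrow> x * cj x \<in> L.ints"
  and trace_ints: "x \<in> M.ints \<Longrightarrow> x + cj x \<in> L.ints"
  using cj_ints[of x] cj_trace_norm[of x] M.ints_K[of x]
  by (auto intro!: M_ints_L M.ints_mult M.ints_add)

text \<open>The elements \<open>x - cj x\<close>, for \<open>x\<close> integral, are the multiples \<open>c * s\<close> with \<open>c \<in> codiff\<close>;
  their products generate the relative discriminant ideal \<open>rdisc\<close>.\<close>

definition codiff :: "'a set" where
  "codiff = {c \<in> L. \<exists>x\<in>M.ints. x - cj x = c * s}"

definition rdisc :: "'a set" where
  "rdisc = L.smul w (L.imul codiff codiff)"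

lemma codiffE:
  assumes "c \<in> codiff"
  obtains x where "c \<in> L" "x \<in> M.ints" "x - cj x = c * s"
  using assms unfolding codiff_def by blast

lemma codiffI: "x \<in> M.ints \<Longrightarrow> c \<in> L \<Longrightarrow> x - cj x = c * s \<Longrightarrow> c \<in> codiff"
  unfolding codiff_def by blast

lemma s_nonzero: "s \<noteq> 0"
  using sL L.K_zero by auto

lemma ints_codiff:
  assumes "x \<in> M.ints"
  obtains c where "c \<in> codiff" "x - cj x = c * s"
proof -
  obtain a b where h: "a \<in> L" "b \<in> L" "x = a + b * s"
    by (rule M_E[OF M.ints_K[OF assms]])
  have "x - cj x = (b + b) * s"
    using h by (simp add: cj_eq algebra_simps)
  then show thesis
    using that codiffI[OF assms L.K_add[OF h(2,2)]] by blast
qed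

lemma submodule_codiff: "submodule_over L.ints codiff"
proof (rule submodule_overI)
  show "0 \<in> codiff"
    by (rule codiffI[OF M.ints_zero L.K_zero]) (simp add: cj_L L.K_zero)
next
  fix c d assume "c \<in> codiff" "d \<in> codiff"
  then obtain x y where h: "c \<in> L" "x \<in> M.ints" "x - cj x = c * s" "d \<in> L" "y \<in> M.ints" "y - cj y = d * s"
    by (elim codiffE)
  have "(x + y) - cj (x + y) = (x - cj x) + (y - cj y)"
    using cj_add[OF M.ints_K[OF h(2)] M.ints_K[OF h(5)]] by simp
  then show "c + d \<in> codiff"
    using h by (intro codiffI[OF M.ints_add[OF h(2,5)] L.K_add[OF h(1,4)]]) (simp add: distrib_right)
next
  fix r c assume r: "r \<in> L.ints" and "c \<in> codiff"
  then obtain x where h: "c \<in> L" "x \<in> M.ints" "x - cj x = c * s"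
    by (elim codiffE)
  have rL: "r \<in> L"
    by (rule L.ints_K[OF r])
  have "cj (r * x) = r * cj x"
    using cj_mult[of r x] L_M rL M.ints_K[OF h(2)] cj_L[OF rL] by auto
  then have "r * x - cj (r * x) = r * c * s"
    using h(3) by (simp add: right_diff_distrib[symmetric] mult.assoc)
  then show "r * c \<in> codiff"
    by (rule codiffI[OF M.ints_mult[OF L_ints_M[OF r] h(2)] L.K_mult[OF rL h(1)]])
qed

lemma codiff_prod:
  assumes x: "x \<in> M.ints" "x - cj x = c * s" and y: "y \<in> M.ints" "y - cj y = d * s"
  shows "c * d * w = (x * y + cj (x * y)) - (x * cj y + cj (x * cj y))"
proof -
  have xy: "x \<in> M" "y \<in> M"
    using x y M.ints_K by auto
  have "c * d * w = (c * s) * (d * s)"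
    unfolding s2[symmetric] by (simp add: mult_ac)
  also have "\<dots> = (x - cj x) * (y - cj y)"
    using x(2) y(2) by simp
  finally show ?thesis
    using cj_mult[OF xy] cj_mult[OF xy(1) cj_M[OF xy(2)]] cj_cj[OF xy(2)] by (simp add: algebra_simps)
qed

lemma codiff_prod_ints:
  assumes "c \<in> codiff" "d \<in> codiff"
  shows "c * d * w \<in> L.ints"
proof -
  obtain x y where h: "c \<in> L" "x \<in> M.ints" "x - cj x = c * s" "d \<in> L" "y \<in> M.ints" "y - cj y = d * s"
    using assms by (elim codiffE)
  show ?thesis
    unfolding codiff_prod[OF h(2,3,5,6)]
    using h cj_ints by (intro L.ints_diff trace_ints M.ints_mult)
qed

lemma codiff_mult_s: "c \<in> codiff \<Longrightarrow> c * s \<in> M.ints"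
  by (elim codiffE) (metis M.ints_diff cj_ints)

lemma rdisc_least:
  assumes "submodule_over L.ints N" "\<And>c d. c \<in> codiff \<Longrightarrow> d \<in> codiff \<Longrightarrow> c * d * w \<in> N"
  shows "rdisc \<subseteq> N"
proof -
  have "L.imul codiff codiff \<subseteq> {u. u * w \<in> N}"
    by (rule L.imul_least[OF L.submodule_multiplier[OF assms(1)]]) (use assms(2) in simp)
  then show ?thesis
    unfolding rdisc_def by (auto elim!: L.smulE simp: mult.commute)
qed

lemma rdiscI: "c \<in> codiff \<Longrightarrow> d \<in> codiff \<Longrightarrow> c * d * w \<in> rdisc"
  using L.smulI[OF L.imulI[of c codiff d codiff], of w] unfolding rdisc_def by (simp add: mult_ac)

lemma int_ideal_rdisc: "L.int_ideal rdisc"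
  unfolding L.int_ideal_def
proof
  show "submodule_over L.ints rdisc"
    unfolding rdisc_def by (rule L.submodule_smul[OF L.submodule_imul])
  show "rdisc \<subseteq> L.ints"
    by (rule rdisc_least[OF L.submodule_over_ints codiff_prod_ints])
qed

lemma codiff_nonzero:
  obtains c where "c \<in> codiff" "c \<noteq> 0"
proof -
  obtain m :: int where m: "m > 0" "of_int m * s \<in> M.ints"
    by (rule M.ints_denominator[OF s_M])
  have "cj (of_int m * s) = - (of_int m * s)"
    using cj_eq[OF L.K_zero L.K_of_int[of m]] by simp
  then have "of_int m * s - cj (of_int m * s) = of_int (2 * m) * s"
    by simp
  then have "of_int (2 * m) \<in> codiff"
    by (rule codiffI[OF m(2) L.K_of_int])
  then show thesis
    using that m(1) by simp
qed

lemma nz_ideal_rdisc: "L.nz_ideal rdisc"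
proof -
  obtain c where c: "c \<in> codiff" "c \<noteq> 0"
    by (rule codiff_nonzero)
  show ?thesis
    by (rule L.nz_idealI[OF int_ideal_rdisc rdiscI[OF c(1) c(1)]]) (use c(2) w_nonzero in simp)
qed

text \<open>With \<open>m * s\<close> integral and \<open>c\<close> in \<open>codiff\<close>, the
  product \<open>(m * s) * (c * s) = m * c * w\<close> is integral, and \<open>k\<close> removes
  \<open>w\<close>. So \<open>codiff\<close> is a fractional ideal, and results on ideals reach it
  by scaling.\<close>

lemma codiff_denominator:
  obtains q :: int where "q > 0" "L.int_ideal (L.smul (of_int q) codiff)"
proof -
  obtain m :: int where m: "m > 0" "of_int m * s \<in> M.ints"
    by (rule M.ints_denominator[OF s_M])
  obtain k :: int where k: "k > 0" "of_int k * inverse w \<in> L.ints"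
    by (rule L.ints_denominator[OF L.K_inverse[OF wL]])
  have "of_int (m * k) * c \<in> L.ints" if c: "c \<in> codiff" for c
  proof -
    have cL: "c \<in> L"
      using c by (rule codiffE)
    have "(of_int m * s) * (c * s) = of_int m * c * w"
      unfolding s2[symmetric] by (simp add: mult_ac)
    then have "of_int m * c * w \<in> M.ints"
      using M.ints_mult[OF m(2) codiff_mult_s[OF c]] by (simp only:)
    then have "of_int m * c * w \<in> L.ints"
      by (rule M_ints_L) (intro L.K_mult L.K_of_int cL wL)
    from L.ints_mult[OF this k(2)]
    have "of_int m * c * w * (of_int k * inverse w) \<in> L.ints" .
    moreover have "of_int (m * k) * c = of_int m * c * w * (of_int k * inverse w)"
      using w_nonzero by (simp add: field_simps)
    ultimately show ?thesis
      by (simp only:)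
  qed
  then have "L.int_ideal (L.smul (of_int (m * k)) codiff)"
    unfolding L.int_ideal_def
    by (intro conjI L.submodule_smul submodule_codiff subsetI) (auto elim!: L.smulE)
  then show thesis
    by (rule that[rotated]) (simp add: m(1) k(1))
qed

section \<open>The ring of integers under the square condition\<close>

text \<open>Put \<open>u = \<beta>^2 w = 1 + 4 z\<close>. Since \<open>\<beta>\<close> is in
  \<open>codiff\<close>, \<open>u\<close> is in \<open>rdisc\<close>. Since \<open>2 \<beta>\<close>
  times the inverse of \<open>A\<close> is in \<open>codiff\<close>, \<open>rdisc\<close> contains
  \<open>4 u\<close> times the square of that inverse, which is generated by \<open>4\<close>
  because \<open>A A\<close> is generated by \<open>u\<close>. Hence \<open>1 = u - 4 z\<close> is
  in \<open>rdisc\<close>.\<close>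

lemma square_condition_imp_rdisc:
  assumes sc: "square_condition L w \<beta> A"
  shows "rdisc = L.ints"
proof -
  obtain z where z: "z \<in> L.ints" "\<beta>\<^sup>2 * w = 1 + 4 * z"
    and \<beta>: "\<beta> \<in> L" "\<beta> \<noteq> 0" and A: "L.int_ideal A" "L.smul (\<beta>\<^sup>2 * w) L.ints = L.imul A A"
    using sc unfolding L.square_condition_iff by blast
  have ss: "s\<^sup>2 = w"
    using s2 by (simp add: power2_eq_square)
  note gen = square_condition_generators[OF sc s_M ss]
  define u where "u = \<beta>\<^sup>2 * w"
  have uL: "u \<in> L" and u0: "u \<noteq> 0"
    using \<beta> wL w_nonzero by (auto simp: u_def power2_eq_square intro: L.K_mult)
  have "cj (1 / 2 + \<beta> / 2 * s) = 1 / 2 - \<beta> / 2 * s"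
    by (intro cj_eq L.K_divide L.K_one L.K_numeral \<beta>)
  then have "(1 + \<beta> * s) / 2 - cj ((1 + \<beta> * s) / 2) = \<beta> * s"
    by (simp add: add_divide_distrib)
  then have \<beta>C: "\<beta> \<in> codiff"
    by (rule codiffI[OF gen(1) \<beta>(1)])
  have "\<beta> * \<beta> * w = u"
    by (simp add: u_def power2_eq_square)
  then have u_mem: "u \<in> rdisc"
    using rdiscI[OF \<beta>C \<beta>C] by simp
  have xC: "2 * x * \<beta> \<in> codiff" if x: "x \<in> inverse_ideal L A" for x
  proof (rule codiffI[OF gen(2)[OF x]])
    have xL: "x \<in> L"
      using x by (simp add: inverse_ideal_def)
    show "2 * x * \<beta> \<in> L"
      by (intro L.K_mult L.K_numeral xL \<beta>)
    have "cj (0 + x * \<beta> * s) = 0 - x * \<beta> * s"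
      by (intro cj_eq L.K_zero L.K_mult xL \<beta>)
    then show "x * \<beta> * s - cj (x * \<beta> * s) = 2 * x * \<beta> * s"
      by simp
  qed
  \<comment> \<open>As \<open>A A\<close> is generated by \<open>u\<close>, dividing elements of
    \<open>A\<close> by \<open>u\<close> leads into the inverse of \<open>A\<close>.\<close>
  have inv: "a / u \<in> inverse_ideal L A" if a: "a \<in> A" for a
    unfolding inverse_ideal_def
  proof (intro CollectI conjI ballI)
    show "a / u \<in> L"
      using uL L.ints_K[OF L.ideal_closed(6)[OF A(1) a]] by (intro L.K_divide)
    fix b assume "b \<in> A"
    then have "a * b \<in> L.smul u L.ints"
      unfolding u_def A(2) using a by (intro L.imulI)
    then show "a / u * b \<in> L.ints"
      using u0 by (auto elim!: L.smulE simp: field_simps)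
  qed
  have "L.imul A A \<subseteq> {v. v * (4 / u) \<in> rdisc}"
  proof (rule L.imul_least[OF L.submodule_multiplier[OF L.int_idealD(1)[OF int_ideal_rdisc]]])
    fix a b assume ab: "a \<in> A" "b \<in> A"
    have "(2 * (a / u) * \<beta>) * (2 * (b / u) * \<beta>) * w = 4 * (a * b) * (\<beta>\<^sup>2 * w) / (u * u)"
      by (simp add: power2_eq_square mult_ac)
    also have "\<dots> = a * b * (4 / u)"
      unfolding u_def[symmetric] using u0 by simp
    finally show "a * b \<in> {v. v * (4 / u) \<in> rdisc}"
      using rdiscI[OF xC[OF inv[OF ab(1)]] xC[OF inv[OF ab(2)]]] by simp
  qed
  moreover have "u \<in> L.imul A A"
    using L.smulI[OF L.ints_one, of u] A(2) unfolding u_def by simp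
  ultimately have "4 \<in> rdisc"
    using u0 by auto
  then have "u - 4 * z \<in> rdisc"
    by (intro L.ideal_closed(3)[OF int_ideal_rdisc u_mem] L.ideal_closed(5)[OF int_ideal_rdisc] z(1))
  then have "1 \<in> rdisc"
    using z(2) unfolding u_def by simp
  then show ?thesis
    by (rule L.ideal_eq_ints[OF int_ideal_rdisc])
qed

text \<open>If \<open>1\<close> lies in \<open>rdisc\<close> then it is the trace of an integer \<open>y\<close>, and \<open>\<beta> * s = y - cj y\<close> works.\<close>

lemma rdisc_imp_square_condition:
  assumes r: "rdisc = L.ints"
  shows "\<exists>\<beta> A. square_condition L w \<beta> A"
proof -
  \<comment> \<open>Traces of integers form a module over \<open>L.ints\<close>, so it suffices that
    the generators \<open>c * d * w\<close> of \<open>rdisc\<close> are traces.\<close>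
  let ?T = "{t. \<exists>x\<in>M.ints. t = x + cj x}"
  have T: "submodule_over L.ints ?T"
  proof (rule submodule_overI)
    show "0 \<in> ?T"
      using M.ints_zero cj_L[OF L.K_zero] by (auto intro!: bexI[of _ 0])
  next
    fix p q assume "p \<in> ?T" "q \<in> ?T"
    then obtain x y where h: "x \<in> M.ints" "y \<in> M.ints" "p = x + cj x" "q = y + cj y"
      by blast
    have "p + q = (x + y) + cj (x + y)"
      using h cj_add[OF M.ints_K[OF h(1)] M.ints_K[OF h(2)]] by simp
    then show "p + q \<in> ?T"
      using M.ints_add[OF h(1,2)] by blast
  next
    fix a p assume a: "a \<in> L.ints" and "p \<in> ?T"
    then obtain x where h: "x \<in> M.ints" "p = x + cj x"
      by blast
    have aL: "a \<in> L"
      by (rule L.ints_K[OF a])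
    have "a * p = a * x + cj (a * x)"
      using h cj_mult[of a x] L_M aL M.ints_K[OF h(1)] cj_L[OF aL] by (auto simp: distrib_left)
    then show "a * p \<in> ?T"
      using M.ints_mult[OF L_ints_M[OF a] h(1)] by blast
  qed
  have "rdisc \<subseteq> ?T"
  proof (rule rdisc_least[OF T])
    fix c d assume "c \<in> codiff" "d \<in> codiff"
    then obtain x y where h: "c \<in> L" "x \<in> M.ints" "x - cj x = c * s" "d \<in> L" "y \<in> M.ints" "y - cj y = d * s"
      by (elim codiffE)
    have "x * y + cj (x * y) \<in> ?T"
      using M.ints_mult[OF h(2,5)] by blast
    moreover have "x * cj y + cj (x * cj y) \<in> ?T"
      using M.ints_mult[OF h(2) cj_ints[OF h(5)]] by blast
    ultimately show "c * d * w \<in> ?T"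
      unfolding codiff_prod[OF h(2,3,5,6)] by (rule submodule_over_diff[OF T L.minus_one_ints])
  qed
  then have "1 \<in> ?T"
    using r L.ints_one by blast
  then obtain y where y: "y \<in> M.ints" "y + cj y = 1"
    by force
  obtain \<beta> where \<beta>: "\<beta> \<in> codiff" "y - cj y = \<beta> * s"
    by (rule ints_codiff[OF y(1)])
  have \<beta>L: "\<beta> \<in> L"
    using \<beta>(1) by (rule codiffE)
  have "\<beta>\<^sup>2 * w = (\<beta> * s) * (\<beta> * s)"
    unfolding s2[symmetric] by (simp add: power2_eq_square mult_ac)
  also have "\<dots> = (y + cj y) * (y + cj y) - 4 * (y * cj y)"
    unfolding \<beta>(2)[symmetric] by (simp add: algebra_simps)
  finally have u: "\<beta>\<^sup>2 * w = 1 + 4 * (- (y * cj y))"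
    using y(2) by simp
  have Ny: "- (y * cj y) \<in> L.ints"
    by (rule L.ints_uminus[OF norm_ints[OF y(1)]])
  \<comment> \<open>Otherwise the norm of \<open>y\<close> would be \<open>1 / 4\<close>, which is
    rational but not an integer.\<close>
  have "\<beta> \<noteq> 0"
  proof
    assume "\<beta> = 0"
    then have "- (y * cj y) = of_rat (- 1 / 4)"
      using u by (simp add: field_simps of_rat_divide of_rat_minus add_eq_0_iff2)
    then have "algebraic_int (of_rat (- 1 / 4) :: 'a)" "(of_rat (- 1 / 4) :: 'a) \<in> \<rat>"
      using Ny by (auto simp: integers_of_def)
    then have "(of_rat (- 1 / 4) :: 'a) \<in> \<int>"
      by (rule rational_algebraic_int_is_int)
    then obtain k :: int where "(of_rat (- 1 / 4) :: 'a) = of_int k"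
      by (rule Ints_cases)
    then have "(of_rat (- 1 / 4) :: 'a) = of_rat (of_int k)"
      by simp
    then have "- 1 / 4 = (of_int k :: rat)"
      by (simp only: of_rat_eq_iff)
    then have "of_int (4 * k) = (of_int (- 1) :: rat)"
      by simp
    then have "4 * k = - 1"
      by (simp only: of_int_eq_iff)
    then show False
      by presburger
  qed
  \<comment> \<open>\<open>A\<close> is integral because \<open>\<beta>\<close> is itself in
    \<open>codiff\<close>, and \<open>A A\<close> is \<open>\<beta>^2 w\<close> times
    \<open>rdisc\<close>, which is the unit ideal.\<close>
  define A where "A = L.smul (\<beta> * w) codiff"
  have A: "L.int_ideal A"
    unfolding L.int_ideal_def A_def
  proof (intro conjI L.submodule_smul submodule_codiff subsetI)
    fix x assume "x \<in> L.smul (\<beta> * w) codiff"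
    then show "x \<in> L.ints"
      using codiff_prod_ints[OF \<beta>(1)] by (auto elim!: L.smulE simp: mult_ac)
  qed
  have "L.imul A A = L.smul (\<beta> * w) (L.smul (\<beta> * w) (L.imul codiff codiff))"
    unfolding A_def L.imul_smul L.imul_commute[of codiff "L.smul _ _"] ..
  also have "\<dots> = L.smul (\<beta>\<^sup>2 * w) rdisc"
    unfolding rdisc_def L.smul_smul by (simp add: power2_eq_square mult_ac)
  finally have "L.smul (\<beta>\<^sup>2 * w) L.ints = L.imul A A"
    using r by simp
  then show ?thesis
    using A \<beta>L \<open>\<beta> \<noteq> 0\<close> u Ny unfolding L.square_condition_iff by blast
qed

text \<open>Subtracting \<open>2 a\<close> times the generator \<open>(1 + \<beta> s) / 2\<close>
  from \<open>x = a + b s\<close> clears the \<open>L\<close>-part, and \<open>2 a\<close> is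
  integral as a trace. The rest \<open>\<gamma> \<beta> s\<close> is integral, hence so is its
  square \<open>\<gamma>^2 \<beta>^2 w\<close>, which puts \<open>\<gamma>\<close> into the inverse
  of \<open>A\<close>.\<close>

lemma ints_square_condition:
  assumes sc: "square_condition L w \<beta> A"
  shows "M.ints = submodule_over L.ints hull
    ({1, (1 + \<beta> * s) / 2} \<union> {x * \<beta> * s | x. x \<in> inverse_ideal L A})"
    (is "_ = _ hull ?G")
proof
  obtain z where z: "z \<in> L.ints" "\<beta>\<^sup>2 * w = 1 + 4 * z"
    and \<beta>: "\<beta> \<in> L" "\<beta> \<noteq> 0" and A: "L.int_ideal A" "L.smul (\<beta>\<^sup>2 * w) L.ints = L.imul A A"
    using sc unfolding L.square_condition_iff by blast
  have ss: "s\<^sup>2 = w"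
    using s2 by (simp add: power2_eq_square)
  note gen = square_condition_generators[OF sc s_M ss]
  let ?H = "submodule_over L.ints hull ?G"
  have H: "submodule_over L.ints ?H"
    by (rule submodule_over_hull)
  show "?H \<subseteq> M.ints"
    by (rule submodule_hull_minimal[OF _ submodule_over_L_ints[OF M.submodule_over_ints]])
       (use gen M.ints_one in auto)
  show "M.ints \<subseteq> ?H"
  proof
    fix x assume x: "x \<in> M.ints"
    obtain a b where h: "a \<in> L" "b \<in> L" "x = a + b * s"
      by (rule M_E[OF M.ints_K[OF x]])
    define \<gamma> where "\<gamma> = (b - a * \<beta>) / \<beta>"
    have \<gamma>: "\<gamma> \<in> L" "\<gamma> * \<beta> = b - a * \<beta>"
      using h \<beta> by (auto simp: \<gamma>_def intro: L.K_divide L.K_diff L.K_mult)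
    have "x + cj x = 2 * a"
      using h by (simp add: cj_eq)
    then have a2: "2 * a \<in> L.ints"
      using trace_ints[OF x] by simp
    have "2 * a * ((1 + \<beta> * s) / 2) = a + a * \<beta> * s"
      by (simp add: distrib_left mult_ac)
    then have eq: "x = 2 * a * ((1 + \<beta> * s) / 2) + \<gamma> * \<beta> * s"
      unfolding \<gamma>(2) h(3) by (simp add: algebra_simps)
    then have "\<gamma> * \<beta> * s = x - 2 * a * ((1 + \<beta> * s) / 2)"
      by simp
    then have ct: "\<gamma> * \<beta> * s \<in> M.ints"
      by (simp only:) (intro M.ints_diff M.ints_mult x L_ints_M[OF a2] gen(1))
    have "(\<gamma> * \<beta> * s) * (\<gamma> * \<beta> * s) = \<gamma> * \<gamma> * (\<beta>\<^sup>2 * w)"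
      unfolding s2[symmetric] by (simp add: power2_eq_square mult_ac)
    then have "\<gamma> * \<gamma> * (\<beta>\<^sup>2 * w) \<in> M.ints"
      using M.ints_mult[OF ct ct] by (simp only:)
    then have "\<gamma> * \<gamma> * (\<beta>\<^sup>2 * w) \<in> L.ints"
      by (rule M_ints_L) (intro L.K_mult L.K_power \<gamma> \<beta> wL)
    then have "\<gamma> \<in> inverse_ideal L A"
      by (rule L.inverse_idealI[OF A \<gamma>(1)])
    then have "\<gamma> * \<beta> * s \<in> ?H"
      by (intro hull_inc) blast
    moreover have "(1 + \<beta> * s) / 2 \<in> ?H"
      by (rule hull_inc) blast
    ultimately show "x \<in> ?H"
      by (subst eq) (intro submodule_over_add[OF H] submodule_over_mult[OF H a2])
  qed
qed

section \<open>Ramification and the relative discriminant\<close>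

text \<open>Suppose \<open>P\<close> lies in the square of \<open>Q\<close>; then so does every
  element of \<open>Q\<close> that belongs to \<open>L\<close>, in particular every trace that falls
  into \<open>Q\<close>. If some \<open>y - cj y\<close> were outside \<open>Q\<close>, it could be
  cancelled modulo \<open>Q\<close>, and traces would force all of \<open>Q\<close> into its square,
  which is impossible. So all differences lie in \<open>Q\<close>, and \<open>rdisc\<close> lies in
  \<open>P\<close>.\<close>

lemma rdisc_imp_unramified:
  assumes r: "rdisc = L.ints"
  shows "unramified_extension L M"
  unfolding unramified_extension_def
proof (intro allI impI)
  fix P Q assume h: "primeideal P (integer_ring L) \<and> P \<noteq> {0} \<and>
    primeideal Q (integer_ring M) \<and> Q \<inter> L.ints = P"
  then have P: "L.max_ideal P"
    using L.primeideal_integer_ring_iff by blast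
  obtain p where p: "p \<in> P" "p \<noteq> 0"
    by (rule L.nz_ideal_witness[OF L.max_idealD(1)[OF P]])
  have QP: "Q \<inter> L.ints = P" and PQ: "P \<subseteq> Q"
    using h by auto
  then have Q: "M.max_ideal Q"
    using M.primeideal_integer_ring_iff h p by blast
  note Qi = M.max_idealD(2)[OF Q]
  let ?Q2 = "M.imul Q Q"
  have "\<not> P \<subseteq> ?Q2"
  proof
    assume PQ2: "P \<subseteq> ?Q2"
    have QL: "x \<in> ?Q2" if "x \<in> Q" "x \<in> L" for x
      using that QP PQ2 M.ideal_closed(6)[OF Qi that(1)] M_ints_L by blast
    have diff: "y - cj y \<in> Q" if y: "y \<in> M.ints" for y
    proof (rule ccontr)
      assume nd: "y - cj y \<notin> Q"
      have di: "y - cj y \<in> M.ints"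
        by (intro M.ints_diff y cj_ints)
      have yM: "y \<in> M"
        by (rule M.ints_K[OF y])
      have both: "cj x \<in> ?Q2" if x: "x \<in> Q" "cj x \<in> Q" for x
      proof (rule M.max_ideal_square_cancel[OF Q di nd x(2)])
        have xM: "x \<in> M"
          by (rule M.ints_K[OF M.ideal_closed(6)[OF Qi x(1)]])
        have "x + cj x \<in> ?Q2"
          by (rule QL[OF M.ideal_closed(2)[OF Qi x] cj_trace_norm(1)[OF xM]])
        then have 1: "y * (x + cj x) \<in> ?Q2"
          by (rule submodule_over_mult[OF M.submodule_imul y])
        have "y * x \<in> Q" "cj (y * x) \<in> Q"
          unfolding cj_mult[OF yM xM]
          by (rule M.ideal_closed(4)[OF Qi y x(1)], rule M.ideal_closed(4)[OF Qi cj_ints[OF y] x(2)])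
        then have 2: "y * x + cj (y * x) \<in> ?Q2"
          by (intro QL M.ideal_closed(2)[OF Qi] cj_trace_norm(1) M_mult yM xM)
        \<comment> \<open>The traces of \<open>x\<close> and of \<open>y * x\<close> form a linear
          system in \<open>x\<close> and \<open>cj x\<close>. Eliminating \<open>x\<close> leaves
          \<open>cj x\<close> with the coefficient \<open>y - cj y\<close>, which is invertible
          modulo \<open>Q\<close>.\<close>
        have "(y - cj y) * cj x = y * (x + cj x) - (y * x + cj (y * x))"
          unfolding cj_mult[OF yM xM] by (simp add: algebra_simps)
        then show "(y - cj y) * cj x \<in> ?Q2"
          using submodule_over_diff[OF M.submodule_imul M.minus_one_ints 1 2] by simp
      qed
      have both': "x \<in> ?Q2" if x: "x \<in> Q" "cj x \<in> Q" for x
      proof -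
        have "cj (cj x) = x"
          by (rule cj_cj[OF M.ints_K[OF M.ideal_closed(6)[OF Qi x(1)]]])
        then show ?thesis
          using both[of "cj x"] x by simp
      qed
      have "Q \<subseteq> ?Q2"
      proof (cases "\<forall>z\<in>Q. cj z \<in> Q")
        case True
        then show ?thesis
          using both' by blast
      next
        case False
        then obtain z where z: "z \<in> Q" "cj z \<notin> Q"
          by blast
        have zi: "z \<in> M.ints"
          by (rule M.ideal_closed(6)[OF Qi z(1)])
        show ?thesis
        proof
          fix x assume x: "x \<in> Q"
          have xi: "x \<in> M.ints"
            by (rule M.ideal_closed(6)[OF Qi x])
          \<comment> \<open>Multiplication by \<open>cj z\<close>, a unit modulo \<open>Q\<close>,
            turns \<open>x\<close> into an element of \<open>Q\<close> whose conjugate is in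
            \<open>Q\<close> as well.\<close>
          have "cj (cj z * x) = z * cj x"
            using cj_mult[OF cj_M[OF M.ints_K[OF zi]] M.ints_K[OF xi]] cj_cj[OF M.ints_K[OF zi]] by simp
          then have "cj (cj z * x) \<in> Q"
            using M.ideal_closed(5)[OF Qi z(1) cj_ints[OF xi]] by simp
          then have "cj z * x \<in> ?Q2"
            by (rule both'[OF M.ideal_closed(4)[OF Qi cj_ints[OF zi] x]])
          then show "x \<in> ?Q2"
            by (rule M.max_ideal_square_cancel[OF Q cj_ints[OF zi] z(2) x])
        qed
      qed
      then show False
        using M.imul_proper[OF M.max_idealD(1)[OF Q] Qi M.max_idealD(3)[OF Q]]
          M.int_ideal_imul(2)[OF Qi Qi] by blast
    qed
    have "rdisc \<subseteq> P"
    proof (rule rdisc_least[OF L.int_idealD(1)[OF L.max_idealD(2)[OF P]]])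
      fix c d assume cd: "c \<in> codiff" "d \<in> codiff"
      then obtain x y where xy: "x \<in> M.ints" "x - cj x = c * s" "y \<in> M.ints" "y - cj y = d * s"
        by (elim codiffE)
      have "c * d * w = (x - cj x) * (y - cj y)"
        unfolding xy(2,4) s2[symmetric] by (simp add: mult_ac)
      also have "\<dots> \<in> Q"
        by (intro M.ideal_closed(5)[OF Qi diff[OF xy(1)]] M.ints_diff xy(3) cj_ints)
      finally show "c * d * w \<in> P"
        using codiff_prod_ints[OF cd] QP by blast
    qed
    then show False
      using r L.max_idealD(4)[OF P] L.ints_one by blast
  qed
  then show "ramification_index M P Q = 1"
    using M.ramification_index_eq_1_iff[OF Q PQ p] by simp
qed

text \<open>A prime \<open>P\<close> that contains \<open>rdisc\<close> ramifies: \<open>cj\<close> acts trivially modulo the prime \<open>Q\<close> above it,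
  so, were \<open>P\<close> to generate \<open>Q\<close>, every integer would be congruent to an element of \<open>L\<close>
  modulo \<open>P\<close>, hence \<open>codiff = P * codiff\<close>.\<close>

lemma unramified_imp_rdisc:
  assumes unram: "unramified_extension L M"
  shows "rdisc = L.ints"
proof (rule ccontr)
  assume "rdisc \<noteq> L.ints"
  then obtain P where P: "L.max_ideal P" "rdisc \<subseteq> P"
    using L.max_ideal_exists[OF nz_ideal_rdisc] by metis
  note Pi = L.max_idealD(2)[OF P(1)]
  note Ps = L.int_idealD(1)[OF Pi]
  obtain p where p: "p \<in> P" "p \<noteq> 0"
    by (rule L.nz_ideal_witness[OF L.max_idealD(1)[OF P(1)]])
  have P_ints: "P \<subseteq> M.ints"
    using L.ideal_closed(6)[OF Pi] L_ints_M by blast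
  have P_L: "x \<in> L" if "x \<in> P" for x
    using L.ints_K[OF L.ideal_closed(6)[OF Pi that]] .
  \<comment> \<open>An explicit ideal that contains \<open>P\<close> and visibly not
    \<open>1\<close>, so that a prime above \<open>P\<close> exists. The condition on
    \<open>x * cj y\<close> is the polarised form of the norm condition; it makes \<open>U\<close>
    closed under addition.\<close>
  define U where "U = {x \<in> M.ints. x * cj x \<in> P \<and> (\<forall>y\<in>M.ints. x * cj y + cj (x * cj y) \<in> P)}"
  have U: "M.int_ideal U"
    unfolding M.int_ideal_def
  proof
    show "submodule_over M.ints U"
    proof (rule submodule_overI)
      show "0 \<in> U"
        unfolding U_def using M.ints_zero cj_L[OF L.K_zero] L.ideal_closed(1)[OF Pi] by simp
    next
      fix x y assume "x \<in> U" "y \<in> U"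
      then have x: "x \<in> M.ints" "x * cj x \<in> P" "\<And>z. z \<in> M.ints \<Longrightarrow> x * cj z + cj (x * cj z) \<in> P"
        and y: "y \<in> M.ints" "y * cj y \<in> P" "\<And>z. z \<in> M.ints \<Longrightarrow> y * cj z + cj (y * cj z) \<in> P"
        unfolding U_def by auto
      note xM = M.ints_K[OF x(1)] and yM = M.ints_K[OF y(1)]
      have "(x + y) * cj (x + y) = x * cj x + y * cj y + (x * cj y + cj (x * cj y))"
        using cj_add[OF xM yM] cj_mult[OF xM cj_M[OF yM]] cj_cj[OF yM] by (simp add: algebra_simps)
      moreover have "x * cj x + y * cj y + (x * cj y + cj (x * cj y)) \<in> P"
        by (intro L.ideal_closed(2)[OF Pi] x(2,3) y(1,2))
      moreover have "(x + y) * cj z + cj ((x + y) * cj z) \<in> P" if z: "z \<in> M.ints" for z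
      proof -
        note zM = cj_M[OF M.ints_K[OF z]]
        have "(x + y) * cj z + cj ((x + y) * cj z) = (x * cj z + cj (x * cj z)) + (y * cj z + cj (y * cj z))"
          using cj_add[OF M_mult[OF xM zM] M_mult[OF yM zM]] by (simp add: distrib_right)
        then show ?thesis
          using L.ideal_closed(2)[OF Pi x(3)[OF z] y(3)[OF z]] by (simp only:)
      qed
      ultimately show "x + y \<in> U"
        unfolding U_def using M.ints_add[OF x(1) y(1)] by simp
    next
      fix r x assume r: "r \<in> M.ints" and "x \<in> U"
      then have x: "x \<in> M.ints" "x * cj x \<in> P" "\<And>z. z \<in> M.ints \<Longrightarrow> x * cj z + cj (x * cj z) \<in> P"
        unfolding U_def by auto
      note xM = M.ints_K[OF x(1)] and rM = M.ints_K[OF r]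
      have Nrx: "(r * x) * cj (r * x) = (r * cj r) * (x * cj x)"
        using cj_mult[OF rM xM] by (simp add: mult_ac)
      have "(r * x) * cj (r * x) \<in> P"
        unfolding Nrx by (rule L.ideal_closed(4)[OF Pi norm_ints[OF r] x(2)])
      moreover have "(r * x) * cj z + cj ((r * x) * cj z) \<in> P" if z: "z \<in> M.ints" for z
      proof -
        have "cj (cj r * z) = r * cj z"
          using cj_mult[OF cj_M[OF rM] M.ints_K[OF z]] cj_cj[OF rM] by simp
        then have "(r * x) * cj z = x * cj (cj r * z)"
          by (simp add: mult_ac)
        then show ?thesis
          using x(3)[OF M.ints_mult[OF cj_ints[OF r] z]] by (simp only:)
      qed
      ultimately show "r * x \<in> U"
        unfolding U_def using M.ints_mult[OF r x(1)] by simp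
    qed
    show "U \<subseteq> M.ints"
      unfolding U_def by blast
  qed
  have PU: "P \<subseteq> U"
  proof
    fix x assume x: "x \<in> P"
    have xi: "x \<in> L.ints"
      by (rule L.ideal_closed(6)[OF Pi x])
    have "x * cj z + cj (x * cj z) \<in> P" if z: "z \<in> M.ints" for z
    proof -
      have "cj (x * cj z) = x * z"
        using cj_mult[OF subsetD[OF L_M P_L[OF x]] cj_M[OF M.ints_K[OF z]]]
          cj_L[OF P_L[OF x]] cj_cj[OF M.ints_K[OF z]] by simp
      then have "x * cj z + cj (x * cj z) = x * (z + cj z)"
        by (simp add: algebra_simps)
      then show ?thesis
        using L.ideal_closed(5)[OF Pi x trace_ints[OF z]] by (simp only:)
    qed
    then show "x \<in> U"
      unfolding U_def using L_ints_M[OF xi] L.ideal_closed(5)[OF Pi x xi] cj_L[OF P_L[OF x]] by simp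
  qed
  have "1 \<notin> U"
    unfolding U_def using L.max_idealD(4)[OF P(1)] cj_L[OF L.K_one] by simp
  then have "U \<noteq> M.ints"
    using M.ints_one by blast
  moreover have "M.nz_ideal U"
    using PU p by (intro M.nz_idealI[OF U]) auto
  ultimately obtain Q where Q: "M.max_ideal Q" "U \<subseteq> Q"
    using M.max_ideal_exists by metis
  note Qi = M.max_idealD(2)[OF Q(1)]
  have PQ: "P \<subseteq> Q"
    using PU Q(2) by blast
  have QP: "Q \<inter> L.ints = P"
  proof -
    have I: "L.int_ideal (Q \<inter> L.ints)"
      unfolding L.int_ideal_def
      by (auto intro!: submodule_overI M.ideal_closed(1,2,4)[OF Qi] L.ints_zero L.ints_add L.ints_mult L_ints_M)
    have "Q \<inter> L.ints = P \<or> Q \<inter> L.ints = L.ints"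
      by (rule L.max_idealD(5)[OF P(1) I]) (use PQ L.ideal_closed(6)[OF Pi] in blast)
    then show ?thesis
      using M.max_idealD(4)[OF Q(1)] L.ints_one by blast
  qed
  \<comment> \<open>The square of a difference lies in \<open>rdisc\<close>, hence in every prime
    above \<open>P\<close>. The claim is for all such primes because a second one,
    \<open>Q1\<close>, is compared with \<open>Q\<close> below.\<close>
  have diff: "y - cj y \<in> Q'" if Q': "M.max_ideal Q'" "P \<subseteq> Q'" and y: "y \<in> M.ints" for Q' y
  proof -
    obtain c where c: "c \<in> codiff" "y - cj y = c * s"
      by (rule ints_codiff[OF y])
    have eq: "(y - cj y) * (y - cj y) = c * c * w"
      unfolding c(2) s2[symmetric] by (simp add: mult_ac)
    have "(y - cj y) * (y - cj y) \<in> Q'"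
      unfolding eq using rdiscI[OF c(1) c(1)] P(2) Q'(2) by blast
    then show ?thesis
      using M.max_ideal_prime[OF Q'(1)] M.ints_diff[OF y cj_ints[OF y]] by blast
  qed
  have "primeideal P (integer_ring L) \<and> P \<noteq> {0}" "primeideal Q (integer_ring M)"
    using L.primeideal_integer_ring_iff P(1) M.primeideal_integer_ring_iff Q(1) by blast+
  then have "ramification_index M P Q = 1"
    using unram QP unfolding unramified_extension_def by blast
  then have notQ2: "\<not> P \<subseteq> M.imul Q Q"
    using M.ramification_index_eq_1_iff[OF Q(1) PQ p] by simp
  define E where "E = submodule_over M.ints hull P"
  have E: "M.int_ideal E"
    unfolding E_def by (rule M.int_ideal_hull[OF P_ints])
  have PE: "P \<subseteq> E"
    unfolding E_def by (rule hull_subset)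
  have EQ: "E \<subseteq> Q"
    unfolding E_def by (rule submodule_hull_minimal[OF PQ M.int_idealD(1)[OF Qi]])
  obtain J where J: "M.int_ideal J" "E = M.imul Q J"
    by (rule M.contains_imp_divides[OF M.max_idealD(1)[OF Q(1)] E EQ])
  have EJ: "E \<subseteq> J"
    unfolding J(2) by (rule M.int_ideal_imul(3)[OF Qi J(1)])
  \<comment> \<open>If not, \<open>J\<close> lies in a prime \<open>Q1\<close> above
    \<open>P\<close>. For \<open>x\<close> in \<open>Q\<close> the norm is in \<open>P\<close>, so
    \<open>x\<close> or \<open>cj x\<close> is in \<open>Q1\<close>, and these agree modulo
    \<open>Q1\<close>. So \<open>Q1 = Q\<close>, and \<open>P\<close> would lie in the square of
    \<open>Q\<close>, contrary to ramification index \<open>1\<close>.\<close>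
  have "J = M.ints"
  proof (rule ccontr)
    assume "J \<noteq> M.ints"
    moreover have "M.nz_ideal J"
      using EJ PE p by (intro M.nz_idealI[OF J(1)]) auto
    ultimately obtain Q1 where Q1: "M.max_ideal Q1" "J \<subseteq> Q1"
      using M.max_ideal_exists by metis
    note Q1i = M.max_idealD(2)[OF Q1(1)]
    have PQ1: "P \<subseteq> Q1"
      using PE EJ Q1(2) by blast
    have "Q \<subseteq> Q1"
    proof
      fix x assume x: "x \<in> Q"
      have xi: "x \<in> M.ints"
        by (rule M.ideal_closed(6)[OF Qi x])
      have "x * cj x \<in> Q \<inter> L.ints"
        using M.ideal_closed(5)[OF Qi x cj_ints[OF xi]] norm_ints[OF xi] by blast
      then have "x * cj x \<in> Q1"
        using QP PQ1 by blast
      then have "x \<in> Q1 \<or> cj x \<in> Q1"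
        by (rule M.max_ideal_prime[OF Q1(1) xi cj_ints[OF xi]])
      then show "x \<in> Q1"
        using M.ideal_closed(2)[OF Q1i _ diff[OF Q1(1) PQ1 xi], of "cj x"] by auto
    qed
    then have "Q1 = Q"
      using M.max_idealD(5)[OF Q(1) Q1i] M.max_idealD(3)[OF Q1(1)] by blast
    then have "E \<subseteq> M.imul Q Q"
      unfolding J(2) using Q1(2) by (intro M.imul_mono) auto
    then show False
      using PE notQ2 by blast
  qed
  then have EQ: "E = Q"
    using J(2) M.imul_commute[of Q] M.imul_ints[OF M.int_idealD(1)[OF Qi]] by simp
  \<comment> \<open>If \<open>2 \<in> Q\<close>, then \<open>y\<close> is congruent to a square
    \<open>z * z\<close> and thus to the norm \<open>z * cj z\<close>. Otherwise \<open>2\<close>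
    has an inverse \<open>h\<close> modulo \<open>P\<close>, and \<open>y\<close> is congruent to
    \<open>h\<close> times its trace.\<close>
  have residue: "\<exists>a\<in>L.ints. y - a \<in> Q" if y: "y \<in> M.ints" for y
  proof (cases "2 \<in> Q")
    case True
    obtain z where z: "z \<in> M.ints" "y - z * z \<in> Q"
      by (rule M.square_residue[OF Q(1) True y])
    have "z * (z - cj z) \<in> Q"
      by (rule M.ideal_closed(4)[OF Qi z(1) diff[OF Q(1) PQ z(1)]])
    from M.ideal_closed(2)[OF Qi z(2) this] have "y - z * cj z \<in> Q"
      by (simp add: algebra_simps)
    then show ?thesis
      using norm_ints[OF z(1)] by blast
  next
    case False
    then have two: "2 \<notin> P" "2 \<in> L.ints"
      using PQ L.ints_of_int[of 2] by auto
    obtain h where h: "h \<in> L.ints" "1 - 2 * h \<in> P"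
      by (rule L.max_ideal_unit[OF P(1) two(2,1)])
    have "y * (1 - 2 * h) + h * (y - cj y) \<in> Q"
      by (intro M.ideal_closed(2)[OF Qi] M.ideal_closed(4)[OF Qi] y L_ints_M[OF h(1)]
          diff[OF Q(1) PQ y] subsetD[OF PQ h(2)])
    then have "y - h * (y + cj y) \<in> Q"
      by (simp add: algebra_simps)
    then show ?thesis
      using L.ints_mult[OF h(1) trace_ints[OF y]] by blast
  qed
  let ?PC = "L.imul P codiff"
  \<comment> \<open>Quantifying over all multiples \<open>z * y\<close> makes \<open>V\<close> a
    module over \<open>M.ints\<close>; so the inclusion of \<open>P\<close> extends to
    \<open>E\<close>, which is \<open>Q\<close>.\<close>
  define V where "V = {z \<in> M.ints. \<forall>y\<in>M.ints. \<exists>c\<in>?PC. z * y - cj (z * y) = c * s}"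
  have "E \<subseteq> V"
    unfolding E_def
  proof (rule submodule_hull_minimal)
    show "P \<subseteq> V"
    proof
      fix x assume x: "x \<in> P"
      have "\<exists>c\<in>?PC. x * y - cj (x * y) = c * s" if y: "y \<in> M.ints" for y
      proof -
        obtain c where c: "c \<in> codiff" "y - cj y = c * s"
          by (rule ints_codiff[OF y])
        have "x * y - cj (x * y) = x * (y - cj y)"
          using cj_mult[OF subsetD[OF L_M P_L[OF x]] M.ints_K[OF y]] cj_L[OF P_L[OF x]]
          by (simp add: algebra_simps)
        also have "\<dots> = x * c * s"
          unfolding c(2) by (simp add: mult.assoc)
        finally show ?thesis
          using L.imulI[OF x c(1)] by blast
      qed
      then show "x \<in> V"
        unfolding V_def using x P_ints by blast
    qed
    show "submodule_over M.ints V"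
    proof (rule submodule_overI)
      show "0 \<in> V"
        unfolding V_def using M.ints_zero cj_L[OF L.K_zero] submodule_over_0[OF L.submodule_imul]
        by (auto intro!: bexI[of _ 0])
    next
      fix a b assume "a \<in> V" "b \<in> V"
      then have a: "a \<in> M.ints" "\<And>y. y \<in> M.ints \<Longrightarrow> \<exists>c\<in>?PC. a * y - cj (a * y) = c * s"
        and b: "b \<in> M.ints" "\<And>y. y \<in> M.ints \<Longrightarrow> \<exists>c\<in>?PC. b * y - cj (b * y) = c * s"
        unfolding V_def by auto
      have "\<exists>c\<in>?PC. (a + b) * y - cj ((a + b) * y) = c * s" if y: "y \<in> M.ints" for y
      proof -
        obtain c d where cd: "c \<in> ?PC" "d \<in> ?PC" "a * y - cj (a * y) = c * s" "b * y - cj (b * y) = d * s"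
          using a(2)[OF y] b(2)[OF y] by blast
        have "(a + b) * y - cj ((a + b) * y) = (a * y - cj (a * y)) + (b * y - cj (b * y))"
          using cj_add[OF M.ints_K[OF M.ints_mult[OF a(1) y]] M.ints_K[OF M.ints_mult[OF b(1) y]]]
          by (simp add: distrib_right)
        also have "\<dots> = (c + d) * s"
          unfolding cd(3,4) by (simp add: distrib_right)
        finally show ?thesis
          using submodule_over_add[OF L.submodule_imul cd(1,2)] by blast
      qed
      then show "a + b \<in> V"
        unfolding V_def using M.ints_add[OF a(1) b(1)] by blast
    next
      fix r a assume r: "r \<in> M.ints" and "a \<in> V"
      then have a: "a \<in> M.ints" "\<And>y. y \<in> M.ints \<Longrightarrow> \<exists>c\<in>?PC. a * y - cj (a * y) = c * s"
        unfolding V_def by auto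
      have "\<exists>c\<in>?PC. r * a * y - cj (r * a * y) = c * s" if y: "y \<in> M.ints" for y
        using a(2)[OF M.ints_mult[OF r y]] by (simp add: mult_ac)
      then show "r * a \<in> V"
        unfolding V_def using M.ints_mult[OF r a(1)] by blast
    qed
  qed
  have "codiff \<subseteq> ?PC"
  proof
    fix c assume "c \<in> codiff"
    then obtain x where x: "c \<in> L" "x \<in> M.ints" "x - cj x = c * s"
      by (rule codiffE)
    obtain a where a: "a \<in> L.ints" "x - a \<in> Q"
      using residue[OF x(2)] by blast
    \<comment> \<open>Subtracting an element of \<open>L\<close> does not change the difference
      \<open>x - cj x\<close>.\<close>
    have "x - a \<in> V"
      using a(2) EQ \<open>E \<subseteq> V\<close> by blast
    then obtain d where d: "d \<in> ?PC" "(x - a) * 1 - cj ((x - a) * 1) = d * s"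
      unfolding V_def using M.ints_one by blast
    have aL: "a \<in> L"
      by (rule L.ints_K[OF a(1)])
    have "cj (x - a) + cj a = cj x"
      using cj_add[of "x - a" a] M.ints_K[OF x(2)] M.K_diff L_M aL by auto
    then have "cj (x - a) = cj x - a"
      using cj_L[OF aL] by (simp add: algebra_simps)
    then have "c * s = d * s"
      using d(2) x(3) by simp
    then show "c \<in> ?PC"
      using d(1) s_nonzero by simp
  qed
  moreover obtain q :: int where q: "q > 0" "L.int_ideal (L.smul (of_int q) codiff)"
    by (rule codiff_denominator)
  \<comment> \<open>\<open>imul_proper\<close> concerns ideals inside \<open>L.ints\<close>, so
    \<open>codiff\<close> is scaled into one.\<close>
  let ?I = "L.smul (of_int q) codiff"
  have "L.imul ?I P = L.smul (of_int q) ?PC"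
    by (simp add: L.imul_smul L.imul_commute[of codiff])
  ultimately have "?I \<subseteq> L.imul ?I P"
    using L.smul_mono_iff[of "of_int q" codiff ?PC] q(1) by simp
  moreover obtain c where c: "c \<in> codiff" "c \<noteq> 0"
    by (rule codiff_nonzero)
  have "L.nz_ideal ?I"
    by (rule L.nz_idealI[OF q(2) L.smulI[OF c(1)]]) (use c(2) q(1) in simp)
  ultimately show False
    using L.imul_proper[OF _ Pi L.max_idealD(3)[OF P(1)], of ?I] L.int_ideal_imul(2)[OF q(2) Pi] by blast
qed

section \<open>The discriminant of a quadratic extension\<close>

text \<open>In the basis formed by \<open>e\<close> and \<open>e\<close> times \<open>s\<close>, the
  two diagonal blocks of multiplication by \<open>a + b * s\<close> are both the matrix of
  \<open>a\<close>. The block \<open>C\<close> belongs to \<open>b * w\<close> because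
  \<open>s * s = w\<close>.\<close>

lemma trace_M:
  assumes "a \<in> L" "b \<in> L"
  shows "M.tr (a + b * s) = 2 * L.tr a"
proof -
  obtain e where e: "qindep L.ndeg e" "qspan L.ndeg e = L"
    by (rule number_field_basis[OF nfL])
  let ?n = "L.ndeg" and ?g = "fam2 L.ndeg e (\<lambda>i. 0 + e i * s)"
  obtain A where A: "\<forall>i<?n. a * e i = (\<Sum>j<?n. of_rat (A i j) * e j)"
    using L.mult_matrix[OF e(2) assms(1)] by blast
  obtain B where B: "\<forall>i<?n. b * e i = (\<Sum>j<?n. of_rat (B i j) * e j)"
    using L.mult_matrix[OF e(2) assms(2)] by blast
  obtain C where C: "\<forall>i<?n. b * w * e i = (\<Sum>j<?n. of_rat (C i j) * e j)"
    using L.mult_matrix[OF e(2) L.K_mult[OF assms(2) wL]] by blast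
  define F where "F k j = (if k < ?n then (if j < ?n then A k j else B k (j - ?n))
      else (if j < ?n then C (k - ?n) j else A (k - ?n) (j - ?n)))" for k j
  have g: "qindep (?n + ?n) ?g" "qspan (?n + ?n) ?g = M"
    by (rule qindep_fam2[OF e(1) e(1)], use L.basis_mem[OF e(2)] L.K_zero in auto)
       (use qspan_fam2[OF e(2)] in auto)
  have F: "(a + b * s) * ?g k = (\<Sum>j<?n + ?n. of_rat (F k j) * ?g j)" if k: "k < ?n + ?n" for k
  proof (cases "k < ?n")
    case True
    then have "(a + b * s) * ?g k = a * e k + b * e k * s"
      by (simp add: fam2_def algebra_simps)
    also have "\<dots> = (\<Sum>j<?n. of_rat (A k j) * e j) + (\<Sum>j<?n. of_rat (B k j) * e j) * s"
      using A B True by simp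
    also have "\<dots> = (\<Sum>j<?n + ?n. of_rat (F k j) * ?g j)"
      unfolding sum_fam2 using True by (simp add: F_def sum_distrib_right mult.assoc)
    finally show ?thesis .
  next
    case False
    then have i: "k - ?n < ?n"
      using k by simp
    have "(a + b * s) * ?g k = b * w * e (k - ?n) + a * e (k - ?n) * s"
      using False by (simp add: fam2_def algebra_simps s2[symmetric])
    also have "\<dots> = (\<Sum>j<?n. of_rat (C (k - ?n) j) * e j) + (\<Sum>j<?n. of_rat (A (k - ?n) j) * e j) * s"
      using A C i by simp
    also have "\<dots> = (\<Sum>j<?n + ?n. of_rat (F k j) * ?g j)"
      unfolding sum_fam2 using False by (simp add: F_def sum_distrib_right mult.assoc)
    finally show ?thesis .
  qed
  have "M.tr (a + b * s) = (\<Sum>k<?n + ?n. F k k)"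
    by (rule field_trace_eq[where A = F, OF g F])
  also have "\<dots> = (\<Sum>k<?n. A k k) + (\<Sum>k<?n. A k k)"
    unfolding sum_split by (simp add: F_def)
  also have "(\<Sum>k<?n. A k k) = L.tr a"
    by (rule field_trace_eq[where A = A, OF e, symmetric]) (use A in auto)
  finally show ?thesis
    by simp
qed

lemma fdet_block_diag:
  fixes A B :: "nat \<Rightarrow> nat \<Rightarrow> 'b::idom"
  shows "fdet (n + m) (\<lambda>i j. if i < n then (if j < n then A i j else 0)
      else (if j < n then 0 else B (i - n) (j - n))) = fdet n A * fdet m B"
proof -
  have "mat (n + m) (n + m) (\<lambda>(i, j). if i < n then (if j < n then A i j else 0)
      else (if j < n then 0 else B (i - n) (j - n)))
    = four_block_mat (mat n n (\<lambda>(i, j). A i j)) (0\<^sub>m n m) (0\<^sub>m m n) (mat m m (\<lambda>(i, j). B i j))"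
    by (rule eq_matI) auto
  then show ?thesis
    unfolding fdet_def by (simp add: det_four_block_mat_lower_left_zero[of _ n _ m])
qed

text \<open>The pairing of two ideal bases arises from the trace form of an integral basis by the
  two transition matrices, whose determinants are the indices up to sign.\<close>

lemma fdet_trace_matrix:
  assumes I: "L.nz_ideal I" "I = zspan L.ndeg g" and J: "L.nz_ideal J" "J = zspan L.ndeg h"
  shows "\<bar>fdet L.ndeg (\<lambda>i j. L.tr (g i * h j))\<bar>
    = \<bar>discriminant L\<bar> * of_nat (qidx L.ints I * qidx L.ints J)"
proof -
  obtain e where e: "qindep L.ndeg e" "qspan L.ndeg e = L" "zspan L.ndeg e = L.ints"
    by (rule L.ints_basis)
  obtain A where A: "\<And>i. i < L.ndeg \<Longrightarrow> g i = (\<Sum>j<L.ndeg. of_int (A i j) * e j)"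
    "int (qidx L.ints I) = \<bar>fdet L.ndeg A\<bar>"
    by (rule L.nz_ideal_matrix[OF e(3)[symmetric] e(1) I(2) L.nz_ideal_ints I(1)
        L.int_idealD(2)[OF L.nz_idealD[OF I(1)]]]) blast
  obtain B where B: "\<And>i. i < L.ndeg \<Longrightarrow> h i = (\<Sum>j<L.ndeg. of_int (B i j) * e j)"
    "int (qidx L.ints J) = \<bar>fdet L.ndeg B\<bar>"
    by (rule L.nz_ideal_matrix[OF e(3)[symmetric] e(1) J(2) L.nz_ideal_ints J(1)
        L.int_idealD(2)[OF L.nz_idealD[OF J(1)]]]) blast
  have "fdet L.ndeg (\<lambda>i j. L.tr (g i * h j))
      = fdet L.ndeg (\<lambda>i j. of_int (A i j)) * fdet L.ndeg (\<lambda>i j. L.tr (e i * e j)) * fdet L.ndeg (\<lambda>i j. of_int (B i j))"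
    by (rule L.trace_form_change) (use A(1) B(1) L.basis_mem[OF e(2)] in auto)
  also have "\<dots> = of_int (fdet L.ndeg A) * discriminant L * of_int (fdet L.ndeg B)"
    by (simp add: fdet_of_int L.discriminant_eq[OF e])
  finally have "\<bar>fdet L.ndeg (\<lambda>i j. L.tr (g i * h j))\<bar>
      = \<bar>discriminant L\<bar> * (of_int \<bar>fdet L.ndeg A\<bar> * of_int \<bar>fdet L.ndeg B\<bar>)"
    by (simp add: abs_mult mult_ac)
  then show ?thesis
    unfolding A(2)[symmetric] B(2)[symmetric] by simp
qed

lemma zspan_scale: "zspan n (\<lambda>i. a * f i) = L.smul a (zspan n f)"
proof (intro subset_antisym subsetI)
  fix x assume "x \<in> zspan n (\<lambda>i. a * f i)"
  then obtain c where "x = (\<Sum>i<n. of_int (c i) * (a * f i))"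
    by (rule zspanE)
  then have "x = a * (\<Sum>i<n. of_int (c i) * f i)"
    by (simp add: sum_distrib_left mult_ac)
  then show "x \<in> L.smul a (zspan n f)"
    by (simp only:) (rule L.smulI, rule zspanI[OF refl])
next
  fix x assume "x \<in> L.smul a (zspan n f)"
  then obtain y where y: "y \<in> zspan n f" "x = a * y"
    by (rule L.smulE)
  obtain c where "y = (\<Sum>i<n. of_int (c i) * f i)"
    using y(1) by (rule zspanE)
  then have "x = (\<Sum>i<n. of_int (c i) * (a * f i))"
    using y(2) by (simp add: sum_distrib_left mult_ac)
  then show "x \<in> zspan n (\<lambda>i. a * f i)"
    by (rule zspanI)
qed

text \<open>The transition matrix is \<open>k\<close> times the identity.\<close>

lemma qidx_scaled_ints:
  assumes "k > (0::int)"
  shows "int (qidx L.ints (L.smul (of_int k) L.ints)) = k ^ L.ndeg"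
proof -
  obtain e where e: "qindep L.ndeg e" "qspan L.ndeg e = L" "zspan L.ndeg e = L.ints"
    by (rule L.ints_basis)
  let ?J = "L.smul (of_int k) L.ints"
  have J: "?J = zspan L.ndeg (\<lambda>i. of_int k * e i)"
    unfolding zspan_scale e(3) ..
  have full: "\<exists>m::int. m > 0 \<and> of_int m * e i \<in> ?J" if "i < L.ndeg" for i
    using assms zspan_base[OF that, of "\<lambda>i. of_int k * e i"] J by (intro exI[of _ k]) simp
  have "int (qidx (zspan L.ndeg e) ?J) = \<bar>fdet L.ndeg (\<lambda>i j. if i = j then k else 0)\<bar>"
    by (rule qidx_zspan(1)[OF e(1) J _ full])
       (simp add: if_distrib[of of_int] if_distrib[of "\<lambda>x. x * _"] cong: if_cong)
  also have "fdet L.ndeg (\<lambda>i j. if i = j then k else 0) = k ^ L.ndeg"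
    by (subst fdet_lower_triangular) auto
  finally show ?thesis
    using assms e(3) by simp
qed

text \<open>Both factors are scaled into ideals, \<open>codiff\<close> by \<open>q\<close> and
  \<open>w * codiff\<close> by \<open>m * q\<close>, so that \<open>fdet_trace_matrix\<close>
  applies. Their product is \<open>rdisc\<close> scaled by \<open>q * (m * q)\<close>; by
  multiplicativity of the norm this scalar enters both sides with the exponent \<open>L.ndeg\<close>
  and cancels.\<close>

lemma fdet_codiff:
  assumes c: "codiff = zspan L.ndeg c"
  shows "\<bar>fdet L.ndeg (\<lambda>i j. L.tr (c i * (w * c j)))\<bar> = \<bar>discriminant L\<bar> * of_nat (qidx L.ints rdisc)"
proof -
  obtain q :: int where q: "q > 0" "L.int_ideal (L.smul (of_int q) codiff)"
    by (rule codiff_denominator)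
  obtain m :: int where m: "m > 0" "of_int m * w \<in> L.ints"
    by (rule L.ints_denominator[OF wL])
  obtain x where x: "x \<in> codiff" "x \<noteq> 0"
    by (rule codiff_nonzero)
  let ?n = "L.ndeg" and ?I = "L.smul (of_int q) codiff"
  let ?J = "L.smul (of_int (m * q) * w) codiff"
  have cL: "c i \<in> L" if "i < ?n" for i
    using zspan_base[OF that, of c] c by (auto elim: codiffE)
  have J_eq: "?J = L.smul (of_int m * w) ?I"
    by (simp add: L.smul_smul mult_ac)
  have J: "L.int_ideal ?J"
    unfolding J_eq L.int_ideal_def
    by (intro conjI L.submodule_smul submodule_codiff subsetI)
       (auto elim!: L.smulE intro: L.ints_mult[OF m(2)] L.ideal_closed(6)[OF q(2)] L.smulI)
  have nzI: "L.nz_ideal ?I"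
    by (rule L.nz_idealI[OF q(2) L.smulI[OF x(1)]]) (use x(2) q(1) in simp)
  have nzJ: "L.nz_ideal ?J"
    by (rule L.nz_idealI[OF J L.smulI[OF x(1)]]) (use x(2) q(1) m(1) w_nonzero in simp)
  have "L.imul ?I ?J = L.smul (of_int (q * (m * q))) rdisc"
    unfolding rdisc_def L.imul_smul L.imul_commute[of codiff "L.smul _ _"] L.smul_smul
    by (simp add: mult_ac)
  also have "\<dots> = L.imul (L.smul (of_int (q * (m * q))) L.ints) rdisc"
    by (rule L.imul_princ[OF L.int_idealD(1)[OF int_ideal_rdisc], symmetric])
  finally have IJ: "L.imul ?I ?J = L.imul (L.smul (of_int (q * (m * q))) L.ints) rdisc" .
  have k: "q * (m * q) > 0"
    using q(1) m(1) by simp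
  have nzk: "L.nz_ideal (L.smul (of_int (q * (m * q))) L.ints)"
    by (rule L.nz_idealI[OF L.int_ideal_smul_ints[OF L.ints_of_int] L.smulI[OF L.ints_one]])
       (use k q(1) m(1) in simp)
  have N: "of_nat (qidx L.ints ?I * qidx L.ints ?J)
      = (of_int (q * (m * q)) ^ ?n * of_nat (qidx L.ints rdisc) :: rat)"
  proof -
    have "qidx L.ints ?I * qidx L.ints ?J
        = qidx L.ints (L.smul (of_int (q * (m * q))) L.ints) * qidx L.ints rdisc"
      unfolding L.qidx_ints_imul[OF nzI nzJ, symmetric] IJ by (rule L.qidx_ints_imul[OF nzk nz_ideal_rdisc])
    then have "int (qidx L.ints ?I * qidx L.ints ?J) = (q * (m * q)) ^ ?n * int (qidx L.ints rdisc)"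
      using qidx_scaled_ints[OF k] by simp
    then have "of_int (int (qidx L.ints ?I * qidx L.ints ?J))
        = (of_int ((q * (m * q)) ^ ?n * int (qidx L.ints rdisc)) :: rat)"
      by (simp only:)
    then show ?thesis
      by simp
  qed
  define \<kappa> :: rat where "\<kappa> = of_int (q * (m * q)) ^ ?n"
  define F where "F = fdet ?n (\<lambda>i j. L.tr (c i * (w * c j)))"
  have I': "?I = zspan ?n (\<lambda>i. of_int q * c i)" and J': "?J = zspan ?n (\<lambda>i. of_int (m * q) * w * c i)"
    unfolding zspan_scale c[symmetric] by (rule refl)+
  have "fdet ?n (\<lambda>i j. L.tr (of_int q * c i * (of_int (m * q) * w * c j)))
      = fdet ?n (\<lambda>i j. of_int (q * (m * q)) * L.tr (c i * (w * c j)))"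
  proof (rule fdet_cong)
    fix i j assume ij: "i < ?n" "j < ?n"
    have "of_int q * c i * (of_int (m * q) * w * c j) = of_rat (of_int (q * (m * q))) * (c i * (w * c j))"
      unfolding of_rat_of_int_eq by (simp add: mult_ac)
    then show "L.tr (of_int q * c i * (of_int (m * q) * w * c j)) = of_int (q * (m * q)) * L.tr (c i * (w * c j))"
      using L.tr_of_rat_mult[of "c i * (w * c j)" "of_int (q * (m * q))"] cL[OF ij(1)] cL[OF ij(2)] wL L.K_mult
      by (simp only:)
  qed
  also have "\<dots> = of_int (q * (m * q)) ^ ?n * fdet ?n (\<lambda>i j. L.tr (c i * (w * c j)))"
    by (rule fdet_smult)
  finally have "\<bar>of_int (q * (m * q)) ^ ?n * fdet ?n (\<lambda>i j. L.tr (c i * (w * c j)))\<bar>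
      = \<bar>discriminant L\<bar> * (of_int (q * (m * q)) ^ ?n * of_nat (qidx L.ints rdisc))"
    using fdet_trace_matrix[OF nzI I' nzJ J'] unfolding N by simp
  then have eq: "\<bar>\<kappa> * F\<bar> = \<bar>discriminant L\<bar> * (\<kappa> * of_nat (qidx L.ints rdisc))"
    unfolding \<kappa>_def F_def .
  have "\<kappa> > 0"
    unfolding \<kappa>_def using k by (intro zero_less_power) (simp only: of_int_0_less_iff)
  have "\<kappa> * \<bar>F\<bar> = \<bar>\<kappa> * F\<bar>"
    using \<open>\<kappa> > 0\<close> by (simp add: abs_mult)
  also have "\<dots> = \<kappa> * (\<bar>discriminant L\<bar> * of_nat (qidx L.ints rdisc))"
    unfolding eq by (simp only: mult.left_commute)
  finally show ?thesis
    using \<open>\<kappa> > 0\<close> unfolding F_def by simp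
qed

lemma codiff_basis:
  obtains c where "qindep L.ndeg c" "codiff = zspan L.ndeg c"
proof -
  obtain q :: int where q: "q > 0" "L.int_ideal (L.smul (of_int q) codiff)"
    by (rule codiff_denominator)
  obtain x where x: "x \<in> codiff" "x \<noteq> 0"
    by (rule codiff_nonzero)
  have nz: "L.nz_ideal (L.smul (of_int q) codiff)"
    by (rule L.nz_idealI[OF q(2) L.smulI[OF x(1)]]) (use x(2) q(1) in simp)
  obtain f where f: "qindep L.ndeg f" "qspan L.ndeg f = L" "L.smul (of_int q) codiff = zspan L.ndeg f"
    by (rule L.nz_ideal_basis[OF nz])
  define c where "c i = f i / of_int q" for i
  have fc: "f = (\<lambda>i. of_int q * c i)"
    using q(1) by (simp add: c_def fun_eq_iff)
  have "L.smul (of_int q) codiff = L.smul (of_int q) (zspan L.ndeg c)"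
    using f(3) unfolding fc zspan_scale .
  then have "codiff = zspan L.ndeg c"
    by (rule L.smul_inj[rotated]) (use q(1) in simp)
  moreover have "qindep L.ndeg c"
    unfolding qindep_def
  proof (intro allI impI)
    fix r i assume r: "(\<Sum>i<L.ndeg. of_rat (r i) * c i) = 0" and i: "i < L.ndeg"
    have "(\<Sum>i<L.ndeg. of_rat (r i) * f i) = of_int q * (\<Sum>i<L.ndeg. of_rat (r i) * c i)"
      unfolding fc by (simp add: sum_distrib_left mult_ac)
    then have "(\<Sum>i<L.ndeg. of_rat (r i) * f i) = 0"
      using r by simp
    then show "r i = 0"
      using f(1) i unfolding qindep_def by (elim allE[of _ r]) simp
  qed
  ultimately show thesis
    using that by blast
qed

text \<open>The integral basis consists of \<open>e\<close> and lifts \<open>x i\<close> of a basis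
  \<open>c\<close> of \<open>codiff\<close>. Removing the \<open>L\<close>-parts of the
  \<open>x i\<close> is a unipotent change of basis, after which the trace form is block diagonal:
  twice the form of \<open>L\<close> on \<open>e\<close>, and half the form
  \<open>L.tr (c i * (w * c j))\<close>. The factors \<open>2 ^ n\<close> and
  \<open>(1 / 2) ^ n\<close> cancel.\<close>

lemma discriminant_M: "\<bar>discriminant M\<bar> = (discriminant L)\<^sup>2 * of_nat (qidx L.ints rdisc)"
proof -
  let ?n = "L.ndeg"
  obtain e where e: "qindep ?n e" "qspan ?n e = L" "zspan ?n e = L.ints"
    by (rule L.ints_basis)
  obtain c where c: "qindep ?n c" "codiff = zspan ?n c"
    by (rule codiff_basis)
  have eL: "e i \<in> L" if "i < ?n" for i
    by (rule L.basis_mem[OF e(2) that])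
  have cC: "c i \<in> codiff" if "i < ?n" for i
    using zspan_base[OF that, of c] c(2) by simp
  have cL: "c i \<in> L" if "i < ?n" for i
    using cC[OF that] by (rule codiffE)
  have "\<forall>i. \<exists>x. i < ?n \<longrightarrow> x \<in> M.ints \<and> x - cj x = c i * s"
    using cC by (meson codiffE)
  then obtain x where x: "\<And>i. i < ?n \<Longrightarrow> x i \<in> M.ints" "\<And>i. i < ?n \<Longrightarrow> x i - cj (x i) = c i * s"
    by metis
  define \<alpha> where "\<alpha> i = (x i + cj (x i)) / 2" for i
  have \<alpha>L: "\<alpha> i \<in> L" if "i < ?n" for i
    unfolding \<alpha>_def by (intro L.K_divide L.K_numeral cj_trace_norm(1) M.ints_K x(1) that)
  have x_eq: "x i = \<alpha> i + c i / 2 * s" if "i < ?n" for i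
    unfolding \<alpha>_def using x(2)[OF that] by (simp add: field_simps)
  have c2: "qindep ?n (\<lambda>i. c i / 2)"
    unfolding qindep_def
  proof (intro allI impI)
    fix r i assume r: "(\<Sum>i<?n. of_rat (r i) * (c i / 2)) = 0" and i: "i < ?n"
    have "(\<Sum>i<?n. of_rat (r i) * (c i / 2)) = (\<Sum>i<?n. of_rat (r i) * c i) / 2"
      by (simp add: sum_divide_distrib)
    then have "(\<Sum>i<?n. of_rat (r i) * c i) = 0"
      using r by simp
    then show "r i = 0"
      using c(1) i unfolding qindep_def by (elim allE[of _ r]) simp
  qed
  have c2L: "c i / 2 \<in> L" if "i < ?n" for i
    by (intro L.K_divide L.K_numeral cL that)
  let ?G = "fam2 ?n e (\<lambda>i. \<alpha> i + c i / 2 * s)"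
  let ?H = "fam2 ?n e (\<lambda>i. 0 + c i / 2 * s)"
  have G_indep: "qindep (?n + ?n) ?G"
    by (rule qindep_fam2[OF e(1) c2 eL \<alpha>L c2L])
  have G_ints: "?G k \<in> M.ints" if "k < ?n + ?n" for k
  proof (cases "k < ?n")
    case True
    then show ?thesis
      using L_ints_M zspan_base[OF True, of e] e(3) by (simp add: fam2_def)
  next
    case False
    then have "k - ?n < ?n"
      using that by simp
    then show ?thesis
      using False x(1)[of "k - ?n"] x_eq[of "k - ?n"] by (simp add: fam2_def)
  qed
  have G_zspan: "zspan (?n + ?n) ?G = M.ints"
  proof
    show "zspan (?n + ?n) ?G \<subseteq> M.ints"
      by (rule zspan_subset[OF M.submodule_over_Ints[OF M.submodule_over_ints] G_ints])
    show "M.ints \<subseteq> zspan (?n + ?n) ?G"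
    proof
      fix y assume y: "y \<in> M.ints"
      obtain d where d: "d \<in> codiff" "y - cj y = d * s"
        by (rule ints_codiff[OF y])
      obtain r where r: "d = (\<Sum>i<?n. of_int (r i) * c i)"
        using d(1) c(2) by (metis zspanE)
      \<comment> \<open>\<open>cj_add\<close> is for two summands in \<open>M\<close>, so the sum is
        treated by induction and integrality is carried along.\<close>
      have sum_M: "(\<Sum>i<m. of_int (r i) * x i) \<in> M.ints
          \<and> (\<Sum>i<m. of_int (r i) * x i) - cj (\<Sum>i<m. of_int (r i) * x i) = (\<Sum>i<m. of_int (r i) * c i) * s"
        if "m \<le> ?n" for m
        using that
      proof (induction m)
        case 0
        then show ?case by (simp add: M.ints_zero cj_L L.K_zero)
      next
        case (Suc m)
        let ?S = "\<Sum>i<m. of_int (r i) * x i"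
        have S: "?S \<in> M.ints" "?S - cj ?S = (\<Sum>i<m. of_int (r i) * c i) * s"
          using Suc by auto
        have xm: "x m \<in> M.ints" "x m - cj (x m) = c m * s"
          using x Suc.prems by auto
        have rx: "of_int (r m) * x m \<in> M.ints"
          by (intro M.ints_mult M.ints_of_int xm)
        have rL: "(of_int (r m) :: 'a) \<in> L"
          by (rule L.K_of_int)
        have "cj (?S + of_int (r m) * x m) = cj ?S + of_int (r m) * cj (x m)"
          using cj_add[OF M.ints_K[OF S(1)] M.ints_K[OF rx]]
            cj_mult[OF subsetD[OF L_M rL] M.ints_K[OF xm(1)]] cj_L[OF rL] by simp
        then have "(?S + of_int (r m) * x m) - cj (?S + of_int (r m) * x m)
            = (?S - cj ?S) + of_int (r m) * (x m - cj (x m))"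
          by (simp add: algebra_simps)
        then show ?case
          unfolding S(2) xm(2) using M.ints_add[OF S(1) rx] by (simp add: algebra_simps)
      qed
      define S where "S = (\<Sum>i<?n. of_int (r i) * x i)"
      define z where "z = y - S"
      have S: "S \<in> M.ints" "S - cj S = d * s"
        using sum_M[OF order_refl] unfolding r S_def by auto
      have z: "z \<in> M.ints"
        unfolding z_def by (rule M.ints_diff[OF y S(1)])
      have h: "cj z + cj S = cj y"
        using cj_add[OF M.ints_K[OF z] M.ints_K[OF S(1)]] by (simp add: z_def)
      \<comment> \<open>\<open>y\<close> and \<open>S\<close> have the same difference
        \<open>d * s\<close>, which cancels, so \<open>z\<close> is fixed by conjugation and lies in
        \<open>L\<close>.\<close>
      have "cj z = (y - (y - cj y)) - (S - (S - cj S))"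
        using h by (simp add: eq_diff_eq)
      also have "\<dots> = z"
        unfolding S(2) d(2) by (simp add: z_def)
      finally have "cj z = z" .
      then have "z \<in> L.ints"
        by (intro M_ints_L z cj_fixed M.ints_K)
      then have "z \<in> zspan ?n e"
        unfolding e(3) .
      then obtain t where t: "z = (\<Sum>i<?n. of_int (t i) * e i)"
        by (rule zspanE)
      have S_eq: "S = (\<Sum>i<?n. of_int (r i) * (\<alpha> i + c i / 2 * s))"
        unfolding S_def by (rule sum.cong[OF refl]) (simp only: lessThan_iff x_eq)
      have "y = z + S"
        by (simp add: z_def)
      then have "y = (\<Sum>i<?n. of_int (t i) * e i) + (\<Sum>i<?n. of_int (r i) * (\<alpha> i + c i / 2 * s))"
        unfolding t S_eq .
      also have "\<dots> = (\<Sum>k<?n + ?n. of_int (if k < ?n then t k else r (k - ?n)) * ?G k)"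
        unfolding sum_fam2 by simp
      finally show "y \<in> zspan (?n + ?n) ?G"
        by (rule zspanI)
    qed
  qed
  have G_qspan: "qspan (?n + ?n) ?G = M"
  proof
    show "qspan (?n + ?n) ?G \<subseteq> M"
      by (rule qspan_subset[OF M.submodule_over_Rats_K M.ints_K[OF G_ints]])
    show "M \<subseteq> qspan (?n + ?n) ?G"
    proof
      fix y assume "y \<in> M"
      then obtain m :: int where m: "m > 0" "of_int m * y \<in> M.ints"
        by (rule M.ints_denominator)
      then have "of_int m * y \<in> qspan (?n + ?n) ?G"
        using zspan_subset_qspan[of "?n + ?n" ?G] G_zspan by auto
      from submodule_over_mult[OF submodule_over_qspan _ this, of "of_rat (1 / of_int m)"]
      show "y \<in> qspan (?n + ?n) ?G"
        using m(1) by (simp add: of_rat_divide)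
    qed
  qed
  have "\<forall>i. \<exists>R. i < ?n \<longrightarrow> \<alpha> i = (\<Sum>j<?n. of_rat (R j) * e j)"
    using \<alpha>L e(2) by (metis qspanE)
  then obtain R where R: "\<And>i. i < ?n \<Longrightarrow> \<alpha> i = (\<Sum>j<?n. of_rat (R i j) * e j)"
    by metis
  \<comment> \<open>\<open>?G\<close> arises from \<open>?H\<close> by adding the
    \<open>L\<close>-parts \<open>\<alpha> i\<close>, so the transition matrix is triangular with
    ones on the diagonal. \<open>?H\<close> need not consist of integers.\<close>
  define U where "U k j = (if k < ?n then (if k = j then 1 else 0)
      else (if j < ?n then R (k - ?n) j else if k = j then 1 else 0 :: rat))" for k j
  have GU: "?G k = (\<Sum>j<?n + ?n. of_rat (U k j) * ?H j)" if k: "k < ?n + ?n" for k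
  proof (cases "k < ?n")
    case True
    then show ?thesis
      unfolding sum_fam2
      by (simp add: U_def fam2_def if_distrib[of of_rat] if_distrib[of "\<lambda>x. x * _"] cong: if_cong)
  next
    case False
    then obtain i where i: "k = ?n + i" "i < ?n"
      using k by (metis add_less_cancel_left le_Suc_ex not_less)
    have 1: "(\<Sum>j<?n. of_rat (U k j) * e j) = \<alpha> i"
      using i R[OF i(2)] by (simp add: U_def)
    have 2: "(\<Sum>j<?n. of_rat (U k (?n + j)) * g j) = g i" for g :: "nat \<Rightarrow> 'a"
      using i by (simp add: U_def if_distrib[of of_rat] if_distrib[of "\<lambda>x. x * _"] cong: if_cong)
    show ?thesis
      unfolding sum_fam2 1 2 using i by (simp add: fam2_def)
  qed
  have "fdet (?n + ?n) U = (\<Prod>i<?n + ?n. U i i)"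
    by (rule fdet_lower_triangular) (auto simp: U_def)
  moreover have "U i i = 1" for i
    by (simp add: U_def)
  ultimately have U1: "fdet (?n + ?n) U = 1"
    by simp
  have H_M: "?H k \<in> M" if "k < ?n + ?n" for k
    using that eL L_M M_I[OF L.K_zero c2L] by (auto simp: fam2_def)
  have "discriminant M = fdet (?n + ?n) (\<lambda>i j. M.tr (?G i * ?G j))"
    using M.discriminant_eq[unfolded degree_M, OF G_indep G_qspan G_zspan] .
  also have "\<dots> = fdet (?n + ?n) U * fdet (?n + ?n) (\<lambda>i j. M.tr (?H i * ?H j)) * fdet (?n + ?n) U"
    by (rule M.trace_form_change[OF GU GU H_M H_M])
  also have "\<dots> = fdet (?n + ?n) (\<lambda>i j. M.tr (?H i * ?H j))"
    by (simp add: U1)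
  also have "\<dots> = fdet (?n + ?n) (\<lambda>i j. if i < ?n then (if j < ?n then 2 * L.tr (e i * e j) else 0)
      else (if j < ?n then 0 else (1 / 2) * L.tr (c (i - ?n) * (w * c (j - ?n)))))"
  proof (rule fdet_cong)
    fix i j assume ij: "i < ?n + ?n" "j < ?n + ?n"
    have t0: "M.tr (b * s) = 0" if "b \<in> L" for b
      using trace_M[OF L.K_zero that] L.tr_zero by simp
    have ta: "M.tr a = 2 * L.tr a" if "a \<in> L" for a
      using trace_M[OF that L.K_zero] by simp
    show "M.tr (?H i * ?H j) = (if i < ?n then (if j < ?n then 2 * L.tr (e i * e j) else 0)
      else (if j < ?n then 0 else (1 / 2) * L.tr (c (i - ?n) * (w * c (j - ?n)))))"
    proof (cases "i < ?n"; cases "j < ?n")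
      assume "i < ?n" "j < ?n"
      then show ?thesis
        by (simp add: fam2_def ta L.K_mult eL)
    next
      assume h: "i < ?n" "\<not> j < ?n"
      then have j: "j - ?n < ?n"
        using ij by simp
      have "M.tr (e i * (c (j - ?n) / 2) * s) = 0"
        by (intro t0 L.K_mult eL h(1) c2L j)
      then show ?thesis
        using h by (simp add: fam2_def mult_ac)
    next
      assume h: "\<not> i < ?n" "j < ?n"
      then have i: "i - ?n < ?n"
        using ij by simp
      have "M.tr (e j * (c (i - ?n) / 2) * s) = 0"
        by (intro t0 L.K_mult eL h(2) c2L i)
      then show ?thesis
        using h by (simp add: fam2_def mult_ac)
    next
      assume h: "\<not> i < ?n" "\<not> j < ?n"
      then have i: "i - ?n < ?n" and j: "j - ?n < ?n"
        using ij by auto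
      let ?p = "c (i - ?n) * (w * c (j - ?n))"
      have pL: "?p \<in> L"
        by (intro L.K_mult cL i j wL)
      \<comment> \<open>The two halved coefficients give \<open>1 / 4\<close>, and doubling by the
        trace of \<open>M\<close> leaves \<open>1 / 2\<close>.\<close>
      have "?H i * ?H j = of_rat (1 / 4) * ?p"
        using h by (simp add: fam2_def s2[symmetric] of_rat_divide mult_ac)
      then have "M.tr (?H i * ?H j) = M.tr (of_rat (1 / 4) * ?p)"
        by (simp only:)
      also have "\<dots> = 2 * L.tr (of_rat (1 / 4) * ?p)"
        by (intro ta L.K_mult[OF L.K_of_rat pL])
      also have "\<dots> = 1 / 2 * L.tr ?p"
        unfolding L.tr_of_rat_mult[OF pL] by simp
      finally show ?thesis
        using h by simp
    qed
  qed
  also have "\<dots> = fdet ?n (\<lambda>i j. 2 * L.tr (e i * e j)) * fdet ?n (\<lambda>i j. 1 / 2 * L.tr (c i * (w * c j)))"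
    by (rule fdet_block_diag)
  also have "\<dots> = discriminant L * fdet ?n (\<lambda>i j. L.tr (c i * (w * c j)))"
    unfolding fdet_smult L.discriminant_eq[OF e] by (simp add: power_divide)
  finally have disc: "discriminant M = discriminant L * fdet ?n (\<lambda>i j. L.tr (c i * (w * c j)))" .
  show ?thesis
    unfolding disc abs_mult fdet_codiff[OF c(2)]
    by (simp only: mult.assoc[symmetric] abs_mult_self_eq power2_eq_square)
qed

text \<open>The degree doubles and the absolute discriminant \<open>D\<close> becomes
  \<open>D^2 N\<close>, with \<open>N\<close> the index of \<open>rdisc\<close>. Written with the
  common exponent \<open>1 / (2 n)\<close>, the root discriminants agree only if
  \<open>D^2 N = D^2\<close>, that is, \<open>N = 1\<close>.\<close>

lemma root_discriminant_iff: "root_discriminant M = root_discriminant L \<longleftrightarrow> rdisc = L.ints"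
proof -
  let ?n = "L.ndeg"
  define D where "D = real_of_rat \<bar>discriminant L\<bar>"
  define N where "N = real (qidx L.ints rdisc)"
  have n: "?n > 0"
    by (rule L.deg_pos)
  have D: "D > 0"
    using L.discriminant_nonzero by (simp add: D_def)
  have "N > 0"
    using L.qidx_pos[OF L.nz_ideal_ints nz_ideal_rdisc L.int_idealD(2)[OF int_ideal_rdisc]] by (simp add: N_def)
  have "real_of_rat \<bar>discriminant M\<bar> = D\<^sup>2 * N"
  proof -
    have "D\<^sup>2 = real_of_rat (\<bar>discriminant L\<bar>\<^sup>2)"
      by (simp only: D_def of_rat_power)
    then show ?thesis
      unfolding discriminant_M N_def by (simp add: of_rat_mult)
  qed
  then have M: "root_discriminant M = (D\<^sup>2 * N) powr (1 / (2 * real ?n))"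
    unfolding root_discriminant_def degree_M by simp
  have "D\<^sup>2 = D powr 2"
    using D by simp
  then have "(D\<^sup>2) powr (1 / (2 * real ?n)) = D powr (1 / real ?n)"
    by (simp only: powr_powr) simp
  then have L: "root_discriminant L = (D\<^sup>2) powr (1 / (2 * real ?n))"
    unfolding root_discriminant_def D_def[symmetric] by simp
  have inj: "x = y" if "x > 0" "y > 0" "x powr r = y powr r" "r \<noteq> 0" for x y r :: real
  proof -
    have "(x powr r) powr (1 / r) = (y powr r) powr (1 / r)"
      using that by simp
    then show ?thesis
      using that(1,2,4) by (simp add: powr_powr)
  qed
  have "root_discriminant M = root_discriminant L \<longleftrightarrow> D\<^sup>2 * N = D\<^sup>2"
    unfolding M L using D n \<open>N > 0\<close> inj[of "D\<^sup>2 * N" "D\<^sup>2" "1 / (2 * real ?n)"] by auto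
  also have "\<dots> \<longleftrightarrow> N = 1"
    using D by simp
  also have "\<dots> \<longleftrightarrow> rdisc = L.ints"
    unfolding N_def using qidx_eq_1[OF L.int_idealD(3)[OF L.int_ideal_ints] L.int_idealD(3)[OF int_ideal_rdisc]
        L.int_idealD(2)[OF int_ideal_rdisc]] by simp
  finally show ?thesis .
qed

end

text \<open>If \<open>s \<in> L\<close> then \<open>adjoin L s = L\<close>, and \<open>\<beta> = 1 / s\<close> with the unit ideal satisfies the condition.\<close>

lemma (in nfield) adjoin_self:
  assumes "s \<in> K"
  shows "adjoin K s = K"
proof -
  interpret R: field "ring_of_type_algebra :: 'a ring"
    by (rule field_from_type_algebra)
  show ?thesis
    unfolding adjoin_def
  proof
    show "generate_field ring_of_type_algebra (insert s K) \<subseteq> K"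
      by (rule R.generate_field_min_subfield1[OF _ subfield_K]) (use assms in auto)
    show "K \<subseteq> generate_field ring_of_type_algebra (insert s K)"
      by (auto intro: generate_field.incl)
  qed
qed

text \<open>The only prime above \<open>P\<close> is \<open>P\<close> itself, and it is not
  contained in its square.\<close>

lemma (in nfield) unramified_self: "unramified_extension K K"
  unfolding unramified_extension_def
proof (intro allI impI)
  fix P Q assume h: "primeideal P (integer_ring K) \<and> P \<noteq> {0} \<and>
    primeideal Q (integer_ring K) \<and> Q \<inter> ints = P"
  then have P: "max_ideal P"
    using primeideal_integer_ring_iff by blast
  obtain p where p: "p \<in> P" "p \<noteq> 0"
    by (rule nz_ideal_witness[OF max_idealD(1)[OF P]])
  have "P \<subseteq> Q"
    using h by auto
  then have Q: "max_ideal Q"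
    using primeideal_integer_ring_iff h p by blast
  note Qi = max_idealD(2)[OF Q]
  have "Q = P"
    using h int_idealD(2)[OF Qi] by blast
  moreover have "\<not> Q \<subseteq> imul Q Q"
    using imul_proper[OF max_idealD(1)[OF Q] Qi max_idealD(3)[OF Q]] int_ideal_imul(2)[OF Qi Qi] by blast
  ultimately show "ramification_index K P Q = 1"
    using ramification_index_eq_1_iff[OF Q \<open>P \<subseteq> Q\<close> p] by simp
qed

lemma (in nfield) square_condition_square:
  assumes "s \<in> K" "s \<noteq> 0" "s\<^sup>2 = w"
  shows "square_condition K w (1 / s) ints"
  unfolding square_condition_iff
proof (intro conjI)
  have one: "(1 / s)\<^sup>2 * w = 1"
    using assms(2) unfolding assms(3)[symmetric] by (simp add: power_divide)
  show "1 / s \<in> K" "1 / s \<noteq> 0"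
    using assms by (auto intro: K_divide K_one)
  show "\<exists>z\<in>ints. (1 / s)\<^sup>2 * w = 1 + 4 * z"
    unfolding one by (rule bexI[OF _ ints_zero]) simp
  show "smul ((1 / s)\<^sup>2 * w) ints = imul ints ints"
    unfolding one imul_ints[OF submodule_over_ints] by (simp add: smul_def)
qed (rule int_ideal_ints)

text \<open>The generator \<open>1\<close> already yields all of \<open>ints\<close>; it remains
  that the other generators are integral.\<close>

lemma (in nfield) ints_square_condition_self:
  assumes sc: "square_condition K w \<beta> A" and s: "s \<in> K" "s\<^sup>2 = w"
  shows "ints = submodule_over ints hull
    ({1, (1 + \<beta> * s) / 2} \<union> {x * \<beta> * s | x. x \<in> inverse_ideal K A})"
    (is "_ = _ hull ?G")
proof
  interpret nfield_ext K K
    by unfold_locales simp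
  note gen = square_condition_generators[OF sc s]
  show "submodule_over ints hull ?G \<subseteq> ints"
    by (rule submodule_hull_minimal[OF _ submodule_over_ints]) (use gen ints_one in auto)
  show "ints \<subseteq> submodule_over ints hull ?G"
  proof
    fix x assume x: "x \<in> ints"
    have "1 \<in> submodule_over ints hull ?G"
      by (rule hull_inc) blast
    from submodule_over_mult[OF submodule_over_hull x this]
    show "x \<in> submodule_over ints hull ?G"
      by simp
  qed
qed

theorem theorem2p1:
  fixes L :: "'a::field_char_0 set" and w s :: 'a
  assumes "number_field L" and "w \<in> L" and "w \<noteq> 0" and "s\<^sup>2 = w"
  defines "L' \<equiv> adjoin L s"
  shows "(unramified_extension L L' \<longleftrightarrow> root_discriminant L' = root_discriminant L) \<and>
    (root_discriminant L' = root_discriminant L \<longleftrightarrow> (\<exists>\<beta> A. square_condition L w \<beta> A)) \<and>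
    (\<forall>\<beta> A. square_condition L w \<beta> A \<longrightarrow>
       integers_of L' =
         submodule_over (integers_of L) hull
           ({1, (1 + \<beta> * s) / 2} \<union> {x * \<beta> * s | x. x \<in> inverse_ideal L A}))"
proof (cases "s \<in> L")
  case True
  interpret nfield L
    by unfold_locales (rule assms(1))
  have "s \<noteq> 0"
    using assms(3,4) by auto
  have L': "L' = L"
    unfolding L'_def by (rule adjoin_self[OF True])
  show ?thesis
    unfolding L'
    using unramified_self square_condition_square[OF True \<open>s \<noteq> 0\<close> assms(4)]
      ints_square_condition_self[OF _ True assms(4)] by blast
next
  case False
  interpret quadratic L w s
    by unfold_locales (use assms(1,2,4) False in \<open>auto simp: power2_eq_square\<close>)
  have L': "L' = M"
    unfolding L'_def by (rule adjoin_eq)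
  have "unramified_extension L M \<longleftrightarrow> rdisc = L.ints"
    using rdisc_imp_unramified unramified_imp_rdisc by blast
  moreover have "(\<exists>\<beta> A. square_condition L w \<beta> A) \<longleftrightarrow> rdisc = L.ints"
    using square_condition_imp_rdisc rdisc_imp_square_condition by blast
  ultimately show ?thesis
    unfolding L' root_discriminant_iff using ints_square_condition by blast
qed

end
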